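(* For any positive integer $n$ there is an effectively computable number $\tau$ such that the following holds. If $q\ge5$, $G\subset F_q^*$ is a cyclic group of order $4$, and $\mathcal B$ is a system modulo $q$ such that for each $a\in G\setminus\{1\}$ the set $z(a,1)$ is nonempty, and $\bigcup_{a\in G\setminus\{1\}} z(a,1)$ consists of numbers with imaginary part $\ge\tau$ and contains at most $n$ elements, then $\mathcal B$ is a barrier for each of the following two statements about a family $\mathcal F=(F_{q,a})_{a\in F_q^*}$: (1) for all sufficiently large $x$ there exists $a\in G\setminus\{1\}$ with $F_{q,1}(x)\ge F_{q,a}(x)$; (2) for all sufficiently large $x$ there exists $a\in G\setminus\{1\}$ with $F_{q,1}(x)\le F_{q,a}(x)$. Consequently, when $q\in\{5,10\}$ there are no bounded barriers for the statement "for arbitrarily large $x$, $F_{q,1}(x)<F_{q,a}(x)$ for all $a\in F_q^*\setminus\{1\}$", and no bounded barriers for the statement "for arbitrarily large $x$, $F_{q,1}(x)>F_{q,a}(x)$ for all $a\in F_q^*\setminus\{1\}$".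
   Context: Let $q\ge 3$ be an integer, $F_q^*$ the multiplicative group of reduced residues modulo $q$, $\phi$ Euler's function, $C_q$ the set of non-principal Dirichlet characters modulo $q$, $\pi(x)$ the number of primes $\le x$. For complex $\rho$ with $\Re\rho>0$ and $x\ge 2$ put $$f(\rho)=\frac{x^{\rho}}{\rho\log x}+\frac1\rho\int_2^x\frac{t^\rho}{t\log^2 t}\,dt .$$ A system $\mathcal B$ (modulo $q$) assigns to each $\chi\in C_q$ a sequence $B(\chi)$ (possibly empty, repetitions allowed) of complex numbers with non-negative imaginary part; $n(\rho,\chi)$ is the number of occurrences of $\rho$ in $B(\chi)$ (0 if it does not occur). If $\rho$ is real it is required that $n(\rho,\chi)=n(\rho,\overline\chi)$. Put $R^+(\mathcal B)=\sup\{\Re\rho:\rho\in\mathcal B\}$, $R^-(\mathcal B)=\inf\{\Re\rho:\rho\in\mathcal B\}$. It is always assumed that $\frac12<R^-(\mathcal B)\le R^+(\mathcal B)\le 1$ and $\sum_{\chi\in C_q}\sum_{\rho\in B(\chi)} n(\rho,\chi)/|\rho|<\infty$ (sums are over distinct $\rho$). Define $$P_{q,a}(x;\mathcal B)=-\frac{2}{\phi(q)}\Re\Big(\sum_{\chi\in C_q}\overline\chi(a)\sum_{\rho\in B(\chi)}w(\rho)\,n(\rho,\chi) f(\rho)\Big)+\frac{\pi(x)}{\phi(q)},$$ where the inner sum is over distinct $\rho$, $w(\rho)=\frac12$ if $\rho$ is real and $w(\rho)=1$ otherwise. A family $\mathcal F=(F_{q,a})_{a\in F_q^*}$ of functions $[0,\infty)\to\mathbb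 R$ is $\beta$-similar to $\mathcal P_q=(P_{q,a}(\cdot;\mathcal B))_{a\in F_q^*}$ if $|F_{q,a}(x)-P_{q,a}(x;\mathcal B)|=o(x^\beta/\log x)$ as $x\to\infty$ for every $a$. For a statement $\mathcal I(\mathcal F)$ about such families, $\mathcal B$ is a barrier for $\mathcal I$ if, with $\beta=R^-(\mathcal B)$, for every $\mathcal F$ that is $\beta$-similar to $\mathcal P_q$ the statement $\mathcal I(\mathcal F)$ is false. For $a,b\in F_q^*$ let $g(\rho;a,b)=\sum_{\chi\in C_q}n(\rho,\chi)(\chi(a)-\chi(b))$, $\beta(a,b)=\sup\{\Re\rho: g(\rho;a,b)\ne0\}$, and $z(a,b)=\bigcup_{\chi\in C_q}\{\rho\in B(\chi): g(\rho;a,b)\ne 0,\ \Re\rho=\beta(a,b)\}$. If all $B(\chi)$ are finite, the size $|\mathcal B|$ is the total number of elements of the sequences $B(\chi)$, $\chi\in C_q$, counted with multiplicity. A statement $\mathcal I$ possesses a bounded barrier if there is a constant $K$ (independent of $\tau$) such that for every $\tau>0$ there is a barrier $\mathcal B$ for $\mathcal I$ with all $B(\chi)$ finite, $|\mathcal B|\le K$, and all points of all $B(\chi)$ having imaginary part $\ge\tau$. "For arbitrarily large $x$, $A(x)$" means the set of $x$ for which $A(x)$ holds is unbounded above. *)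

theory Defs
  imports
    "HOL-Analysis.Analysis"
    "HOL-Library.Landau_Symbols"
    "HOL-Number_Theory.Number_Theory"
    "HOL-Algebra.Elementary_Groups"
begin

text \<open>Reduced residues are represented by the integers coprime to \<open>q\<close> in \<open>{0..q - 1}\<close>.\<close>

abbreviation reduced_residues :: "nat \<Rightarrow> int monoid" where
  "reduced_residues q \<equiv> units_of (residue_ring (int q))"

text \<open>Dirichlet characters are periodic functions on all integers, vanishing exactly at the
  integers not coprime to the modulus. (\<open>\<psi> 1 = 1\<close> follows from the conditions below.)\<close>

definition dirichlet_character :: "nat \<Rightarrow> (int \<Rightarrow> complex) \<Rightarrow> bool" where
  "dirichlet_character q \<psi> \<longleftrightarrow>
     (\<forall>m n. \<psi> (m * n) = \<psi> m * \<psi> n) \<and>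
     (\<forall>m. \<psi> (m + int q) = \<psi> m) \<and>
     (\<forall>m. \<psi> m \<noteq> 0 \<longleftrightarrow> coprime m (int q))"

definition principal_character :: "nat \<Rightarrow> int \<Rightarrow> complex" where
  "principal_character q m = (if coprime m (int q) then 1 else 0)"

definition nonprincipal_characters :: "nat \<Rightarrow> (int \<Rightarrow> complex) set" where
  "nonprincipal_characters q = {\<psi>. dirichlet_character q \<psi> \<and> \<psi> \<noteq> principal_character q}"

definition primes_upto_count :: "real \<Rightarrow> nat" where
  "primes_upto_count x = card {p :: nat. prime p \<and> real p \<le> x}"

definition zero_term :: "real \<Rightarrow> complex \<Rightarrow> complex" where
  "zero_term x \<rho> =
     of_real x powr \<rho> / (\<rho> * of_real (ln x)) +
     1 / \<rho> * integral {2..x} (\<lambda>t. of_real t powr \<rho> / (of_real t * (of_real (ln t))\<^sup>2))"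


subsection \<open>Systems\<close>

datatype complex_seq = Finite_Seq "complex list" | Infinite_Seq "nat \<Rightarrow> complex"

fun occurrences :: "complex_seq \<Rightarrow> complex \<Rightarrow> nat set" where
  "occurrences (Finite_Seq xs) \<rho> = {k. k < length xs \<and> xs ! k = \<rho>}"
| "occurrences (Infinite_Seq s) \<rho> = {k. s k = \<rho>}"

fun seq_points :: "complex_seq \<Rightarrow> complex set" where
  "seq_points (Finite_Seq xs) = set xs"
| "seq_points (Infinite_Seq s) = range s"

fun finite_seq :: "complex_seq \<Rightarrow> bool" where
  "finite_seq (Finite_Seq xs) \<longleftrightarrow> True"
| "finite_seq (Infinite_Seq s) \<longleftrightarrow> False"

text \<open>The value on infinite sequences is irrelevant: sizes are only used for finite ones.\<close>

fun seq_length :: "complex_seq \<Rightarrow> nat" where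
  "seq_length (Finite_Seq xs) = length xs"
| "seq_length (Infinite_Seq s) = 0"

text \<open>Only the values of a system at the non-principal characters modulo \<open>q\<close> are ever used.\<close>

type_synonym system = "(int \<Rightarrow> complex) \<Rightarrow> complex_seq"

definition multiplicity_in :: "system \<Rightarrow> complex \<Rightarrow> (int \<Rightarrow> complex) \<Rightarrow> nat" where
  "multiplicity_in B \<rho> \<psi> = card (occurrences (B \<psi>) \<rho>)"

definition system_points :: "nat \<Rightarrow> system \<Rightarrow> complex set" where
  "system_points q B = (\<Union>\<psi>\<in>nonprincipal_characters q. seq_points (B \<psi>))"

definition R_plus :: "nat \<Rightarrow> system \<Rightarrow> real" where
  "R_plus q B = Sup (Re ` system_points q B)"

definition R_minus :: "nat \<Rightarrow> system \<Rightarrow> real" where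
  "R_minus q B = Inf (Re ` system_points q B)"

text \<open>Nonemptiness and boundedness are part of \<open>1/2 < R\<^sup>- \<le> R\<^sup>+ \<le> 1\<close> when supremum and infimum
  are read in the extended reals; they have to be stated since \<open>Sup\<close> and \<open>Inf\<close> on \<open>real\<close> are
  unspecified otherwise. Likewise, finiteness of all multiplicities is part of
  the convergence of \<open>\<Sum> n(\<rho>, \<psi>) / |\<rho>|\<close>, but \<open>card\<close> is \<open>0\<close> on infinite sets.\<close>

definition is_system :: "nat \<Rightarrow> system \<Rightarrow> bool" where
  "is_system q B \<longleftrightarrow>
     (\<forall>\<rho>\<in>system_points q B. Im \<rho> \<ge> 0) \<and>
     (\<forall>\<psi>\<in>nonprincipal_characters q. \<forall>\<rho>\<in>\<real>.
        multiplicity_in B \<rho> \<psi> = multiplicity_in B \<rho> (\<lambda>m. cnj (\<psi> m))) \<and>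
     system_points q B \<noteq> {} \<and>
     bdd_below (Re ` system_points q B) \<and> bdd_above (Re ` system_points q B) \<and>
     1 / 2 < R_minus q B \<and> R_minus q B \<le> R_plus q B \<and> R_plus q B \<le> 1 \<and>
     (\<forall>\<psi>\<in>nonprincipal_characters q.
        (\<forall>\<rho>\<in>seq_points (B \<psi>). finite (occurrences (B \<psi>) \<rho>)) \<and>
        (\<lambda>\<rho>. real (multiplicity_in B \<rho> \<psi>) / cmod \<rho>) summable_on seq_points (B \<psi>))"

definition weight :: "complex \<Rightarrow> real" where
  "weight \<rho> = (if \<rho> \<in> \<real> then 1 / 2 else 1)"

definition model_count :: "nat \<Rightarrow> system \<Rightarrow> int \<Rightarrow> real \<Rightarrow> real" where
  "model_count q B a x =
     - 2 / real (totient q) *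
       Re (\<Sum>\<psi>\<in>nonprincipal_characters q. cnj (\<psi> a) *
             (\<Sum>\<^sub>\<infinity>\<rho>\<in>seq_points (B \<psi>).
                of_real (weight \<rho>) * of_nat (multiplicity_in B \<rho> \<psi>) * zero_term x \<rho>)) +
     real (primes_upto_count x) / real (totient q)"


subsection \<open>Barriers\<close>

text \<open>A family of functions on \<open>[0, \<infinity>)\<close> indexed by reduced residues is a function of type
  \<^typ>\<open>int \<Rightarrow> real \<Rightarrow> real\<close>; its values at other integers or negative reals play no role.\<close>

type_synonym family = "int \<Rightarrow> real \<Rightarrow> real"

definition similar_family :: "nat \<Rightarrow> real \<Rightarrow> family \<Rightarrow> system \<Rightarrow> bool" where
  "similar_family q \<beta> F B \<longleftrightarrow>
     (\<forall>a\<in>carrier (reduced_residues q).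
        (\<lambda>x. \<bar>F a x - model_count q B a x\<bar>) \<in> o[at_top](\<lambda>x. x powr \<beta> / ln x))"

definition barrier :: "nat \<Rightarrow> (family \<Rightarrow> bool) \<Rightarrow> system \<Rightarrow> bool" where
  "barrier q I B \<longleftrightarrow>
     is_system q B \<and> (\<forall>F. similar_family q (R_minus q B) F B \<longrightarrow> \<not> I F)"

definition system_size :: "nat \<Rightarrow> system \<Rightarrow> nat" where
  "system_size q B = (\<Sum>\<psi>\<in>nonprincipal_characters q. seq_length (B \<psi>))"

definition possesses_bounded_barrier :: "nat \<Rightarrow> (family \<Rightarrow> bool) \<Rightarrow> bool" where
  "possesses_bounded_barrier q I \<longleftrightarrow>
     (\<exists>K. \<forall>\<tau>>0. \<exists>B. barrier q I B \<and>
        (\<forall>\<psi>\<in>nonprincipal_characters q. finite_seq (B \<psi>)) \<and>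
        system_size q B \<le> K \<and>
        (\<forall>\<rho>\<in>system_points q B. Im \<rho> \<ge> \<tau>))"

definition g_diff :: "nat \<Rightarrow> system \<Rightarrow> complex \<Rightarrow> int \<Rightarrow> int \<Rightarrow> complex" where
  "g_diff q B \<rho> a b =
     (\<Sum>\<psi>\<in>nonprincipal_characters q. of_nat (multiplicity_in B \<rho> \<psi>) * (\<psi> a - \<psi> b))"

definition beta_diff :: "nat \<Rightarrow> system \<Rightarrow> int \<Rightarrow> int \<Rightarrow> real" where
  "beta_diff q B a b = Sup {Re \<rho> |\<rho>. g_diff q B \<rho> a b \<noteq> 0}"

definition z_diff :: "nat \<Rightarrow> system \<Rightarrow> int \<Rightarrow> int \<Rightarrow> complex set" where
  "z_diff q B a b =
     (\<Union>\<psi>\<in>nonprincipal_characters q.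
        {\<rho> \<in> seq_points (B \<psi>). g_diff q B \<rho> a b \<noteq> 0 \<and> Re \<rho> = beta_diff q B a b})"


subsection \<open>Effective computability\<close>

text \<open>\<open>recursive k f\<close>: on argument lists of length \<open>k\<close>, \<open>f\<close> is a total \<open>\<mu>\<close>-recursive function
  (minimization is only applied when it always terminates). Values of \<open>f\<close> at lists of other
  lengths are meaningless.\<close>

inductive recursive :: "nat \<Rightarrow> (nat list \<Rightarrow> nat) \<Rightarrow> bool" where
  zero: "recursive k (\<lambda>xs. 0)"
| succ: "recursive 1 (\<lambda>xs. Suc (xs ! 0))"
| proj: "i < k \<Longrightarrow> recursive k (\<lambda>xs. xs ! i)"
| comp: "recursive (length gs) f \<Longrightarrow> (\<forall>g\<in>set gs. recursive k g) \<Longrightarrow>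
         recursive k (\<lambda>xs. f (map (\<lambda>g. g xs) gs))"
| prim_rec: "recursive k f \<Longrightarrow> recursive (Suc (Suc k)) g \<Longrightarrow>
         recursive (Suc k) (\<lambda>xs. rec_nat (f (tl xs)) (\<lambda>y r. g (y # r # tl xs)) (hd xs))"
| minimization: "recursive (Suc k) f \<Longrightarrow> (\<forall>xs. length xs = k \<longrightarrow> (\<exists>y. f (y # xs) = 0)) \<Longrightarrow>
         recursive k (\<lambda>xs. LEAST y. f (y # xs) = 0)"

text \<open>A sequence of reals is computable if a rational approximation of the \<open>n\<close>-th term with error
  at most \<open>1 / (k + 1)\<close> can be computed uniformly in \<open>n\<close> and \<open>k\<close>.\<close>

definition computable_real_seq :: "(nat \<Rightarrow> real) \<Rightarrow> bool" where
  "computable_real_seq \<tau> \<longleftrightarrow>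
     (\<exists>f g. recursive 2 f \<and> recursive 2 g \<and>
        (\<forall>n k. \<bar>\<tau> n - (real (f [n, k]) - real (g [n, k])) / real (k + 1)\<bar> \<le> 1 / real (k + 1)))"

end

theory Submission
  imports Defs "HOL-Real_Asymp.Real_Asymp"
begin

text \<open>Let \<open>g\<close> generate the group \<open>G\<close> of order four and put \<open>u = ln x\<close>. For \<open>a \<noteq> 1\<close> in \<open>G\<close> the difference
\<open>F 1 x - F a x\<close> is, up to the factor \<open>2 x\<^sup>\<beta> / (\<phi>(q) ln x)\<close> with \<open>\<beta> = \<beta>(a, 1)\<close> and an error tending to
\<open>0\<close>, the leading sum \<open>Re (\<Sum> cnj g(\<rho>; a, 1) cis (u Im \<rho>) / \<rho>)\<close> over \<open>\<rho> \<in> z(a, 1)\<close>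
(lemma \<open>family_difference_asymptotics\<close>). Leading sums are almost periodic in \<open>u\<close>, so strict signs which
they have at one real \<open>u\<close> recur at arbitrarily large \<open>u\<close> (lemma \<open>leading_sums_recurrent\<close>). Hence both
barriers follow once there is one \<open>u\<close> at which the three leading sums are negative and another one at
which they are positive.

A character takes a fourth root of unity at \<open>g\<close>. Let \<open>N\<^sub>k\<close> be the number of occurrences of \<open>\<rho>\<close>, whose
imaginary part is \<open>\<gamma>\<close>, at characters with value \<open>\<i>\<^sup>k\<close>, and put \<open>a = N\<^sub>1 + N\<^sub>3\<close>, \<open>b = 2 N\<^sub>2\<close>, \<open>c = N\<^sub>1 - N\<^sub>3\<close>.
Then \<open>g(\<rho>; g\<^sup>2, 1) = - 2 a\<close>, while \<open>g(\<rho>; g, 1) = - (a + b) + \<i> c\<close>, and \<open>g(\<rho>; g\<^sup>3, 1)\<close> is its conjugate.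
Replacing \<open>1 / \<rho>\<close> by \<open>1 / (\<i> \<gamma>)\<close> costs a relative error of order \<open>1 / \<tau>\<close> and turns the leading sums for
\<open>g\<^sup>2\<close>, \<open>g\<close>, \<open>g\<^sup>3\<close> into \<open>- 2 X\<close>, \<open>- (X + Y) - Z\<close>, \<open>- (X + Y) + Z\<close>, where \<open>X\<close>, \<open>Y\<close> are sine sums with the nonnegative
coefficients \<open>a / \<gamma>\<close>, \<open>b / \<gamma>\<close> and \<open>Z\<close> is the cosine sum with coefficients \<open>c / \<gamma>\<close>. So the task is to find \<open>u\<close>
with \<open>X > 0\<close> and \<open>X + Y > \<bar>Z\<bar>\<close>, with a margin that depends only on the number \<open>n\<close> of terms; replacing \<open>u\<close>
by \<open>- u\<close> then gives the opposite signs. The frequencies may satisfy linear relations, so the phases cannot be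
prescribed independently.

The key is the quadratic form \<open>Q = X\<^sup>2 + 2 X Y - Z\<^sup>2 = 2 X (X + Y) - X\<^sup>2 - Z\<^sup>2\<close>. As \<open>\<bar>c\<bar> \<le> a\<close>, its mean
value over \<open>u\<close> is nonnegative. On the other hand \<open>Q > 0\<close> forces \<open>X\<close> and \<open>X + Y\<close> to have the same sign and,
by the inequality between the arithmetic and the geometric mean, \<open>\<bar>X + Y\<bar> > \<bar>Z\<bar>\<close>; since \<open>X\<close> and \<open>Y\<close> are odd
and \<open>Z\<close> is even, \<open>u\<close> or \<open>- u\<close> is as required. For a margin, \<open>Q\<close> is averaged against \<open>1 - cos (l u)\<close>, where
\<open>l\<close> is the sum of two frequencies of the sums: this adds a positive contribution of these two frequencies and
loses only products involving a frequency above both (lemma \<open>quadratic_form_large\<close>). Choosing a frequency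
whose coefficients outweigh those of all higher ones (lemma \<open>dominating_index\<close>) bounds the mean below by an
explicit function of \<open>n\<close>. This yields lemma \<open>sine_cosine_domination\<close> and the value \<open>threshold n\<close> of the
computable bound \<open>\<tau>\<close>. If \<open>z(g\<^sup>2, 1)\<close> and \<open>z(g, 1)\<close> are disjoint, then \<open>X\<close> and \<open>Y\<close> belong to
different points and \<open>Z\<close> vanishes; in this case \<open>X > 0\<close> and \<open>Y > 0\<close> are needed separately, which is the same
lemma applied after scaling \<open>X\<close> down (lemma \<open>two_sine_sums_positive\<close>).

Modulo \<open>5\<close> and \<open>10\<close> all reduced residues form a cyclic group of order four. A bounded barrier with large
imaginary parts then satisfies the hypotheses of the first part, unless \<open>z(g\<^sup>2, 1)\<close> is empty. In
that case the model functions at \<open>1\<close> and at \<open>g\<^sup>2\<close> coincide, and moving the function at \<open>1\<close> by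
\<open>x\<^sup>r / (ln x)\<^sup>2\<close>, \<open>r = R_minus q B\<close>, which similarity tolerates, breaks the tie in the desired direction.\<close>

section \<open>Mean values of trigonometric sums\<close>

text \<open>The Bohr mean of an almost periodic function. Continuity is included so that the integrals exist and means can be added.\<close>

definition has_mean :: "(real \<Rightarrow> real) \<Rightarrow> real \<Rightarrow> bool" where
  "has_mean f c \<longleftrightarrow> continuous_on UNIV f \<and> ((\<lambda>S. integral {0..S} f / S) \<longlongrightarrow> c) at_top"

lemma has_mean_integrable:
  assumes "has_mean f c"
  shows "f integrable_on {0..S}"
  using assms unfolding has_mean_def
  by (meson continuous_on_subset integrable_continuous_real subset_UNIV)

lemma has_mean_add:
  assumes "has_mean f c" "has_mean g d"
  shows "has_mean (\<lambda>u. f u + g u) (c + d)"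
proof -
  have "((\<lambda>S. integral {0..S} f / S + integral {0..S} g / S) \<longlongrightarrow> c + d) at_top"
    using assms by (intro tendsto_add) (auto simp: has_mean_def)
  moreover have "integral {0..S} (\<lambda>u. f u + g u) = integral {0..S} f + integral {0..S} g" for S
    by (intro integral_add has_mean_integrable[OF assms(1)] has_mean_integrable[OF assms(2)])
  ultimately show ?thesis
    using assms by (auto simp: has_mean_def add_divide_distrib intro!: continuous_intros)
qed

lemma has_mean_cmult:
  assumes "has_mean f c"
  shows "has_mean (\<lambda>u. k * f u) (k * c)"
proof -
  have "((\<lambda>S. k * (integral {0..S} f / S)) \<longlongrightarrow> k * c) at_top"
    using assms by (intro tendsto_mult_left) (auto simp: has_mean_def)
  then show ?thesis
    using assms by (auto simp: has_mean_def intro!: continuous_intros)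
qed

lemma has_mean_sum:
  assumes "\<And>i. i \<in> I \<Longrightarrow> has_mean (f i) (c i)"
  shows "has_mean (\<lambda>u. \<Sum>i\<in>I. f i u) (\<Sum>i\<in>I. c i)"
proof -
  have zero: "has_mean (\<lambda>u. 0) 0"
    by (simp add: has_mean_def)
  show ?thesis
    using assms
  proof (induction I rule: infinite_finite_induct)
    case (insert i I)
    then show ?case by (simp add: has_mean_add)
  qed (simp_all add: zero)
qed

lemma has_mean_cos:
  "has_mean (\<lambda>u. cos (l * u)) (if l = 0 then 1 else 0)"
proof (cases "l = 0")
  case True
  have "\<forall>\<^sub>F S in at_top. integral {0..S} (\<lambda>u::real. 1::real) / S = 1"
    using eventually_gt_at_top[of "0::real"] by eventually_elim simp
  then have "((\<lambda>S. integral {0..S} (\<lambda>u::real. 1::real) / S) \<longlongrightarrow> 1) at_top"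
    by (rule tendsto_eventually)
  then show ?thesis using True by (simp add: has_mean_def)
next
  case False
  have int: "integral {0..S} (\<lambda>u. cos (l * u)) = sin (l * S) / l" if "S \<ge> 0" for S
  proof -
    have "((\<lambda>u. cos (l * u)) has_integral sin (l * S) / l - sin (l * 0) / l) {0..S}"
      using that False
      by (intro fundamental_theorem_of_calculus)
        (auto simp flip: has_real_derivative_iff_has_vector_derivative
              intro!: derivative_eq_intros)
    then show ?thesis by (simp add: integral_unique)
  qed
  have "((\<lambda>S. inverse S * (1 / \<bar>l\<bar>)) \<longlongrightarrow> 0 * (1 / \<bar>l\<bar>)) at_top"
    by (intro tendsto_mult_right tendsto_inverse_0_at_top filterlim_ident)
  then have lim: "((\<lambda>S. inverse S * (1 / \<bar>l\<bar>)) \<longlongrightarrow> 0) at_top" by simp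
  have "((\<lambda>S. integral {0..S} (\<lambda>u. cos (l * u)) / S) \<longlongrightarrow> 0) at_top"
  proof (rule Lim_null_comparison[OF _ lim])
    show "\<forall>\<^sub>F S in at_top. norm (integral {0..S} (\<lambda>u. cos (l * u)) / S) \<le> inverse S * (1 / \<bar>l\<bar>)"
      using eventually_gt_at_top[of 0]
    proof eventually_elim
      case (elim S)
      then have "norm (integral {0..S} (\<lambda>u. cos (l * u)) / S) = \<bar>sin (l * S)\<bar> / \<bar>l\<bar> / S"
        by (simp add: int abs_mult)
      also have "\<dots> \<le> 1 / \<bar>l\<bar> / S"
        using elim by (intro divide_right_mono) auto
      finally show ?case using elim by (simp add: field_simps)
    qed
  qed
  then show ?thesis using False by (simp add: has_mean_def continuous_intros)
qed

lemma has_mean_attained: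
  assumes "has_mean f c" "c' < c"
  obtains u where "f u > c'"
proof (rule ccontr)
  assume neg: "\<not> thesis"
  have le: "f u \<le> c'" for u using neg that by (meson not_le)
  have "\<forall>\<^sub>F S in at_top. integral {0..S} f / S \<le> c'"
    using eventually_gt_at_top[of 0]
  proof eventually_elim
    case (elim S)
    have "integral {0..S} f \<le> integral {0..S} (\<lambda>_. c')"
      by (intro integral_le has_mean_integrable[OF assms(1)]) (auto simp: le)
    then show ?case using elim by (simp add: field_simps)
  qed
  moreover have "((\<lambda>S. integral {0..S} f / S) \<longlongrightarrow> c) at_top"
    using assms by (simp add: has_mean_def)
  ultimately have "c \<le> c'" by (intro tendsto_upperbound[of _ c at_top]) auto
  then show False using assms by simp
qed

lemma quadratic_form_expansion:
  fixes f a b c :: "'i \<Rightarrow> real" and I :: "'i set"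
  defines "X \<equiv> \<lambda>u. \<Sum>i\<in>I. a i * sin (f i * u)"
    and "Y \<equiv> \<lambda>u. \<Sum>i\<in>I. b i * sin (f i * u)"
    and "Z \<equiv> \<lambda>u. \<Sum>i\<in>I. c i * cos (f i * u)"
  shows "X u ^ 2 + 2 * X u * Y u - Z u ^ 2 =
     (\<Sum>i\<in>I. \<Sum>j\<in>I.
        (a i * a j + 2 * a i * b j - c i * c j) / 2 * cos ((f i - f j) * u)
      - (a i * a j + 2 * a i * b j + c i * c j) / 2 * cos ((f i + f j) * u))"
proof -
  have 1: "sin (f i * u) * sin (f j * u) = (cos ((f i - f j) * u) - cos ((f i + f j) * u)) / 2" for i j
    by (simp add: cos_add cos_diff algebra_simps)
  have 2: "cos (f i * u) * cos (f j * u) = (cos ((f i - f j) * u) + cos ((f i + f j) * u)) / 2" for i j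
    by (simp add: cos_add cos_diff algebra_simps)
  have "X u ^ 2 + 2 * X u * Y u - Z u ^ 2 =
      (\<Sum>i\<in>I. \<Sum>j\<in>I. (a i * a j + 2 * a i * b j) * (sin (f i * u) * sin (f j * u))
        - c i * c j * (cos (f i * u) * cos (f j * u)))"
    unfolding X_def Y_def Z_def power2_eq_square
    by (simp add: sum_product sum_subtractf sum.distrib distrib_left distrib_right
        sum_distrib_left sum_distrib_right algebra_simps)
  also have "\<dots> = (\<Sum>i\<in>I. \<Sum>j\<in>I.
        (a i * a j + 2 * a i * b j - c i * c j) / 2 * cos ((f i - f j) * u)
      - (a i * a j + 2 * a i * b j + c i * c j) / 2 * cos ((f i + f j) * u))"
    unfolding 1 2 by (intro sum.cong refl) (simp add: field_simps)
  finally show ?thesis .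
qed

lemma cos_times_weight:
  "cos (x * u) * (1 - cos (l * u)) =
     cos (x * u) + ((-1/2) * cos ((x - l) * u) + (-1/2) * cos ((x + l) * u))" for x u l :: real
  by (simp add: cos_add cos_diff algebra_simps)

lemma has_mean_cos_times_weight:
  "has_mean (\<lambda>u. cos (x * u) * (1 - cos (l * u)))
     ((if x = 0 then 1 else 0) + ((-1/2) * (if x - l = 0 then 1 else 0)
       + (-1/2) * (if x + l = 0 then 1 else 0)))"
  unfolding cos_times_weight
  by (intro has_mean_add has_mean_cmult has_mean_cos)

text \<open>Only products whose combined frequency vanishes survive averaging over \<open>u\<close>. In the mean of the quadratic form
itself these are the products of equal frequencies with \<open>cos ((f i - f j) u)\<close>, whose coefficients are nonnegative
because \<open>\<bar>c i\<bar> \<le> a i\<close>. The factor \<open>1 - cos (l u)\<close> with \<open>l = f s + f s'\<close> brings in the terms with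
\<open>f i + f j = l\<close>, all of which contribute with the favourable sign, and those with \<open>f i - f j = \<plusminus> l\<close>, for which one
of the two frequencies exceeds \<open>l > f s\<close>; the latter are bounded by the coefficient sums over \<open>H\<close>. The pair
\<open>(i, j)\<close> is either order of \<open>s\<close>, \<open>s'\<close>, since the product \<open>a i * b j\<close> is not symmetric.\<close>

lemma quadratic_form_large:
  fixes f a b c :: "'i \<Rightarrow> real" and I :: "'i set" and s s' :: 'i
  defines "X \<equiv> \<lambda>u. \<Sum>i\<in>I. a i * sin (f i * u)"
    and "Y \<equiv> \<lambda>u. \<Sum>i\<in>I. b i * sin (f i * u)"
    and "Z \<equiv> \<lambda>u. \<Sum>i\<in>I. c i * cos (f i * u)"
    and "H \<equiv> {i \<in> I. f i > f s}"
  assumes fin: "finite I" and pos: "\<And>i. i \<in> I \<Longrightarrow> f i > 0"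
    and a: "\<And>i. i \<in> I \<Longrightarrow> a i \<ge> 0" and b: "\<And>i. i \<in> I \<Longrightarrow> b i \<ge> 0"
    and c: "\<And>i. i \<in> I \<Longrightarrow> \<bar>c i\<bar> \<le> a i"
    and s: "s \<in> I" "s' \<in> I" "(i, j) = (s, s') \<or> (i, j) = (s', s)"
    and M: "2 * M < ((a i * a j + 2 * a i * b j + c i * c j) / 2
        - sum a H * (sum a I + sum b I) - sum a I * (sum a H + sum b H)) / 2"
    and "M \<ge> 0"
  obtains u where "X u ^ 2 + 2 * X u * Y u - Z u ^ 2 > M"
proof -
  define l where "l = f s + f s'"
  define P where "P i j = (a i * a j + 2 * a i * b j - c i * c j) / 2" for i j
  define R where "R i j = (a i * a j + 2 * a i * b j + c i * c j) / 2" for i j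
  define d :: "real \<Rightarrow> real" where "d x = (if x = 0 then 1 else 0)" for x
  define e where "e x = d x + ((-1/2) * d (x - l) + (-1/2) * d (x + l))" for x
  have cc: "\<bar>c i * c j\<bar> \<le> a i * a j" if "i \<in> I" "j \<in> I" for i j
    unfolding abs_mult using that a c by (intro mult_mono) auto
  have P0: "P i j \<ge> 0" and R0: "R i j \<ge> 0" and Ple: "P i j \<le> a i * (a j + b j)"
    if "i \<in> I" "j \<in> I" for i j
  proof -
    have "a i * b j \<ge> 0" using that a b by simp
    then show "P i j \<ge> 0" "R i j \<ge> 0" "P i j \<le> a i * (a j + b j)"
      using cc[OF that] by (auto simp: P_def R_def algebra_simps)
  qed
  have mean: "has_mean (\<lambda>u. (X u ^ 2 + 2 * X u * Y u - Z u ^ 2) * (1 - cos (l * u)))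
     (\<Sum>i\<in>I. \<Sum>j\<in>I. P i j * e (f i - f j) + (- R i j) * e (f i + f j))"
  proof -
    have "X u ^ 2 + 2 * X u * Y u - Z u ^ 2 =
       (\<Sum>i\<in>I. \<Sum>j\<in>I. P i j * cos ((f i - f j) * u) - R i j * cos ((f i + f j) * u))" for u
      unfolding X_def Y_def Z_def P_def R_def by (rule quadratic_form_expansion)
    then have "(X u ^ 2 + 2 * X u * Y u - Z u ^ 2) * (1 - cos (l * u)) =
       (\<Sum>i\<in>I. \<Sum>j\<in>I. P i j * (cos ((f i - f j) * u) * (1 - cos (l * u)))
          + (- R i j) * (cos ((f i + f j) * u) * (1 - cos (l * u))))" for u
      by (simp only: sum_distrib_right) (intro sum.cong refl, simp only: algebra_simps)
    then show ?thesis
      unfolding e_def d_def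
      by (simp only:) (intro has_mean_sum has_mean_add has_mean_cmult has_mean_cos_times_weight)
  qed
  have H: "finite H" "H \<subseteq> I" using fin by (auto simp: H_def)
  define h where "h i = (if i \<in> H then 1 else 0::real)" for i
  \<comment> \<open>The diagonal terms are nonnegative and are dropped; the gain comes from \<open>f i + f j = l\<close>.\<close>
  have term_ge: "P i j * e (f i - f j) + (- R i j) * e (f i + f j) \<ge>
      R i j * d (f i + f j - l) / 2 - a i * h i * (a j + b j) / 2 - a i * (h j * (a j + b j)) / 2"
    if ij: "i \<in> I" "j \<in> I" for i j
  proof -
    have fpos: "f i > 0" "f j > 0" "f s > 0" "f s' > 0" using ij s pos by auto
    then have l: "l > 0" "l > f s" by (auto simp: l_def)
    have dp: "d (f i + f j) = 0" "d (f i + f j + l) = 0" "d (f i - f j) \<ge> 0"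
      using fpos l by (auto simp: d_def)
    have d1: "d (f i - f j - l) \<le> h i" "d (f i - f j + l) \<le> h j"
      using fpos l ij by (auto simp: d_def h_def H_def)
    have h0: "h i \<ge> 0" "h j \<ge> 0" by (auto simp: h_def)
    have "P i j * d (f i - f j - l) \<le> a i * (a j + b j) * h i"
      using d1 P0[OF ij] Ple[OF ij] by (intro mult_mono) (auto simp: d_def intro: order_trans)
    moreover have "P i j * d (f i - f j + l) \<le> a i * (a j + b j) * h j"
      using d1 P0[OF ij] Ple[OF ij] by (intro mult_mono) (auto simp: d_def intro: order_trans)
    moreover have "P i j * d (f i - f j) \<ge> 0" using dp P0[OF ij] by simp
    moreover have "P i j * e (f i - f j) + (- R i j) * e (f i + f j) =
        P i j * d (f i - f j) - P i j * d (f i - f j - l) / 2 - P i j * d (f i - f j + l) / 2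
          + R i j * d (f i + f j - l) / 2"
      unfolding e_def dp by (simp add: ring_distribs)
    moreover have "a i * h i * (a j + b j) = a i * (a j + b j) * h i"
      "a i * (h j * (a j + b j)) = a i * (a j + b j) * h j"
      by (simp_all only: mult_ac)
    ultimately show ?thesis by linarith
  qed
  have sum_h: "(\<Sum>i\<in>I. g i * h i) = sum g H" for g
  proof -
    have "(\<Sum>i\<in>I. g i * h i) = (\<Sum>i\<in>H. g i * h i)"
      using H fin by (intro sum.mono_neutral_right) (auto simp: h_def)
    then show ?thesis by (simp add: h_def)
  qed
  have R_ge: "(\<Sum>i\<in>I. \<Sum>j\<in>I. R i j * d (f i + f j - l)) \<ge> R i j" 
  proof -
    have ij: "i \<in> I" "j \<in> I" using s by auto
    have "R i j = R i j * d (f i + f j - l)" using s by (auto simp: d_def l_def)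
    also have "\<dots> \<le> (\<Sum>j\<in>I. R i j * d (f i + f j - l))"
      using ij fin R0 by (intro member_le_sum) (auto simp: d_def)
    also have "\<dots> \<le> (\<Sum>i\<in>I. \<Sum>j\<in>I. R i j * d (f i + f j - l))"
      using ij fin R0 by (intro member_le_sum[of i I "\<lambda>i. \<Sum>j\<in>I. R i j * d (f i + f j - l)"])
        (auto simp: d_def intro!: sum_nonneg)
    finally show ?thesis .
  qed
  have "(\<Sum>i\<in>I. \<Sum>j\<in>I. P i j * e (f i - f j) + (- R i j) * e (f i + f j)) \<ge>
     (\<Sum>i\<in>I. \<Sum>j\<in>I. R i j * d (f i + f j - l) / 2 - a i * h i * (a j + b j) / 2
        - a i * (h j * (a j + b j)) / 2)"
    by (intro sum_mono term_ge)
  also have "(\<Sum>i\<in>I. \<Sum>j\<in>I. R i j * d (f i + f j - l) / 2 - a i * h i * (a j + b j) / 2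
        - a i * (h j * (a j + b j)) / 2) =
      ((\<Sum>i\<in>I. \<Sum>j\<in>I. R i j * d (f i + f j - l)) - (\<Sum>i\<in>I. a i * h i) * (\<Sum>j\<in>I. a j + b j)
       - sum a I * (\<Sum>j\<in>I. (a j + b j) * h j)) / 2"
    unfolding sum_product
    by (simp add: sum_subtractf sum_divide_distrib[symmetric] diff_divide_distrib mult_ac)
  also have "\<dots> = ((\<Sum>i\<in>I. \<Sum>j\<in>I. R i j * d (f i + f j - l)) - sum a H * (sum a I + sum b I)
       - sum a I * (sum a H + sum b H)) / 2"
    unfolding sum_h by (simp add: sum.distrib)
  finally have lower: "((\<Sum>i\<in>I. \<Sum>j\<in>I. R i j * d (f i + f j - l)) - sum a H * (sum a I + sum b I)
       - sum a I * (sum a H + sum b H)) / 2 \<le>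
     (\<Sum>i\<in>I. \<Sum>j\<in>I. P i j * e (f i - f j) + (- R i j) * e (f i + f j))" .
  have "2 * M < S" if "(r' - p - p') / 2 \<le> S" "2 * M < (r - p - p') / 2" "r \<le> r'" for r r' p p' S
    using that by argo
  from this[OF lower M R_ge[unfolded R_def[of i j]]]
  have "2 * M < (\<Sum>i\<in>I. \<Sum>j\<in>I. P i j * e (f i - f j) + (- R i j) * e (f i + f j))" .
  then obtain u where u: "(X u ^ 2 + 2 * X u * Y u - Z u ^ 2) * (1 - cos (l * u)) > 2 * M"
    using has_mean_attained[OF mean] by blast
  show thesis
  proof (rule that[of u], rule ccontr)
    assume "\<not> M < X u ^ 2 + 2 * X u * Y u - Z u ^ 2"
    then have "(X u ^ 2 + 2 * X u * Y u - Z u ^ 2) * (1 - cos (l * u)) \<le> M * (1 - cos (l * u))"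
      by (intro mult_right_mono) auto
    also have "\<dots> \<le> M * 2"
      using \<open>M \<ge> 0\<close> cos_ge_minus_one[of "l * u"] by (intro mult_left_mono) linarith+
    finally show False using u by simp
  qed
qed

section \<open>Sine sums that dominate cosine sums\<close>

text \<open>An index is wanted whose weight is not negligible compared with the total weight of all higher frequencies, which by
itself may be tiny. The index \<open>s\<close> of the lowest frequency has all other indices above it. Either it is
as wanted, or the remaining indices carry weight at least \<open>D x\<^sup>2\<close>, and the argument is repeated without it:
no other tail changes when the lowest index is removed. Each of the at most \<open>card I\<close> rounds replaces \<open>x\<close> by its square, whence
the double exponential.\<close>

lemma dominating_index:
  fixes f m :: "'i \<Rightarrow> real"
  assumes "finite I" "I \<noteq> {}" "\<And>i. i \<in> I \<Longrightarrow> m i \<ge> 0"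
    and "D \<ge> 4" "0 < x" "x \<le> 1 / 2" "D * x \<le> sum m I"
  shows "\<exists>s\<in>I. D * x ^ (2 ^ card I) \<le> m s \<and> D * sum m {i \<in> I. f i > f s} \<le> 4 * m s ^ 2"
  using assms
proof (induction I arbitrary: x rule: finite_psubset_induct)
  case (psubset I)
  obtain s where s: "s \<in> I" "\<And>i. i \<in> I \<Longrightarrow> f s \<le> f i"
    using psubset.prems psubset.hyps
    by (metis (no_types, lifting) arg_min_if_finite(1) arg_min_least)
  define J where "J = I - {s}"
  have J: "finite J" "J \<subset> I" "card I = Suc (card J)"
    using s psubset.hyps by (auto simp: J_def card_Diff_singleton card_gt_0_iff)
      (metis Suc_pred card_gt_0_iff empty_iff)
  have sum_I: "sum m I = m s + sum m J"
    using s psubset.hyps by (simp add: J_def sum.remove)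
  have xx: "x ^ 2 ^ card I \<le> x / 2"
  proof -
    have "x ^ 2 ^ card I \<le> x ^ 2"
      using psubset.prems J by (intro power_decreasing) auto
    also have "\<dots> \<le> x * (1/2)"
      unfolding power2_eq_square using psubset.prems by (intro mult_left_mono) auto
    finally show ?thesis by simp
  qed
  show ?case
  proof (cases "D * x / 2 \<le> m s \<and> D * sum m J \<le> 4 * m s ^ 2")
    case True
    have "sum m {i \<in> I. f i > f s} \<le> sum m J"
      using psubset.prems J by (intro sum_mono2) (auto simp: J_def)
    then have "D * sum m {i \<in> I. f i > f s} \<le> D * sum m J"
      using psubset.prems by (intro mult_left_mono) auto
    moreover have "D * x ^ 2 ^ card I \<le> D * (x / 2)"
      using xx psubset.prems by (intro mult_left_mono) auto
    ultimately show ?thesis using True s by (intro bexI[of _ s]) auto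
  next
    case False
    have xxx: "x\<^sup>2 \<le> x / 2"
      unfolding power2_eq_square using psubset.prems mult_left_mono[of x "1/2" x] by simp
    \<comment> \<open>\<open>s\<close> can fail by having too little weight itself or by the rest having too much\<close>
    have large: "D * x\<^sup>2 \<le> sum m J"
    proof (cases "D * x / 2 \<le> m s")
      case True
      then have "D * (D * x\<^sup>2) = 4 * (D * x / 2)\<^sup>2"
        by (simp add: power2_eq_square)
      also have "\<dots> \<le> 4 * m s ^ 2"
        using True psubset.prems by (intro mult_left_mono power_mono) auto
      also have "\<dots> \<le> D * sum m J" using False True by simp
      finally show ?thesis using psubset.prems by simp
    next
      case False
      then have "D * x / 2 \<le> sum m J" using sum_I psubset.prems by linarith
      moreover have "D * x\<^sup>2 \<le> D * (x / 2)"
        using xxx psubset.prems by (intro mult_left_mono) auto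
      ultimately show ?thesis by simp
    qed
    moreover have "D * x\<^sup>2 > 0" using psubset.prems by simp
    ultimately have "J \<noteq> {}" by auto
    moreover have "x\<^sup>2 \<le> 1 / 2" using xxx psubset.prems by linarith
    ultimately have "\<exists>t\<in>J. D * (x\<^sup>2) ^ (2 ^ card J) \<le> m t
        \<and> D * sum m {i \<in> J. f i > f t} \<le> 4 * m t ^ 2"
      using psubset.IH[of J "x\<^sup>2"] J psubset.prems large by (auto simp: J_def)
    then obtain t where t: "t \<in> J" "D * (x\<^sup>2) ^ (2 ^ card J) \<le> m t"
        "D * sum m {i \<in> J. f i > f t} \<le> 4 * m t ^ 2"
      by blast
    have "{i \<in> I. f i > f t} = {i \<in> J. f i > f t}"
      using s(2)[of t] t(1) by (auto simp: J_def)
    then show ?thesis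
      using t J by (intro bexI[of _ t]) (auto simp: power_mult[symmetric])
  qed
qed

lemma exists_ge_average:
  fixes g :: "'i \<Rightarrow> real"
  assumes "finite I" "I \<noteq> {}" "card I \<le> n" "sum g I \<ge> 0"
  shows "\<exists>i\<in>I. sum g I \<le> real n * g i"
proof -
  have "\<exists>i\<in>I. sum g I \<le> real (card I) * g i"
  proof (rule ccontr)
    assume *: "\<not> ?thesis"
    have c: "card I > 0" using assms by (simp add: card_gt_0_iff)
    have "sum g I < (\<Sum>i\<in>I. sum g I / card I)"
      using * c assms by (intro sum_strict_mono) (auto simp: field_simps not_le)
    then show False using c by simp
  qed
  then obtain i where i: "i \<in> I" "sum g I \<le> real (card I) * g i" by blast
  have "g i \<ge> 0"
  proof (rule ccontr)
    assume "\<not> g i \<ge> 0"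
    moreover have "real (card I) > 0" using assms by (simp add: card_gt_0_iff)
    ultimately have "real (card I) * g i < 0" by (simp add: mult_pos_neg)
    then show False using i assms by linarith
  qed
  then have "real (card I) * g i \<le> real n * g i" using assms by (intro mult_right_mono) auto
  then show ?thesis using i by (intro bexI[of _ i]) auto
qed

text \<open>Lemma \<open>dominating_index\<close> with \<open>D = 256 n\<close> and \<open>x = 1 / D\<close> gives an index of weight at least \<open>D * x ^ 2 ^ n\<close>, and
the quadratic form gets a margin proportional to the square of this weight divided by \<open>D\<close>, which is
\<open>D / threshold n\<close>.\<close>

definition threshold :: "nat \<Rightarrow> nat" where
  "threshold n = (256 * n) ^ 2 ^ Suc n"

lemma threshold_bound:
  assumes "n \<ge> 1"
  shows "real (256 * n) * (1 / real (256 * n)) ^ 2 ^ n > 0"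
    and "256 / real (threshold n) \<le> (real (256 * n) * (1 / real (256 * n)) ^ 2 ^ n)\<^sup>2 / real (256 * n)"
proof -
  define D where "D = real (256 * n)"
  have D: "D \<ge> 256" using assms by (simp add: D_def)
  show "real (256 * n) * (1 / real (256 * n)) ^ 2 ^ n > 0" using assms by simp
  have "(D * (1 / D) ^ 2 ^ n)\<^sup>2 / D = D * (1 / D) ^ (2 ^ Suc n)"
    using D by (simp add: power_mult_distrib power2_eq_square power_add[symmetric] mult_2)
  also have "\<dots> = D / real (threshold n)"
    by (simp add: threshold_def D_def power_one_over)
  also have "\<dots> \<ge> 256 / real (threshold n)"
    using D by (intro divide_right_mono) auto
  finally show "256 / real (threshold n) \<le>
      (real (256 * n) * (1 / real (256 * n)) ^ 2 ^ n)\<^sup>2 / real (256 * n)"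
    by (simp add: D_def)
qed

text \<open>The weight of an index is the sum of the relative sizes of its two coefficients, \<open>a i\<close> measured by \<open>sum a I\<close>
and \<open>b i\<close> by \<open>sum a I + sum b I\<close>, so that the lemma stays uniform when one sum is much
larger than the other. With \<open>s\<close> from \<open>dominating_index\<close>, the partner \<open>s'\<close> is chosen such that the coefficient of the
pair is comparable with the square of the weight of \<open>s\<close>, while the losses in \<open>quadratic_form_large\<close> are at most half of it.\<close>

lemma quadratic_form_margin:
  fixes f a b c :: "'i \<Rightarrow> real" and I :: "'i set" and n :: nat
  defines "X \<equiv> \<lambda>u. \<Sum>i\<in>I. a i * sin (f i * u)"
    and "Y \<equiv> \<lambda>u. \<Sum>i\<in>I. b i * sin (f i * u)"
    and "Z \<equiv> \<lambda>u. \<Sum>i\<in>I. c i * cos (f i * u)"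
  assumes I: "finite I" "card I \<le> n" and pos: "\<And>i. i \<in> I \<Longrightarrow> f i > 0"
    and a: "\<And>i. i \<in> I \<Longrightarrow> a i \<ge> 0" and b: "\<And>i. i \<in> I \<Longrightarrow> b i \<ge> 0"
    and c: "\<And>i. i \<in> I \<Longrightarrow> \<bar>c i\<bar> \<le> a i"
    and A: "sum a I > 0"
  obtains u where "X u ^ 2 + 2 * X u * Y u - Z u ^ 2
    > 32 / real (threshold n) * (sum a I * (sum a I + sum b I))"
proof -
  have "I \<noteq> {}" using A by auto
  then have n: "n \<ge> 1" using I by (metis One_nat_def Suc_leI card_gt_0_iff le_trans)
  define A where "A = sum a I"
  define T where "T = sum a I + sum b I"
  define D where "D = real (256 * n)"
  define m where "m i = a i / A + b i / T" for i
  have B0: "sum b I \<ge> 0" using b by (simp add: sum_nonneg)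
  have AT: "A > 0" "T > 0" "A \<le> T" using A B0 by (auto simp: A_def T_def)
  have D: "D \<ge> 256" using n by (simp add: D_def)
  have m0: "m i \<ge> 0" if "i \<in> I" for i using that a b AT by (simp add: m_def)
  have "1 \<le> sum m I"
  proof -
    have "sum m I = sum a I / A + sum b I / T"
      by (simp add: m_def sum.distrib sum_divide_distrib)
    then show ?thesis using AT B0 by (simp add: A_def)
  qed
  then have "\<exists>s\<in>I. D * (1/D) ^ (2 ^ card I) \<le> m s \<and> D * sum m {i \<in> I. f i > f s} \<le> 4 * m s ^ 2"
    using D \<open>I \<noteq> {}\<close> I m0 by (intro dominating_index) (auto simp: field_simps)
  then obtain s where s: "s \<in> I" "D * (1/D) ^ (2 ^ card I) \<le> m s"
    "D * sum m {i \<in> I. f i > f s} \<le> 4 * m s ^ 2" by blast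
  define H where "H = {i \<in> I. f i > f s}"
  have H: "H \<subseteq> I" "finite H" using I by (auto simp: H_def)
  have "D * (1/D) ^ (2 ^ n) \<le> D * (1/D) ^ (2 ^ card I)"
    using D I by (intro mult_left_mono power_decreasing power_increasing) auto
  then have ms: "D * (1/D) ^ (2 ^ n) \<le> m s" using s by simp
  have tail: "sum a H * T + A * (sum a H + sum b H) \<le> A * T * (8 * m s ^ 2 / D)"
  proof -
    have "sum a H * T + A * (sum a H + sum b H) = A * T * (sum a H / A + (sum a H + sum b H) / T)"
      using AT by (simp add: field_simps)
    also have "sum a H / A + (sum a H + sum b H) / T = (\<Sum>i\<in>H. a i / A + (a i / T + b i / T))"
      by (simp add: sum.distrib sum_divide_distrib add_divide_distrib)
    also have "\<dots> \<le> (\<Sum>i\<in>H. 2 * m i)"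
    proof (intro sum_mono)
      fix i assume "i \<in> H"
      then have i: "a i \<ge> 0" "b i \<ge> 0" using H a b by auto
      have "a i / T \<le> a i / A" using i AT by (intro divide_left_mono) auto
      moreover have "b i / T \<ge> 0" using i AT by simp
      ultimately show "a i / A + (a i / T + b i / T) \<le> 2 * m i" by (simp add: m_def)
    qed
    also have "\<dots> = 2 * sum m H" by (simp add: sum_distrib_left)
    also have "\<dots> \<le> 8 * m s ^ 2 / D" using s(3) D by (simp add: H_def field_simps)
    finally show ?thesis using AT by (simp add: mult_left_mono)
  qed
  have m_le: "m s \<le> 2"
  proof -
    have "a s \<le> sum a I" "b s \<le> sum b I" using s I a b by (auto intro!: member_le_sum)
    then have "a s / A \<le> 1" "b s / T \<le> 1" using AT B0 A by (auto simp: A_def T_def)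
    then show ?thesis by (simp add: m_def)
  qed
  have cc: "\<bar>c i * c j\<bar> \<le> a i * a j" if "i \<in> I" "j \<in> I" for i j
    unfolding abs_mult using that a c by (intro mult_mono) auto
  have "\<exists>s'\<in>I. \<exists>i j. ((i, j) = (s, s') \<or> (i, j) = (s', s)) \<and>
     A * T * (m s ^ 2 / (16 * real n)) \<le> (a i * a j + 2 * a i * b j + c i * c j) / 2"
  proof -
    have n1: "real n \<ge> 1" using n by simp
    have red: "m s ^ 2 / (16 * real n) \<le> m s / (8 * real n)"
    proof -
      have "m s ^ 2 \<le> m s * 2" unfolding power2_eq_square
        using m_le m0[OF s(1)] by (intro mult_left_mono) auto
      then show ?thesis using n1 by (simp add: field_simps)
    qed
    have ab: "a i * b j \<le> (a i * a j + 2 * a i * b j + c i * c j) / 2" if "i \<in> I" "j \<in> I" for i j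
      using cc[OF that] by auto
    \<comment> \<open>If \<open>b s\<close> carries the weight of \<open>s\<close>, it is paired with the largest \<open>a\<close>. If \<open>a s\<close> does, it is
      paired with the largest \<open>b\<close>, provided that the \<open>b\<close> are at least as large in total, and with itself otherwise.\<close>
    consider "b s / T \<ge> m s / 2" | "a s / A \<ge> m s / 2" "sum b I \<ge> sum a I"
      | "a s / A \<ge> m s / 2" "sum b I < sum a I"
      unfolding m_def by argo
    then show ?thesis
    proof cases
      case 1
      obtain s' where s': "s' \<in> I" "sum a I \<le> real n * a s'"
        using exists_ge_average[of I n a] A I \<open>I \<noteq> {}\<close> by auto
      have "m s ^ 2 / (16 * real n) \<le> (1 / real n) * (m s / 2)"
        using red m0[OF s(1)] n1 by (simp add: field_simps)
      also have "\<dots> \<le> (a s' / A) * (b s / T)"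
        using s' 1 AT m0[OF s(1)] a[OF s'(1)] n1
        by (intro mult_mono) (auto simp: A_def[symmetric] field_simps)
      finally have "A * T * (m s ^ 2 / (16 * real n)) \<le> a s' * b s"
        using AT by (simp add: field_simps)
      then show ?thesis using ab[of s' s] s s' by (intro bexI[of _ s'] exI[of _ s'] exI[of _ s]) auto
    next
      case 2
      obtain s' where s': "s' \<in> I" "sum b I \<le> real n * b s'"
        using exists_ge_average[of I n b] B0 I \<open>I \<noteq> {}\<close> by auto
      have "T \<le> 2 * (real n * b s')" using 2 s' by (simp add: T_def)
      then have "1 / (2 * real n) \<le> b s' / T" using AT n1 by (simp add: field_simps)
      then have "(m s / 2) * (1 / (2 * real n)) \<le> (a s / A) * (b s' / T)"
        using 2 AT a[OF s(1)] n1 by (intro mult_mono) auto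
      moreover have "m s ^ 2 / (16 * real n) \<le> (m s / 2) * (1 / (2 * real n))"
        using red m0[OF s(1)] n1 by (simp add: field_simps)
      ultimately have "m s ^ 2 / (16 * real n) \<le> (a s / A) * (b s' / T)" by linarith
      then have "A * T * (m s ^ 2 / (16 * real n)) \<le> a s * b s'"
        using AT by (simp add: field_simps)
      then show ?thesis using ab[of s s'] s s' by (intro bexI[of _ s'] exI[of _ s] exI[of _ s']) auto
    next
      case 3
      have "T \<le> 2 * A" using 3 by (simp add: T_def A_def)
      have "m s ^ 2 / (16 * real n) \<le> m s ^ 2 / 16"
        using n1 by (intro divide_left_mono) auto
      also have "\<dots> = (m s / 2) ^ 2 / 4" by (simp add: power2_eq_square)
      also have "\<dots> \<le> (a s / A) ^ 2 / 4"
        using 3 m0[OF s(1)] by (intro divide_right_mono power_mono) auto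
      finally have "A * T * (m s ^ 2 / (16 * real n)) \<le> A * T * ((a s / A) ^ 2 / 4)"
        using AT by (intro mult_left_mono) auto
      also have "\<dots> = T / A * (a s * a s) / 4"
        using AT by (simp add: field_simps power2_eq_square)
      also have "\<dots> \<le> 2 * (a s * a s) / 4"
        using AT \<open>T \<le> 2 * A\<close> by (intro divide_right_mono mult_right_mono) (auto simp: field_simps)
      also have "\<dots> \<le> (a s * a s + 2 * a s * b s + c s * c s) / 2"
        using a[OF s(1)] b[OF s(1)] by simp
      finally show ?thesis using s by (intro bexI[of _ s] exI[of _ s]) auto
    qed
  qed
  then obtain s' i j where s': "s' \<in> I" "(i, j) = (s, s') \<or> (i, j) = (s', s)"
    and R: "A * T * (m s ^ 2 / (16 * real n)) \<le> (a i * a j + 2 * a i * b j + c i * c j) / 2"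
    by blast
  have "A * T * (m s ^ 2 / (16 * real n)) = A * T * (16 * m s ^ 2 / D)"
    by (simp add: D_def)
  with R tail have "A * T * (8 * m s ^ 2 / D) \<le> (a i * a j + 2 * a i * b j + c i * c j) / 2
      - sum a H * T - A * (sum a H + sum b H)"
    by (simp add: algebra_simps)
  moreover have "A * T * (256 / real (threshold n)) \<le> A * T * (m s ^ 2 / D)"
  proof -
    have "256 / real (threshold n) \<le> (D * (1/D) ^ (2 ^ n)) ^ 2 / D"
      unfolding D_def by (rule threshold_bound[OF n])
    also have "\<dots> \<le> m s ^ 2 / D"
      using ms D threshold_bound(1)[OF n] by (intro divide_right_mono power_mono) (auto simp: D_def)
    finally show ?thesis using AT by (intro mult_left_mono) auto
  qed
  moreover have "threshold n > 0" using n by (simp add: threshold_def)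
  then have "A * T * (256 / real (threshold n)) > 0" using AT by simp
  moreover have "A * T * (8 * m s ^ 2 / D) = 8 * (A * T * (m s ^ 2 / D))"
    "32 / real (threshold n) * (A * T) = A * T * (256 / real (threshold n)) / 8"
    by simp_all
  moreover have "2 * w < (r - p - p') / 2"
    if "k \<le> r - p - p'" "l \<le> l'" "0 < l" "k = 8 * l'" "w = l / 8" for w r p p' k l l' :: real
    using that by argo
  ultimately have "2 * (32 / real (threshold n) * (A * T)) <
     ((a i * a j + 2 * a i * b j + c i * c j) / 2
      - sum a H * T - A * (sum a H + sum b H)) / 2"
    by blast
  then have large: "2 * (32 / real (threshold n) * (A * T)) <
     ((a i * a j + 2 * a i * b j + c i * c j) / 2
      - sum a {i \<in> I. f i > f s} * (sum a I + sum b I)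
      - sum a I * (sum a {i \<in> I. f i > f s} + sum b {i \<in> I. f i > f s})) / 2"
    by (simp add: A_def T_def H_def)
  have M0: "32 / real (threshold n) * (A * T) \<ge> 0" using AT by simp
  have "\<exists>u. X u ^ 2 + 2 * X u * Y u - Z u ^ 2 > 32 / real (threshold n) * (A * T)"
    unfolding X_def Y_def Z_def
    by (rule quadratic_form_large[OF I(1) pos a b c s(1) s' large M0]) blast+
  then show thesis using that unfolding A_def T_def by blast
qed

text \<open>With \<open>x = X u\<close>, \<open>t = X u + Y u\<close>, \<open>z = \<bar>Z u\<bar>\<close> the quadratic form is \<open>2 x t - x\<^sup>2 - z\<^sup>2\<close>. Once the sign of \<open>u\<close> makes
\<open>x\<close> nonnegative, the lower bound for it together with \<open>t \<le> T\<close> bounds \<open>x\<close> below, and together with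
\<open>2 x z \<le> x\<^sup>2 + z\<^sup>2\<close> and \<open>x \<le> A\<close> it bounds \<open>t - z\<close> below.\<close>

lemma sine_cosine_domination:
  fixes f a b c :: "'i \<Rightarrow> real" and I :: "'i set" and n :: nat
  defines "X \<equiv> \<lambda>u. \<Sum>i\<in>I. a i * sin (f i * u)"
    and "Y \<equiv> \<lambda>u. \<Sum>i\<in>I. b i * sin (f i * u)"
    and "Z \<equiv> \<lambda>u. \<Sum>i\<in>I. c i * cos (f i * u)"
  assumes I: "finite I" "card I \<le> n" and pos: "\<And>i. i \<in> I \<Longrightarrow> f i > 0"
    and a: "\<And>i. i \<in> I \<Longrightarrow> a i \<ge> 0" and b: "\<And>i. i \<in> I \<Longrightarrow> b i \<ge> 0"
    and c: "\<And>i. i \<in> I \<Longrightarrow> \<bar>c i\<bar> \<le> a i"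
    and A: "sum a I > 0"
  obtains u where "X u \<ge> 16 / real (threshold n) * sum a I"
    and "X u + Y u \<ge> \<bar>Z u\<bar> + 16 / real (threshold n) * (sum a I + sum b I)"
proof -
  define e where "e = 16 / real (threshold n)"
  define A where "A = sum a I"
  define T where "T = sum a I + sum b I"
  have AT: "A > 0" "T > 0" "e \<ge> 0"
    using A b sum_nonneg[of I b] by (auto simp: A_def T_def e_def add_pos_nonneg)
  have "\<exists>v. X v ^ 2 + 2 * X v * Y v - Z v ^ 2 > 32 / real (threshold n) * (sum a I * (sum a I + sum b I))"
    unfolding X_def Y_def Z_def
    by (rule quadratic_form_margin[OF I pos a b c A]) blast+
  then obtain v where v: "X v ^ 2 + 2 * X v * Y v - Z v ^ 2 > 2 * e * (A * T)"
    by (auto simp: e_def A_def T_def)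
  \<comment> \<open>the quadratic form is even in the variable, so the sign of \<open>v\<close> is free\<close>
  define u where "u = (if X v \<ge> 0 then v else - v)"
  have flip: "X (- v) = - X v" "Y (- v) = - Y v" "Z (- v) = Z v"
    by (simp_all add: X_def Y_def Z_def sum_negf)
  define x where "x = X u"
  define t where "t = X u + Y u"
  define z where "z = \<bar>Z u\<bar>"
  have Q: "2 * x * t - x ^ 2 - z ^ 2 > 2 * e * (A * T)" and "x \<ge> 0"
    using v flip by (auto simp: u_def x_def t_def z_def power2_eq_square algebra_simps)
  have sin_le: "r * sin y \<le> r" if "r \<ge> 0" for r y :: real
    using mult_left_mono[OF sin_le_one that] by simp
  have "x \<le> A" unfolding x_def X_def A_def using a by (intro sum_mono sin_le) auto
  have "Y u \<le> sum b I" unfolding Y_def using b by (intro sum_mono sin_le) auto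
  then have "t \<le> T" using \<open>x \<le> A\<close> by (simp add: t_def x_def T_def A_def)
  have "0 \<le> e * (A * T)" using AT by simp
  then have xt: "x * t > 0" using Q zero_le_power2[of x] zero_le_power2[of z] by linarith
  then have "x > 0" using \<open>x \<ge> 0\<close> by (cases "x = 0") auto
  have "e * (A * T) \<le> x * t" using Q zero_le_power2[of x] zero_le_power2[of z] by linarith
  also have "\<dots> \<le> x * T" using \<open>t \<le> T\<close> \<open>x > 0\<close> by (intro mult_left_mono) auto
  finally have 1: "e * A \<le> x" using AT by (simp add: mult.assoc[symmetric])
  have "e * (x * T) \<le> e * (A * T)"
    using \<open>x \<le> A\<close> AT by (intro mult_left_mono mult_right_mono) auto
  moreover have "2 * x * z \<le> x ^ 2 + z ^ 2" using sum_squares_bound[of x z] by simp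
  ultimately have "2 * (x * (z + e * T)) \<le> 2 * (x * t)" using Q by (simp add: algebra_simps)
  then have "z + e * T \<le> t" using \<open>x > 0\<close> by simp
  then show thesis using that[of u] 1 by (simp add: x_def t_def z_def e_def A_def T_def)
qed

text \<open>Both conditions on the sum \<open>X\<close> in \<open>sine_cosine_domination\<close> are used with \<open>Z = 0\<close> after \<open>X\<close> has been scaled by \<open>k\<close>
so that it can never exceed half of the margin for \<open>k X + Y\<close>; then \<open>Y\<close> alone keeps the other half. The bound for \<open>X\<close>
is homogeneous and survives the scaling.\<close>

lemma two_sine_sums_positive:
  fixes f a b :: "'i \<Rightarrow> real" and I :: "'i set" and n :: nat
  defines "X \<equiv> \<lambda>u. \<Sum>i\<in>I. a i * sin (f i * u)"
    and "Y \<equiv> \<lambda>u. \<Sum>i\<in>I. b i * sin (f i * u)"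
  assumes I: "finite I" "card I \<le> n" and pos: "\<And>i. i \<in> I \<Longrightarrow> f i > 0"
    and a: "\<And>i. i \<in> I \<Longrightarrow> a i \<ge> 0" and b: "\<And>i. i \<in> I \<Longrightarrow> b i \<ge> 0"
    and AB: "sum a I > 0" "sum b I > 0"
  obtains u where "X u \<ge> 8 / real (threshold n) * sum a I"
    and "Y u \<ge> 8 / real (threshold n) * sum b I"
proof -
  define e where "e = 8 / real (threshold n)"
  \<comment> \<open>the scaled sum \<open>k X\<close> is at most \<open>e * sum b I\<close>, half of the margin \<open>2 * e * sum b I\<close>\<close>
  define k where "k = e * sum b I / sum a I"
  have "I \<noteq> {}" using AB by auto
  then have "n \<noteq> 0" using I by auto
  then have "e > 0" by (simp add: e_def threshold_def)
  then have k: "k > 0" "k * sum a I = e * sum b I" using AB by (auto simp: k_def)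
  have kA: "sum (\<lambda>i. k * a i) I > 0"
    using k AB \<open>e > 0\<close> by (simp add: sum_distrib_left[symmetric])
  have "\<exists>u. (\<Sum>i\<in>I. (k * a i) * sin (f i * u)) \<ge> 16 / real (threshold n) * (\<Sum>i\<in>I. k * a i) \<and>
     (\<Sum>i\<in>I. (k * a i) * sin (f i * u)) + (\<Sum>i\<in>I. b i * sin (f i * u)) \<ge>
        \<bar>\<Sum>i\<in>I. 0 * cos (f i * u)\<bar> + 16 / real (threshold n) * ((\<Sum>i\<in>I. k * a i) + sum b I)"
    by (rule sine_cosine_domination[OF I pos, where a = "\<lambda>i. k * a i" and b = b
        and c = "\<lambda>_. 0"]) (use a b k kA in auto)
  then obtain u where u: "(\<Sum>i\<in>I. (k * a i) * sin (f i * u)) \<ge> 16 / real (threshold n) * (\<Sum>i\<in>I. k * a i)"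
     "(\<Sum>i\<in>I. (k * a i) * sin (f i * u)) + (\<Sum>i\<in>I. b i * sin (f i * u)) \<ge>
        \<bar>\<Sum>i\<in>I. 0 * cos (f i * u)\<bar> + 16 / real (threshold n) * ((\<Sum>i\<in>I. k * a i) + sum b I)"
    by blast
  have kX: "(\<Sum>i\<in>I. (k * a i) * sin (f i * u)) = k * X u"
    by (simp add: X_def sum_distrib_left mult.assoc)
  have "k * (2 * e * sum a I) \<le> k * X u"
    using u(1) unfolding kX by (simp add: e_def sum_distrib_left[symmetric] mult_ac)
  then have X: "2 * e * sum a I \<le> X u" using k by simp
  have "X u \<le> sum a I" unfolding X_def
    using a mult_left_mono[OF sin_le_one] by (intro sum_mono) fastforce
  then have "k * X u \<le> e * sum b I" using k by (metis mult_left_mono less_imp_le)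
  moreover have "16 / real (threshold n) = 2 * e" by (simp add: e_def)
  then have "2 * e * (k * sum a I + sum b I) \<le> k * X u + Y u"
    using u(2) unfolding kX by (simp add: Y_def sum_distrib_left)
  moreover have "2 * e * (e * sum b I) \<ge> 0" using \<open>e > 0\<close> AB by simp
  ultimately have "e * sum b I \<le> Y u"
    by (simp add: k distrib_left)
  moreover have "e * sum a I \<le> X u"
    using X \<open>e > 0\<close> AB mult_pos_pos[of e "sum a I"] by linarith
  ultimately show thesis using that[of u] by (simp add: e_def)
qed

section \<open>Simultaneous recurrence\<close>

lemma norm_cis_minus_one_le: "cmod (cis y - 1) \<le> \<bar>y\<bar>"
proof -
  have "(cmod (cis y - 1))\<^sup>2 = (cos y - 1)\<^sup>2 + (sin y)\<^sup>2"
    by (simp add: cmod_power2)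
  also have "\<dots> = 2 - 2 * cos (2 * (y / 2))"
    by (simp add: power2_eq_square algebra_simps sin_squared_eq[unfolded power2_eq_square])
  also have "\<dots> = 4 * sin (y / 2) ^ 2"
    unfolding cos_double_sin by simp
  also have "\<dots> \<le> 4 * \<bar>y / 2\<bar> ^ 2"
    using abs_sin_x_le_abs_x[of "y / 2"] power_mono[of "\<bar>sin (y / 2)\<bar>" "\<bar>y / 2\<bar>" 2]
    by (simp add: power2_abs)
  also have "\<dots> = \<bar>y\<bar>\<^sup>2" by (simp add: power2_eq_square)
  finally show ?thesis by (rule power2_le_imp_le) simp
qed

text \<open>Dirichlet's simultaneous approximation of the numbers \<open>f i L / (2 \<pi>)\<close>: some positive multiple of
\<open>L \<ge> U\<close> brings all phases close to a multiple of \<open>2 \<pi>\<close>.\<close>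

lemma simultaneous_recurrence:
  fixes f :: "'i \<Rightarrow> real"
  assumes "finite I" "d > 0"
  obtains t where "t \<ge> U" "\<And>i. i \<in> I \<Longrightarrow> cmod (cis (f i * t) - 1) \<le> d"
proof -
  define L where "L = max U 1"
  define N where "N = nat \<lceil>2 * pi / d\<rceil>"
  have "2 * pi / d > 0" using assms by simp
  then have N: "N > 0" "2 * pi / d \<le> real N"
    by (auto simp: N_def)
  obtain e where e: "bij_betw e {..<card I} I"
    using assms by (metis ex_bij_betw_nat_finite lessThan_atLeast0)
  obtain q p where q: "0 < q"
    and qp: "\<And>k. k < card I \<Longrightarrow> \<bar>of_int q * (f (e k) * L / (2 * pi)) - of_int (p k)\<bar> < 1 / real N"
    using Dirichlet_approx_simult[OF N(1), of "card I" "\<lambda>k. f (e k) * L / (2 * pi)"] by metis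
  show thesis
  proof (rule that[of "of_int q * L"])
    have "1 * L \<le> of_int q * L" using q by (intro mult_right_mono) (auto simp: L_def)
    then show "U \<le> of_int q * L" by (simp add: L_def)
  next
    fix i assume "i \<in> I"
    then obtain k where k: "k < card I" "e k = i"
      using bij_betw_imp_surj_on[OF e] by (metis imageE lessThan_iff)
    define y where "y = f i * (of_int q * L) - 2 * pi * of_int (p k)"
    have "y = 2 * pi * (of_int q * (f (e k) * L / (2 * pi)) - of_int (p k))"
      by (simp add: y_def k field_simps)
    then have "\<bar>y\<bar> = 2 * pi * \<bar>of_int q * (f (e k) * L / (2 * pi)) - of_int (p k)\<bar>"
      by (simp add: abs_mult)
    also have "\<dots> \<le> 2 * pi * (1 / real N)"
      using qp[OF k(1)] by (intro mult_left_mono) auto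
    also have "\<dots> \<le> d" using N assms by (simp add: field_simps)
    finally have "\<bar>y\<bar> \<le> d" .
    moreover have "cis (f i * (of_int q * L)) = cis y"
    proof -
      have "cis (f i * (of_int q * L)) = cis (y + 2 * pi * of_int (p k))" by (simp add: y_def)
      also have "\<dots> = cis y * cis (2 * pi * of_int (p k))" by (rule cis_mult[symmetric])
      also have "cis (2 * pi * of_int (p k)) = 1" by (simp add: cis_multiple_2pi)
      finally show ?thesis by simp
    qed
    ultimately show "cmod (cis (f i * (of_int q * L)) - 1) \<le> d"
      using norm_cis_minus_one_le[of y] by simp
  qed
qed

section \<open>Computability of the threshold\<close>

text \<open>The values of recursive functions matter only on argument lists of the right length, so functions are compared on
these only; otherwise the closure properties below would fail as equations between functions.\<close>

definition computes :: "nat \<Rightarrow> (nat list \<Rightarrow> nat) \<Rightarrow> bool" where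
  "computes k F \<longleftrightarrow> (\<exists>f. recursive k f \<and> (\<forall>xs. length xs = k \<longrightarrow> f xs = F xs))"

lemma computes_proj: "i < k \<Longrightarrow> computes k (\<lambda>xs. xs ! i)"
  unfolding computes_def by (blast intro: recursive.proj)

lemma computes_Suc:
  assumes "computes k G"
  shows "computes k (\<lambda>xs. Suc (G xs))"
proof -
  obtain g where g: "recursive k g" "\<forall>xs. length xs = k \<longrightarrow> g xs = G xs"
    using assms by (auto simp: computes_def)
  have "recursive k (\<lambda>xs. (\<lambda>ys. Suc (ys ! 0)) (map (\<lambda>h. h xs) [g]))"
    using g recursive.succ by (intro recursive.comp) auto
  then show ?thesis using g unfolding computes_def by (intro exI conjI) auto
qed

lemma computes_const: "computes k (\<lambda>xs. c)"
proof (induction c)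
  case 0
  then show ?case unfolding computes_def by (blast intro: recursive.zero)
qed (rule computes_Suc)

lemma computes_binary:
  assumes "computes 2 F" "computes k G" "computes k H"
  shows "computes k (\<lambda>xs. F [G xs, H xs])"
proof -
  obtain f where f: "recursive 2 f" "\<forall>xs. length xs = 2 \<longrightarrow> f xs = F xs"
    using assms by (auto simp: computes_def)
  obtain g where g: "recursive k g" "\<forall>xs. length xs = k \<longrightarrow> g xs = G xs"
    using assms by (auto simp: computes_def)
  obtain h where h: "recursive k h" "\<forall>xs. length xs = k \<longrightarrow> h xs = H xs"
    using assms by (auto simp: computes_def)
  have "recursive k (\<lambda>xs. f (map (\<lambda>h. h xs) [g, h]))"
    using f g h by (intro recursive.comp) (auto simp: numeral_2_eq_2)
  then show ?thesis using f g h unfolding computes_def by (intro exI conjI) auto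
qed

lemma computes_iterate:
  assumes "computes 1 F" "computes 3 G"
  shows "computes 2 (\<lambda>xs. rec_nat (F [xs ! 1]) (\<lambda>y r. G [y, r, xs ! 1]) (xs ! 0))"
proof -
  obtain f where f: "recursive (Suc 0) f" "\<forall>xs. length xs = 1 \<longrightarrow> f xs = F xs"
    using assms by (auto simp: computes_def)
  obtain g where g: "recursive (Suc (Suc (Suc 0))) g" "\<forall>xs. length xs = 3 \<longrightarrow> g xs = G xs"
    using assms by (auto simp: computes_def numeral_3_eq_3)
  have "recursive 2 (\<lambda>xs. rec_nat (f (tl xs)) (\<lambda>y r. g (y # r # tl xs)) (hd xs))"
    using recursive.prim_rec[OF f(1) g(1)] by (simp add: numeral_2_eq_2)
  moreover have "rec_nat (f (tl xs)) (\<lambda>y r. g (y # r # tl xs)) (hd xs) =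
      rec_nat (F [xs ! 1]) (\<lambda>y r. G [y, r, xs ! 1]) (xs ! 0)" if "length xs = 2" for xs
  proof -
    from that obtain a b where "xs = [a, b]"
      by (auto simp: numeral_2_eq_2 length_Suc_conv)
    then show ?thesis using f(2) g(2) by simp
  qed
  ultimately show ?thesis unfolding computes_def by blast
qed

lemma computes_add:
  assumes "computes k G" "computes k H"
  shows "computes k (\<lambda>xs. G xs + H xs)"
proof -
  have "computes 2 (\<lambda>xs. rec_nat ([xs ! 1] ! 0) (\<lambda>y r. Suc ([y, r, xs ! 1] ! 1)) (xs ! 0))"
    by (rule computes_iterate) (auto intro!: computes_proj computes_Suc)
  moreover have "rec_nat b (\<lambda>y r. Suc r) a = a + b" for a b by (induction a) auto
  ultimately have "computes 2 (\<lambda>xs. xs ! 0 + xs ! 1)" by simp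
  from computes_binary[OF this assms] show ?thesis by simp
qed

lemma computes_mult:
  assumes "computes k G" "computes k H"
  shows "computes k (\<lambda>xs. G xs * H xs)"
proof -
  have "computes 2 (\<lambda>xs. rec_nat 0 (\<lambda>y r. [y, r, xs ! 1] ! 1 + [y, r, xs ! 1] ! 2) (xs ! 0))"
    by (rule computes_iterate) (auto intro!: computes_proj computes_add computes_const)
  moreover have "rec_nat 0 (\<lambda>y r. r + b) a = a * b" for a b :: nat by (induction a) auto
  ultimately have "computes 2 (\<lambda>xs. xs ! 0 * xs ! 1)" by simp
  from computes_binary[OF this assms] show ?thesis by simp
qed

lemma computes_power:
  assumes "computes k G" "computes k H"
  shows "computes k (\<lambda>xs. G xs ^ H xs)"
proof -
  have "computes 2 (\<lambda>xs. rec_nat 1 (\<lambda>y r. [y, r, xs ! 1] ! 1 * [y, r, xs ! 1] ! 2) (xs ! 0))"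
    by (rule computes_iterate) (auto intro!: computes_proj computes_mult computes_const)
  moreover have "rec_nat 1 (\<lambda>y r. r * b) a = b ^ a" for a b :: nat by (induction a) auto
  ultimately have "computes 2 (\<lambda>xs. (xs ! 1) ^ (xs ! 0))" by simp
  from computes_binary[OF this assms(2,1)] show ?thesis by simp
qed

text \<open>The threshold is a natural number, so its \<open>k\<close>-th approximation is the exact fraction with denominator \<open>k + 1\<close>.\<close>

lemma computable_threshold: "computable_real_seq (\<lambda>n. real (threshold n))"
proof -
  have "computes 2 (\<lambda>xs. threshold (xs ! 0) * Suc (xs ! 1))"
    unfolding threshold_def
    by (intro computes_mult computes_power computes_const computes_Suc computes_proj) auto
  then obtain f where f: "recursive 2 f"
    "\<And>xs. length xs = 2 \<Longrightarrow> f xs = threshold (xs ! 0) * Suc (xs ! 1)"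
    unfolding computes_def by blast
  have "recursive 2 (\<lambda>xs. 0)" by (rule recursive.zero)
  moreover have "\<bar>real (threshold n) - (real (f [n, k]) - real 0) / real (k + 1)\<bar> \<le> 1 / real (k + 1)" for n k
    using f(2)[of "[n, k]"] by (simp add: field_simps)
  ultimately show ?thesis
    using f(1) unfolding computable_real_seq_def by blast
qed

section \<open>Infinite sums depending on a parameter\<close>

lemma infsum_finite_sum:
  fixes f :: "'i \<Rightarrow> 'a \<Rightarrow> complex"
  assumes "\<And>i. i \<in> I \<Longrightarrow> f i summable_on A"
  shows "(\<lambda>x. \<Sum>i\<in>I. f i x) summable_on A"
    and "infsum (\<lambda>x. \<Sum>i\<in>I. f i x) A = (\<Sum>i\<in>I. infsum (f i) A)"
proof -
  have "(\<lambda>x. \<Sum>i\<in>I. f i x) summable_on A \<and>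
      infsum (\<lambda>x. \<Sum>i\<in>I. f i x) A = (\<Sum>i\<in>I. infsum (f i) A)"
    using assms
    by (induction I rule: infinite_finite_induct) (simp_all add: summable_on_add infsum_add)
  then show "(\<lambda>x. \<Sum>i\<in>I. f i x) summable_on A"
    and "infsum (\<lambda>x. \<Sum>i\<in>I. f i x) A = (\<Sum>i\<in>I. infsum (f i) A)" by blast+
qed

text \<open>Dominated convergence for unordered sums: outside a finite set the dominating sum is small, on the finite set the terms tend to \<open>0\<close>.\<close>

lemma infsum_tendsto_zero_dominated:
  fixes h :: "'x \<Rightarrow> 'a \<Rightarrow> complex" and M :: "'a \<Rightarrow> real"
  assumes M: "M summable_on A"
    and dom: "\<forall>\<^sub>F x in F. \<forall>a\<in>A. norm (h x a) \<le> M a"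
    and lim: "\<And>a. a \<in> A \<Longrightarrow> ((\<lambda>x. h x a) \<longlongrightarrow> 0) F"
  shows "((\<lambda>x. infsum (h x) A) \<longlongrightarrow> 0) F"
proof (rule tendstoI)
  fix e :: real assume "e > 0"
  then have "e / 4 > 0" by simp
  then obtain K where K: "finite K" "K \<subseteq> A" "dist (sum M K) (infsum M A) \<le> e / 4"
    using infsum_finite_approximation[OF M] by blast
  have sK: "M summable_on K" "M summable_on (A - K)"
    using K M summable_on_subset_banach by (auto intro: summable_on_subset_banach)
  have "infsum M (K \<union> (A - K)) = infsum M K + infsum M (A - K)"
    using sK by (intro infsum_Un_disjoint) auto
  then have tail: "infsum M (A - K) \<le> e / 4"
    using K by (simp add: Un_absorb1 dist_real_def)
  have "((\<lambda>x. \<Sum>a\<in>K. h x a) \<longlongrightarrow> (\<Sum>a\<in>K. 0)) F"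
    using K lim by (intro tendsto_sum) auto
  then have "((\<lambda>x. \<Sum>a\<in>K. h x a) \<longlongrightarrow> 0) F" by simp
  then have "\<forall>\<^sub>F x in F. dist (\<Sum>a\<in>K. h x a) 0 < e / 2"
    using \<open>e > 0\<close> by (intro tendstoD) auto
  then show "\<forall>\<^sub>F x in F. dist (infsum (h x) A) 0 < e"
    using dom
  proof eventually_elim
    case (elim x)
    have abs: "(\<lambda>a. norm (h x a)) summable_on A"
      using M elim(2) by (intro summable_on_comparison_test[OF M]) auto
    then have s: "h x summable_on A" by (rule abs_summable_summable)
    have s': "h x summable_on K" "h x summable_on (A - K)"
      using K s by (auto intro: summable_on_subset_banach)
    have "infsum (h x) (K \<union> (A - K)) = infsum (h x) K + infsum (h x) (A - K)"
      using s' by (intro infsum_Un_disjoint) auto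
    then have split: "infsum (h x) A = sum (h x) K + infsum (h x) (A - K)"
      using K by (simp add: Un_absorb1)
    have "norm (infsum (h x) (A - K)) \<le> infsum M (A - K)"
      using elim(2) by (intro norm_infsum_le[OF has_sum_infsum[OF s'(2)] has_sum_infsum[OF sK(2)]]) auto
    then have "norm (infsum (h x) A) \<le> norm (sum (h x) K) + e / 4"
      unfolding split using norm_triangle_ineq[of "sum (h x) K" "infsum (h x) (A - K)"] tail by linarith
    then show ?case using elim(1) \<open>e > 0\<close> by (simp add: dist_norm)
  qed
qed

section \<open>The contribution of one point of a system\<close>

text \<open>The bound for the integral in \<open>zero_term x \<rho>\<close>, divided by the modulus of \<open>x powr \<rho>\<close>. The same factor serves
all \<open>\<rho>\<close> with real part at least \<open>1 / 2\<close>, which is what makes the sum over an infinite system manageable.\<close>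

definition log_integral_factor :: "real \<Rightarrow> real" where
  "log_integral_factor x = 8 / (ln x)\<^sup>2 + 4 / (ln 2)\<^sup>2 * x powr (- 1 / 8)"

lemma log_integral_factor_tendsto: "((\<lambda>x. ln x * log_integral_factor x) \<longlongrightarrow> 0) at_top"
  unfolding log_integral_factor_def by real_asymp

text \<open>Near \<open>x\<close> the function \<open>1 / (ln t)\<^sup>2\<close> is of size \<open>1 / (ln x)\<^sup>2\<close>; for \<open>t < sqrt x\<close> it is bounded and
the factor \<open>(x / t\<^sup>2) powr (1/8)\<close> exceeds \<open>1\<close>. The sum of both bounds avoids splitting the integral at \<open>sqrt x\<close>.\<close>

lemma inverse_log_square_le:
  fixes t x :: real
  assumes "2 \<le> t" "t \<le> x"
  shows "1 / (ln t)\<^sup>2 \<le> 4 / (ln x)\<^sup>2 + 1 / (ln 2)\<^sup>2 * x powr (1/8) * t powr (- 1/4)"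
proof -
  have ln: "ln t \<ge> ln 2" "ln t > 0" "ln x > 0" "ln (2::real) > 0" using assms by auto
  show ?thesis
  proof (cases "t\<^sup>2 \<ge> x")
    case True
    then have "ln x \<le> ln (t ^ 2)" using assms by (intro ln_mono) auto
    then have "ln x \<le> 2 * ln t" using assms by (simp add: ln_realpow)
    then have "(ln x)\<^sup>2 \<le> (2 * ln t)\<^sup>2" using ln by (intro power_mono) auto
    moreover have "(ln t)\<^sup>2 > 0" "(ln x)\<^sup>2 > 0" using ln by auto
    ultimately have "1 / (ln t)\<^sup>2 \<le> 4 / (ln x)\<^sup>2"
      by (simp add: divide_le_eq le_divide_eq power_mult_distrib mult.commute)
    moreover have "1 / (ln 2)\<^sup>2 * x powr (1/8) * t powr (- 1/4) \<ge> 0" by simp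
    ultimately show ?thesis by linarith
  next
    case False
    have "t powr (1/4) = (t powr 2) powr (1/8)" by (simp add: powr_powr)
    also have "t powr 2 = t\<^sup>2" using assms by simp
    also have "(t\<^sup>2) powr (1/8) \<le> x powr (1/8)"
      using False assms by (intro powr_mono2) auto
    finally have "1 \<le> x powr (1/8) * t powr (- 1/4)"
      using assms by (simp add: powr_minus field_simps)
    then have "1 / (ln 2)\<^sup>2 * 1 \<le> 1 / (ln 2)\<^sup>2 * (x powr (1/8) * t powr (- 1/4))"
      by (intro mult_left_mono) auto
    moreover have "1 / (ln t)\<^sup>2 \<le> 1 / (ln 2)\<^sup>2"
      using ln by (intro divide_left_mono power_mono mult_pos_pos zero_less_power; linarith)
    moreover have "4 / (ln x)\<^sup>2 \<ge> 0" by simp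
    ultimately show ?thesis unfolding mult.assoc by linarith
  qed
qed

text \<open>The majorant from \<open>inverse_log_square_le\<close> has an explicit antiderivative. The exponent \<open>- 1/4\<close> there keeps
\<open>Re \<rho> - 1/4\<close> positive, so that the lower limit of integration can be ignored.\<close>

lemma zero_term_integral_bound:
  assumes x: "x \<ge> 2" and re: "Re \<rho> \<ge> 1 / 2"
  shows "cmod (integral {2..x} (\<lambda>t. of_real t powr \<rho> / (of_real t * (of_real (ln t))\<^sup>2)))
    \<le> x powr Re \<rho> * log_integral_factor x"
proof -
  define s where "s = Re \<rho>"
  define p where "p = 4 / (ln x)\<^sup>2"
  define r where "r = 1 / (ln 2)\<^sup>2 * x powr (1/8)"
  define h where "h t = p * t powr (s - 1) + r * t powr (s - 1/4 - 1)" for t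
  define H where "H t = p * (t powr s / s) + r * (t powr (s - 1/4) / (s - 1/4))" for t
  have s: "s \<ge> 1/2" "s - 1/4 \<ge> 1/4" using re by (auto simp: s_def)
  have pr: "p \<ge> 0" "r \<ge> 0" by (auto simp: p_def r_def)
  have hint: "(h has_integral (H x - H 2)) {2..x}"
  proof (rule fundamental_theorem_of_calculus[OF x])
    fix t assume "t \<in> {2..x}"
    then have "t > 0" by auto
    then have "(H has_real_derivative h t) (at t within {2..x})"
      unfolding H_def h_def using s by (auto intro!: derivative_eq_intros)
    then show "(H has_vector_derivative h t) (at t within {2..x})"
      by (simp add: has_real_derivative_iff_has_vector_derivative)
  qed
  have "cmod (integral {2..x} (\<lambda>t. of_real t powr \<rho> / (of_real t * (of_real (ln t))\<^sup>2)))
      \<le> integral {2..x} h"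
  proof (rule integral_norm_bound_integral)
    show "(\<lambda>t. of_real t powr \<rho> / (of_real t * (of_real (ln t))\<^sup>2)) integrable_on {2..x}"
      by (intro integrable_continuous_real continuous_intros) (auto simp: complex_nonpos_Reals_iff)
    show "h integrable_on {2..x}" using hint by blast
  next
    fix t assume t: "t \<in> {2..x}"
    then have "cmod (of_real t powr \<rho> / (of_real t * (of_real (ln t))\<^sup>2)) = t powr s / (t * (ln t)\<^sup>2)"
      by (simp add: norm_divide norm_mult norm_power norm_powr_real_powr s_def)
    also have "\<dots> = t powr (s - 1) * (1 / (ln t)\<^sup>2)"
      using t by (simp add: powr_diff)
    also have "\<dots> \<le> t powr (s - 1) * (p + r * t powr (- 1/4))"
      using inverse_log_square_le[of t x] t by (intro mult_left_mono) (auto simp: p_def r_def)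
    also have "\<dots> = h t"
      using t by (simp add: h_def distrib_left powr_add[symmetric] algebra_simps)
    finally show "cmod (of_real t powr \<rho> / (of_real t * (of_real (ln t))\<^sup>2)) \<le> h t" .
  qed
  also have "integral {2..x} h = H x - H 2" using hint by (rule integral_unique)
  also have "\<dots> \<le> H x"
  proof -
    have "H 2 \<ge> 0" unfolding H_def using s pr
      by (intro add_nonneg_nonneg mult_nonneg_nonneg divide_nonneg_nonneg) auto
    then show ?thesis by simp
  qed
  also have "\<dots> \<le> p * (x powr s * 2) + r * (x powr (s - 1/4) * 4)"
  proof -
    have "x powr s / s \<le> x powr s * 2"
      using s mult_left_mono[of 1 "s * 2" "x powr s"] by (simp add: divide_le_eq mult_ac)
    moreover have "x powr (s - 1/4) / (s - 1/4) \<le> x powr (s - 1/4) * 4"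
      using s mult_left_mono[of 1 "(s - 1/4) * 4" "x powr (s - 1/4)"] by (simp add: divide_le_eq algebra_simps)
    ultimately show ?thesis
      unfolding H_def using pr by (intro add_mono mult_left_mono) auto
  qed
  also have "\<dots> = x powr s * log_integral_factor x"
  proof -
    have "x powr (1/8) * x powr (s - 1/4) = x powr s * x powr (- 1/8)"
      by (simp add: powr_add[symmetric])
    then show ?thesis
      unfolding p_def r_def log_integral_factor_def by (simp add: algebra_simps)
  qed
  finally show ?thesis by (simp add: s_def)
qed

lemma zero_term_approx:
  assumes "x \<ge> 2" "Re \<rho> \<ge> 1 / 2"
  shows "cmod (zero_term x \<rho> - of_real x powr \<rho> / (\<rho> * of_real (ln x)))
    \<le> x powr Re \<rho> * log_integral_factor x / cmod \<rho>"
  using divide_right_mono[OF zero_term_integral_bound[OF assms], of "cmod \<rho>"]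
  by (simp add: zero_term_def norm_divide norm_mult)

text \<open>The normalization by \<open>ln x / x powr \<beta>\<close> is the one in which the leading terms, with \<open>Re \<rho> = \<beta>\<close>, become pure oscillations in \<open>ln x\<close>.\<close>

lemma scaled_zero_term_approx:
  assumes x: "x \<ge> 2" and re: "Re \<rho> \<ge> 1 / 2"
  shows "cmod (zero_term x \<rho> * of_real (ln x / x powr \<beta>)
      - of_real (x powr (Re \<rho> - \<beta>)) * cis (Im \<rho> * ln x) / \<rho>)
    \<le> x powr (Re \<rho> - \<beta>) * (ln x * log_integral_factor x) / cmod \<rho>"
proof -
  have ln: "ln x > 0" using x by simp
  have "of_real x powr \<rho> = of_real (x powr Re \<rho>) * cis (Im \<rho> * ln x)"
    using x by (simp add: powr_def exp_eq_polar Ln_of_real mult.commute)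
  then have "of_real x powr \<rho> / (\<rho> * of_real (ln x)) * of_real (ln x / x powr \<beta>) =
      of_real (x powr (Re \<rho> - \<beta>)) * cis (Im \<rho> * ln x) / \<rho>"
    using x ln by (simp add: powr_diff)
  then have "zero_term x \<rho> * of_real (ln x / x powr \<beta>)
      - of_real (x powr (Re \<rho> - \<beta>)) * cis (Im \<rho> * ln x) / \<rho> =
     (zero_term x \<rho> - of_real x powr \<rho> / (\<rho> * of_real (ln x))) * of_real (ln x / x powr \<beta>)"
    by (simp only: left_diff_distrib)
  moreover have "cmod (of_real (ln x / x powr \<beta>)) = ln x / x powr \<beta>"
    using ln by (simp only: norm_of_real) simp
  ultimately have "cmod (zero_term x \<rho> * of_real (ln x / x powr \<beta>)
      - of_real (x powr (Re \<rho> - \<beta>)) * cis (Im \<rho> * ln x) / \<rho>) =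
     cmod (zero_term x \<rho> - of_real x powr \<rho> / (\<rho> * of_real (ln x))) * (ln x / x powr \<beta>)"
    by (simp only: norm_mult)
  also have "\<dots> \<le> x powr Re \<rho> * log_integral_factor x / cmod \<rho> * (ln x / x powr \<beta>)"
    using zero_term_approx[OF x re] ln by (intro mult_right_mono) auto
  also have "\<dots> = x powr (Re \<rho> - \<beta>) * (ln x * log_integral_factor x) / cmod \<rho>"
    using x by (simp add: powr_diff mult_ac)
  finally show ?thesis .
qed

lemma scaled_zero_term_bound:
  assumes x: "x \<ge> 2" and re: "Re \<rho> \<ge> 1 / 2"
  shows "cmod (zero_term x \<rho> * of_real (ln x / x powr \<beta>))
    \<le> x powr (Re \<rho> - \<beta>) * (1 + ln x * log_integral_factor x) / cmod \<rho>"
proof -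
  have "cmod (zero_term x \<rho> * of_real (ln x / x powr \<beta>)) \<le>
     cmod (of_real (x powr (Re \<rho> - \<beta>)) * cis (Im \<rho> * ln x) / \<rho>)
      + x powr (Re \<rho> - \<beta>) * (ln x * log_integral_factor x) / cmod \<rho>"
    using scaled_zero_term_approx[OF assms, of \<beta>] norm_triangle_sub order_trans add_left_mono
    by (metis (no_types, lifting))
  also have "cmod (of_real (x powr (Re \<rho> - \<beta>)) * cis (Im \<rho> * ln x) / \<rho>) = x powr (Re \<rho> - \<beta>) / cmod \<rho>"
    by (simp add: norm_mult norm_divide)
  finally show ?thesis by (simp add: distrib_left add_divide_distrib)
qed

section \<open>Asymptotics of the differences between residue classes\<close>

lemma multiplicity_in_eq_0:
  "\<rho> \<notin> seq_points (B \<psi>) \<Longrightarrow> multiplicity_in B \<rho> \<psi> = 0"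
  unfolding multiplicity_in_def by (cases "B \<psi>") (auto simp: card_eq_0_iff)

lemma g_diff_nonzero_imp_point:
  assumes "g_diff q B \<rho> a b \<noteq> 0"
  shows "\<rho> \<in> system_points q B"
proof -
  obtain \<psi> where "\<psi> \<in> nonprincipal_characters q" "multiplicity_in B \<rho> \<psi> \<noteq> 0"
    using assms unfolding g_diff_def by (metis (no_types, lifting) mult_zero_left of_nat_0 sum.not_neutral_contains_not_neutral)
  moreover from this(2) have "\<rho> \<in> seq_points (B \<psi>)" by (rule contrapos_np) (rule multiplicity_in_eq_0)
  ultimately show ?thesis unfolding system_points_def by (intro UN_I)
qed

lemma is_system_Re:
  assumes "is_system q B" "\<rho> \<in> system_points q B"
  shows "R_minus q B \<le> Re \<rho>" "1 / 2 < Re \<rho>" "Re \<rho> \<le> 1"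
proof -
  have "R_minus q B \<le> Re \<rho>"
    using assms unfolding R_minus_def is_system_def by (intro cInf_lower) auto
  moreover have "Re \<rho> \<le> R_plus q B"
    using assms unfolding R_plus_def is_system_def by (intro cSup_upper) auto
  moreover have "1 / 2 < R_minus q B" "R_plus q B \<le> 1"
    using assms unfolding is_system_def by blast+
  ultimately show "R_minus q B \<le> Re \<rho>" "1 / 2 < Re \<rho>" "Re \<rho> \<le> 1"
    by linarith+
qed

text \<open>Membership in some sequence of the system is automatic, since \<open>g(\<rho>; a, b) \<noteq> 0\<close> requires a positive multiplicity.\<close>

lemma z_diff_iff:
  "\<rho> \<in> z_diff q B a b \<longleftrightarrow> g_diff q B \<rho> a b \<noteq> 0 \<and> Re \<rho> = beta_diff q B a b"
proof
  assume "\<rho> \<in> z_diff q B a b"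
  then show "g_diff q B \<rho> a b \<noteq> 0 \<and> Re \<rho> = beta_diff q B a b"
    unfolding z_diff_def by blast
next
  assume *: "g_diff q B \<rho> a b \<noteq> 0 \<and> Re \<rho> = beta_diff q B a b"
  then obtain \<psi> where "\<psi> \<in> nonprincipal_characters q" "\<rho> \<in> seq_points (B \<psi>)"
    using g_diff_nonzero_imp_point[of q B \<rho> a b] unfolding system_points_def by blast
  with * show "\<rho> \<in> z_diff q B a b"
    unfolding z_diff_def by blast
qed

lemma z_diff_subset: "z_diff q B a b \<subseteq> system_points q B"
proof
  fix \<rho> assume "\<rho> \<in> z_diff q B a b"
  then have "g_diff q B \<rho> a b \<noteq> 0" by (simp add: z_diff_iff)
  then show "\<rho> \<in> system_points q B" by (rule g_diff_nonzero_imp_point)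
qed

lemma Re_le_beta_diff:
  assumes "is_system q B" "g_diff q B \<rho> a b \<noteq> 0"
  shows "Re \<rho> \<le> beta_diff q B a b"
  unfolding beta_diff_def
proof (rule cSup_upper)
  have "{Re \<rho> |\<rho>. g_diff q B \<rho> a b \<noteq> 0} \<subseteq> Re ` system_points q B"
    using g_diff_nonzero_imp_point[of q B _ a b] by (intro subsetI, elim CollectE exE conjE) simp
  moreover have "bdd_above (Re ` system_points q B)" using assms by (simp add: is_system_def)
  ultimately show "bdd_above {Re \<rho> |\<rho>. g_diff q B \<rho> a b \<noteq> 0}"
    by (rule bdd_above_mono[rotated])
  show "Re \<rho> \<in> {Re \<rho> |\<rho>. g_diff q B \<rho> a b \<noteq> 0}" using assms(2) by blast
qed

lemma summable_multiplicity:
  assumes "is_system q B" "\<psi> \<in> nonprincipal_characters q"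
  shows "(\<lambda>\<rho>. real (multiplicity_in B \<rho> \<psi>) / cmod \<rho>) summable_on system_points q B"
proof -
  have "(\<lambda>\<rho>. real (multiplicity_in B \<rho> \<psi>) / cmod \<rho>) summable_on seq_points (B \<psi>)"
    using assms by (simp add: is_system_def)
  moreover have "seq_points (B \<psi>) \<subseteq> system_points q B"
    using assms by (auto simp: system_points_def)
  ultimately show ?thesis
    by (subst summable_on_cong_neutral[of "seq_points (B \<psi>)"
        _ "\<lambda>\<rho>. real (multiplicity_in B \<rho> \<psi>) / cmod \<rho>"]) (auto simp: multiplicity_in_eq_0)
qed

lemma weight_le_1: "0 \<le> weight \<rho>" "weight \<rho> \<le> 1"
  by (auto simp: weight_def)

lemma dirichlet_character_1:
  assumes "dirichlet_character q \<psi>"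
  shows "\<psi> 1 = 1"
proof -
  have "\<psi> (1 * 1) = \<psi> 1 * \<psi> 1" "\<psi> 1 \<noteq> 0"
    using assms unfolding dirichlet_character_def by (blast, simp)
  then show ?thesis by simp
qed

text \<open>The sums over points can be interchanged with the finite sum over characters after all of them are extended to the
common set \<open>system_points q B\<close>, where the additional multiplicities are \<open>0\<close>. The interchange is essential: the set
\<open>z(a, 1)\<close> refers to the combined coefficients, and points further to the right may cancel between characters.
The prime counting terms at \<open>1\<close> and \<open>a\<close> are equal and cancel. The coefficient is a conjugate since
the model uses the conjugates of the character values and multiplicities are real.\<close>

lemma model_difference:
  assumes sys: "is_system q B" and x: "x \<ge> 2"
  shows "model_count q B 1 x - model_count q B a x = 2 / real (totient q) *
     Re (\<Sum>\<^sub>\<infinity>\<rho>\<in>system_points q B.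
       of_real (weight \<rho>) * cnj (g_diff q B \<rho> a 1) * zero_term x \<rho>)"
    and "(\<lambda>\<rho>. of_real (weight \<rho>) * cnj (g_diff q B \<rho> a 1) * zero_term x \<rho>)
       summable_on system_points q B"
proof -
  let ?C = "nonprincipal_characters q"
  let ?P = "system_points q B"
  define h where "h \<psi> \<rho> = of_real (weight \<rho>) * of_nat (multiplicity_in B \<rho> \<psi>) * zero_term x \<rho>" for \<psi> \<rho>
  define S where "S \<psi> = (\<Sum>\<^sub>\<infinity>\<rho>\<in>seq_points (B \<psi>). h \<psi> \<rho>)" for \<psi>
  define K where "K = x * (1 + ln x * log_integral_factor x) * (1 / ln x)"
  have ln: "ln x > 0" using x by simp
  have pos: "log_integral_factor x \<ge> 0" by (simp add: log_integral_factor_def)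
  have "h \<psi> summable_on ?P" if "\<psi> \<in> ?C" for \<psi>
  proof -
    have "norm (h \<psi> \<rho>) \<le> real (multiplicity_in B \<rho> \<psi>) / cmod \<rho> * K" if "\<rho> \<in> ?P" for \<rho>
    proof -
      note re = is_system_Re[OF sys that]
      have "zero_term x \<rho> = zero_term x \<rho> * of_real (ln x / x powr 0) * of_real (1 / ln x)"
        using x ln by simp
      then have "cmod (zero_term x \<rho>) = cmod (zero_term x \<rho> * of_real (ln x / x powr 0)) * (1 / ln x)"
        using ln norm_mult[of "zero_term x \<rho> * of_real (ln x / x powr 0)" "of_real (1 / ln x)"]
        by (simp only: norm_of_real) simp
      also have "\<dots> \<le> x powr (Re \<rho> - 0) * (1 + ln x * log_integral_factor x) / cmod \<rho> * (1 / ln x)"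
        using scaled_zero_term_bound[OF x, of \<rho> 0] re ln by (intro mult_right_mono) auto
      also have "\<dots> \<le> x powr 1 * (1 + ln x * log_integral_factor x) / cmod \<rho> * (1 / ln x)"
        using re ln pos x by (intro mult_right_mono divide_right_mono powr_mono) auto
      also have "\<dots> = K / cmod \<rho>" using x by (simp add: K_def)
      finally have zt: "cmod (zero_term x \<rho>) \<le> K / cmod \<rho>" .
      have "norm (h \<psi> \<rho>) = weight \<rho> * real (multiplicity_in B \<rho> \<psi>) * cmod (zero_term x \<rho>)"
        using weight_le_1 by (simp add: h_def norm_mult)
      also have "\<dots> \<le> 1 * real (multiplicity_in B \<rho> \<psi>) * (K / cmod \<rho>)"
        using weight_le_1 zt by (intro mult_mono) auto
      finally show ?thesis by simp
    qed
    moreover have "(\<lambda>\<rho>. real (multiplicity_in B \<rho> \<psi>) / cmod \<rho> * K) summable_on ?P"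
      using summable_multiplicity[OF sys that] by (rule summable_on_cmult_left)
    ultimately have "(\<lambda>\<rho>. norm (h \<psi> \<rho>)) summable_on ?P"
      by (intro summable_on_comparison_test[where g = "\<lambda>\<rho>. norm (h \<psi> \<rho>)"]) auto
    then show ?thesis by (rule abs_summable_summable)
  qed
  then have sh: "(\<lambda>\<rho>. (cnj (\<psi> a) - cnj (\<psi> 1)) * h \<psi> \<rho>) summable_on ?P" if "\<psi> \<in> ?C" for \<psi>
    using that by (intro summable_on_cmult_right) auto
  have S: "S \<psi> = infsum (h \<psi>) ?P" if "\<psi> \<in> ?C" for \<psi>
    unfolding S_def using that
    by (intro infsum_cong_neutral) (auto simp: h_def multiplicity_in_eq_0 system_points_def)
  have mc: "model_count q B b x = - 2 / real (totient q) * Re (\<Sum>\<psi>\<in>?C. cnj (\<psi> b) * S \<psi>)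
      + real (primes_upto_count x) / real (totient q)" for b
    by (simp only: model_count_def S_def h_def)
  have lin: "- 2 / c * y + p - (- 2 / c * y' + p) = 2 / c * (y' - y)" for c y y' p :: real
    by (simp add: right_diff_distrib)
  have eq: "(\<Sum>\<psi>\<in>?C. (cnj (\<psi> a) - cnj (\<psi> 1)) * h \<psi> \<rho>) =
      of_real (weight \<rho>) * cnj (g_diff q B \<rho> a 1) * zero_term x \<rho>" for \<rho>
    by (simp add: g_diff_def h_def sum_distrib_left sum_distrib_right mult_ac)
  note sum_h = infsum_finite_sum[where I = ?C and A = ?P
      and f = "\<lambda>\<psi> \<rho>. (cnj (\<psi> a) - cnj (\<psi> 1)) * h \<psi> \<rho>", OF sh]
  show "(\<lambda>\<rho>. of_real (weight \<rho>) * cnj (g_diff q B \<rho> a 1) * zero_term x \<rho>) summable_on ?P"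
    using sum_h(1) unfolding eq .
  have "(\<Sum>\<^sub>\<infinity>\<rho>\<in>?P. of_real (weight \<rho>) * cnj (g_diff q B \<rho> a 1) * zero_term x \<rho>) =
      (\<Sum>\<psi>\<in>?C. \<Sum>\<^sub>\<infinity>\<rho>\<in>?P. (cnj (\<psi> a) - cnj (\<psi> 1)) * h \<psi> \<rho>)"
    using sum_h(2) unfolding eq .
  also have "\<dots> = (\<Sum>\<psi>\<in>?C. (cnj (\<psi> a) - cnj (\<psi> 1)) * S \<psi>)"
    by (intro sum.cong refl) (simp add: S infsum_cmult_right')
  also have "\<dots> = (\<Sum>\<psi>\<in>?C. cnj (\<psi> a) * S \<psi>) - (\<Sum>\<psi>\<in>?C. cnj (\<psi> 1) * S \<psi>)"
    by (simp add: left_diff_distrib sum_subtractf)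
  finally show "model_count q B 1 x - model_count q B a x = 2 / real (totient q) *
     Re (\<Sum>\<^sub>\<infinity>\<rho>\<in>?P. of_real (weight \<rho>) * cnj (g_diff q B \<rho> a 1) * zero_term x \<rho>)"
    unfolding mc using lin by (simp only: minus_complex.sel)
qed

text \<open>The main term of \<open>F 1 - F a\<close>, normalized to be almost periodic in \<open>u = ln x\<close> and without the factor \<open>2 / \<phi>(q)\<close>.\<close>

definition leading_sum :: "nat \<Rightarrow> system \<Rightarrow> int \<Rightarrow> real \<Rightarrow> real" where
  "leading_sum q B a u =
     Re (\<Sum>\<rho>\<in>z_diff q B a 1. cnj (g_diff q B \<rho> a 1) * cis (Im \<rho> * u) / \<rho>)"

text \<open>Points outside \<open>z(a, 1)\<close> with nonzero coefficient lie strictly to the left of the line \<open>Re \<rho> = \<beta>\<close>, so each of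
their normalized terms tends to \<open>0\<close>; together they are dominated by a multiple of the convergent sum of
\<open>n(\<rho>, \<psi>) / \<bar>\<rho>\<bar>\<close>. On the finite set \<open>z(a, 1)\<close> all weights are \<open>1\<close> because the imaginary parts are positive.\<close>

lemma model_difference_asymptotics:
  assumes sys: "is_system q B"
    and z: "finite (z_diff q B a 1)" "\<And>\<rho>. \<rho> \<in> z_diff q B a 1 \<Longrightarrow> Im \<rho> > 0"
  shows "((\<lambda>x. (model_count q B 1 x - model_count q B a x) * (ln x / x powr beta_diff q B a 1)
      - 2 / real (totient q) * leading_sum q B a (ln x)) \<longlongrightarrow> 0) at_top"
proof -
  define P where "P = system_points q B"
  define Z where "Z = z_diff q B a 1"
  define \<beta> where "\<beta> = beta_diff q B a 1"
  define G where "G \<rho> = cnj (g_diff q B \<rho> a 1)" for \<rho>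
  define h where "h x \<rho> = of_real (weight \<rho>) * G \<rho> * (zero_term x \<rho> * of_real (ln x / x powr \<beta>))" for x \<rho>
  define M where "M \<rho> = cmod (G \<rho>) * 2 / cmod \<rho>" for \<rho>
  define err where "err x = ln x * log_integral_factor x" for x
  have err: "(err \<longlongrightarrow> 0) at_top"
    unfolding err_def by (rule log_integral_factor_tendsto)
  have err0: "err x \<ge> 0" if "x \<ge> 2" for x
    using that by (simp add: err_def log_integral_factor_def)
  have ZP: "Z \<subseteq> P" unfolding Z_def P_def by (rule z_diff_subset)
  have re: "1 / 2 \<le> Re \<rho>" if "\<rho> \<in> P" for \<rho>
    using is_system_Re(2)[OF sys] that by (simp add: P_def less_imp_le)
  have G_le: "Re \<rho> \<le> \<beta>" if "G \<rho> \<noteq> 0" for \<rho>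
    using Re_le_beta_diff[OF sys] that by (simp add: G_def \<beta>_def)
  have G_less: "Re \<rho> < \<beta>" if "G \<rho> \<noteq> 0" "\<rho> \<notin> Z" for \<rho>
    using G_le[OF that(1)] that by (force simp: Z_def z_diff_iff G_def \<beta>_def)
  have bound: "norm (h x \<rho>) \<le> M \<rho> * x powr (Re \<rho> - \<beta>)" if "x \<ge> 2" "err x \<le> 1" "\<rho> \<in> P" for x \<rho>
  proof -
    have "norm (h x \<rho>) = weight \<rho> * cmod (G \<rho>) * cmod (zero_term x \<rho> * of_real (ln x / x powr \<beta>))"
      unfolding h_def norm_mult using weight_le_1[of \<rho>] by simp
    also have "\<dots> \<le> 1 * cmod (G \<rho>) * (x powr (Re \<rho> - \<beta>) * (1 + err x) / cmod \<rho>)"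
      using weight_le_1[of \<rho>] scaled_zero_term_bound[of x \<rho> \<beta>] re[OF that(3)] that(1)
      by (intro mult_mono) (auto simp: err_def)
    also have "\<dots> \<le> 1 * cmod (G \<rho>) * (x powr (Re \<rho> - \<beta>) * 2 / cmod \<rho>)"
      using that by (intro mult_left_mono divide_right_mono) auto
    finally show ?thesis by (simp add: M_def mult_ac)
  qed
  have ev: "\<forall>\<^sub>F x in at_top. x \<ge> 2 \<and> err x \<le> 1"
    using order_tendstoD(2)[OF err zero_less_one]
    by (intro eventually_conj eventually_ge_at_top) (auto elim: eventually_mono)
  have M_sum: "M summable_on P"
  proof -
    have le: "M \<rho> \<le> (\<Sum>\<psi>\<in>nonprincipal_characters q.
        real (multiplicity_in B \<rho> \<psi>) / cmod \<rho> * (2 * cmod (\<psi> a - \<psi> 1)))" for \<rho>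
    proof -
      have "cmod (G \<rho>) \<le> (\<Sum>\<psi>\<in>nonprincipal_characters q.
          real (multiplicity_in B \<rho> \<psi>) * cmod (\<psi> a - \<psi> 1))"
        unfolding G_def complex_mod_cnj g_diff_def
        by (rule order_trans[OF norm_sum]) (simp add: norm_mult)
      then have "M \<rho> \<le> (\<Sum>\<psi>\<in>nonprincipal_characters q.
          real (multiplicity_in B \<rho> \<psi>) * cmod (\<psi> a - \<psi> 1)) * 2 / cmod \<rho>"
        unfolding M_def by (intro divide_right_mono mult_right_mono) auto
      also have "\<dots> = (\<Sum>\<psi>\<in>nonprincipal_characters q.
        real (multiplicity_in B \<rho> \<psi>) / cmod \<rho> * (2 * cmod (\<psi> a - \<psi> 1)))"
        by (simp add: sum_distrib_left sum_distrib_right sum_divide_distrib mult_ac)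
      finally show ?thesis .
    qed
    have "(\<lambda>\<rho>. complex_of_real (\<Sum>\<psi>\<in>nonprincipal_characters q.
        real (multiplicity_in B \<rho> \<psi>) / cmod \<rho> * (2 * cmod (\<psi> a - \<psi> 1)))) summable_on P"
      unfolding of_real_sum
    proof (rule infsum_finite_sum(1))
      fix \<psi> assume "\<psi> \<in> nonprincipal_characters q"
      then show "(\<lambda>\<rho>. complex_of_real (real (multiplicity_in B \<rho> \<psi>) / cmod \<rho>
          * (2 * cmod (\<psi> a - \<psi> 1)))) summable_on P"
        unfolding P_def
        by (intro summable_on_of_real summable_on_cmult_left summable_multiplicity[OF sys])
    qed
    from summable_on_Re[OF this]
    have "(\<lambda>\<rho>. \<Sum>\<psi>\<in>nonprincipal_characters q.
        real (multiplicity_in B \<rho> \<psi>) / cmod \<rho> * (2 * cmod (\<psi> a - \<psi> 1))) summable_on P"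
      by simp
    then show ?thesis
      by (rule summable_on_comparison_test) (use le in \<open>auto simp: M_def\<close>)
  qed
  have minor: "((\<lambda>x. infsum (h x) (P - Z)) \<longlongrightarrow> 0) at_top"
  proof (rule infsum_tendsto_zero_dominated)
    show "M summable_on P - Z" using M_sum by (rule summable_on_subset_banach) auto
    show "\<forall>\<^sub>F x in at_top. \<forall>\<rho>\<in>P - Z. norm (h x \<rho>) \<le> M \<rho>"
      using ev
    proof eventually_elim
      case (elim x)
      show ?case
      proof
        fix \<rho> assume \<rho>: "\<rho> \<in> P - Z"
        show "norm (h x \<rho>) \<le> M \<rho>"
        proof (cases "G \<rho> = 0")
          case False
          then have "x powr (Re \<rho> - \<beta>) \<le> x powr 0"
            using G_le elim by (intro powr_mono) auto
          then have "M \<rho> * x powr (Re \<rho> - \<beta>) \<le> M \<rho> * 1"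
            using elim by (intro mult_left_mono) (auto simp: M_def)
          then show ?thesis using bound[of x \<rho>] elim \<rho> by auto
        qed (simp add: h_def M_def)
      qed
    qed
  next
    fix \<rho> assume \<rho>: "\<rho> \<in> P - Z"
    show "((\<lambda>x. h x \<rho>) \<longlongrightarrow> 0) at_top"
    proof (cases "G \<rho> = 0")
      case False
      then have "Re \<rho> - \<beta> < 0" using G_less \<rho> by auto
      then have "((\<lambda>x. M \<rho> * x powr (Re \<rho> - \<beta>)) \<longlongrightarrow> M \<rho> * 0) at_top"
        by (intro tendsto_mult_left tendsto_neg_powr filterlim_ident)
      then have lim: "((\<lambda>x. M \<rho> * x powr (Re \<rho> - \<beta>)) \<longlongrightarrow> 0) at_top" by simp
      show ?thesis
        by (rule Lim_null_comparison[OF _ lim]) (use ev bound \<rho> in \<open>auto elim!: eventually_mono\<close>)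
    qed (simp add: h_def)
  qed
  have major: "((\<lambda>x. (\<Sum>\<rho>\<in>Z. h x \<rho>) - (\<Sum>\<rho>\<in>Z. G \<rho> * cis (Im \<rho> * ln x) / \<rho>)) \<longlongrightarrow> 0) at_top"
  proof -
    have "((\<lambda>x. h x \<rho> - G \<rho> * cis (Im \<rho> * ln x) / \<rho>) \<longlongrightarrow> 0) at_top" if \<rho>: "\<rho> \<in> Z" for \<rho>
    proof -
      have "((\<lambda>x. cmod (G \<rho>) / cmod \<rho> * err x) \<longlongrightarrow> cmod (G \<rho>) / cmod \<rho> * 0) at_top"
        by (intro tendsto_mult_left err)
      then have lim: "((\<lambda>x. cmod (G \<rho>) / cmod \<rho> * err x) \<longlongrightarrow> 0) at_top" by simp
      have "Im \<rho> > 0" "Re \<rho> = \<beta>"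
        using z(2) \<rho> by (auto simp: Z_def \<beta>_def z_diff_iff)
      then have w: "weight \<rho> = 1" by (auto simp: weight_def complex_is_Real_iff)
      have "norm (h x \<rho> - G \<rho> * cis (Im \<rho> * ln x) / \<rho>) \<le> cmod (G \<rho>) / cmod \<rho> * err x"
        if x: "x \<ge> 2" for x
      proof -
        have "h x \<rho> - G \<rho> * cis (Im \<rho> * ln x) / \<rho> =
          G \<rho> * (zero_term x \<rho> * of_real (ln x / x powr \<beta>)
            - of_real (x powr (Re \<rho> - \<beta>)) * cis (Im \<rho> * ln x) / \<rho>)"
          using x \<open>Re \<rho> = \<beta>\<close> by (simp add: h_def w right_diff_distrib)
        moreover have "\<rho> \<in> P" using \<rho> ZP by blast
        note scaled_zero_term_approx[OF x re[OF this], of \<beta>]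
        ultimately have "norm (h x \<rho> - G \<rho> * cis (Im \<rho> * ln x) / \<rho>) \<le>
            cmod (G \<rho>) * (x powr (Re \<rho> - \<beta>) * err x / cmod \<rho>)"
          by (simp only: norm_mult err_def mult_left_mono norm_ge_zero)
        then show ?thesis using x \<open>Re \<rho> = \<beta>\<close> by simp
      qed
      then show ?thesis
        by (intro Lim_null_comparison[OF _ lim] eventually_mono[OF eventually_ge_at_top[of 2]]) auto
    qed
    then have "((\<lambda>x. \<Sum>\<rho>\<in>Z. h x \<rho> - G \<rho> * cis (Im \<rho> * ln x) / \<rho>) \<longlongrightarrow> (\<Sum>\<rho>\<in>Z. 0)) at_top"
      by (intro tendsto_sum) auto
    then show ?thesis by (simp add: sum_subtractf)
  qed
  have "((\<lambda>x. 2 / real (totient q) * Re (((\<Sum>\<rho>\<in>Z. h x \<rho>) - (\<Sum>\<rho>\<in>Z. G \<rho> * cis (Im \<rho> * ln x) / \<rho>))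
      + infsum (h x) (P - Z))) \<longlongrightarrow> 2 / real (totient q) * Re (0 + 0)) at_top"
    by (intro tendsto_mult_left tendsto_Re tendsto_add major minor)
  then have "((\<lambda>x. 2 / real (totient q) * Re (((\<Sum>\<rho>\<in>Z. h x \<rho>) - (\<Sum>\<rho>\<in>Z. G \<rho> * cis (Im \<rho> * ln x) / \<rho>))
      + infsum (h x) (P - Z))) \<longlongrightarrow> 0) at_top"
    by simp
  moreover have "\<forall>\<^sub>F x in at_top.
     2 / real (totient q) * Re (((\<Sum>\<rho>\<in>Z. h x \<rho>) - (\<Sum>\<rho>\<in>Z. G \<rho> * cis (Im \<rho> * ln x) / \<rho>))
      + infsum (h x) (P - Z)) =
     (model_count q B 1 x - model_count q B a x) * (ln x / x powr \<beta>)
      - 2 / real (totient q) * leading_sum q B a (ln x)"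
    using eventually_ge_at_top[of "2::real"]
  proof eventually_elim
    case (elim x)
    define t where "t = ln x / x powr \<beta>"
    have hx: "h x \<rho> = (of_real (weight \<rho>) * G \<rho> * zero_term x \<rho>) * of_real t" for \<rho>
      by (simp add: h_def t_def)
    have sum: "h x summable_on P"
      using model_difference(2)[OF sys elim, of a] unfolding hx P_def G_def
      by (rule summable_on_cmult_left)
    have "infsum (h x) P = infsum (h x) Z + infsum (h x) (P - Z)"
      using ZP sum infsum_Un_disjoint[of "h x" Z "P - Z"]
      by (auto simp: Un_absorb1 intro: summable_on_subset_banach)
    also have "infsum (h x) Z = (\<Sum>\<rho>\<in>Z. h x \<rho>)" using z(1) by (simp add: Z_def)
    finally have split: "infsum (h x) P = (\<Sum>\<rho>\<in>Z. h x \<rho>) + infsum (h x) (P - Z)" .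
    define W where "W = infsum (\<lambda>\<rho>. of_real (weight \<rho>) * G \<rho> * zero_term x \<rho>) P"
    have "infsum (h x) P = W * of_real t"
      unfolding hx W_def by (rule infsum_cmult_left')
    then have "Re ((\<Sum>\<rho>\<in>Z. h x \<rho>) + infsum (h x) (P - Z)) = Re W * t"
      unfolding split[symmetric] by simp
    then have "2 / real (totient q) * Re ((\<Sum>\<rho>\<in>Z. h x \<rho>) + infsum (h x) (P - Z)) =
      (model_count q B 1 x - model_count q B a x) * t"
      unfolding model_difference(1)[OF sys elim, of a] W_def P_def G_def by simp
    then show ?case
      by (simp add: leading_sum_def Z_def G_def t_def algebra_simps)
  qed
  ultimately show ?thesis
    unfolding \<beta>_def by (rule Lim_transform_eventually)
qed

text \<open>Similarity is measured at the exponent \<open>R_minus q B\<close>, which is at most the exponent \<open>\<beta>(a, 1)\<close> of the main term.\<close>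

lemma family_difference_asymptotics:
  assumes sys: "is_system q B" and sim: "similar_family q (R_minus q B) F B"
    and carrier: "1 \<in> carrier (reduced_residues q)" "a \<in> carrier (reduced_residues q)"
    and z: "z_diff q B a 1 \<noteq> {}" "finite (z_diff q B a 1)" "\<And>\<rho>. \<rho> \<in> z_diff q B a 1 \<Longrightarrow> Im \<rho> > 0"
  shows "((\<lambda>x. (F 1 x - F a x) * (ln x / x powr beta_diff q B a 1)
      - 2 / real (totient q) * leading_sum q B a (ln x)) \<longlongrightarrow> 0) at_top"
proof -
  define \<beta> where "\<beta> = beta_diff q B a 1"
  define r where "r = R_minus q B"
  obtain \<rho> where "\<rho> \<in> z_diff q B a 1" using z by blast
  then have "r \<le> \<beta>"
    using is_system_Re(1)[OF sys, of \<rho>] z_diff_subset[of q B a 1]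
    by (auto simp: z_diff_iff r_def \<beta>_def)
  have err: "((\<lambda>x. (F b x - model_count q B b x) * (ln x / x powr \<beta>)) \<longlongrightarrow> 0) at_top"
    if "b \<in> carrier (reduced_residues q)" for b
  proof -
    have "(\<lambda>x. \<bar>F b x - model_count q B b x\<bar>) \<in> o[at_top](\<lambda>x. x powr r / ln x)"
      using sim that by (simp add: similar_family_def r_def)
    from smalloD_tendsto[OF this]
    have lim: "((\<lambda>x. \<bar>F b x - model_count q B b x\<bar> / (x powr r / ln x)) \<longlongrightarrow> 0) at_top" .
    show ?thesis
    proof (rule Lim_null_comparison[OF _ lim])
      show "\<forall>\<^sub>F x in at_top. norm ((F b x - model_count q B b x) * (ln x / x powr \<beta>))
          \<le> \<bar>F b x - model_count q B b x\<bar> / (x powr r / ln x)"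
        using eventually_ge_at_top[of 2]
      proof eventually_elim
        case (elim x)
        then have "ln x > 0" by simp
        have "x powr r \<le> x powr \<beta>" using elim \<open>r \<le> \<beta>\<close> by (intro powr_mono) auto
        then have "ln x / x powr \<beta> \<le> ln x / x powr r"
          using elim \<open>ln x > 0\<close> by (intro divide_left_mono) auto
        then have "\<bar>F b x - model_count q B b x\<bar> * (ln x / x powr \<beta>)
            \<le> \<bar>F b x - model_count q B b x\<bar> * (ln x / x powr r)"
          by (intro mult_left_mono) auto
        then show ?case using \<open>ln x > 0\<close> by (simp add: abs_mult)
      qed
    qed
  qed
  have "((\<lambda>x. (F 1 x - model_count q B 1 x) * (ln x / x powr \<beta>)
       - (F a x - model_count q B a x) * (ln x / x powr \<beta>)
       + ((model_count q B 1 x - model_count q B a x) * (ln x / x powr \<beta>)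
      - 2 / real (totient q) * leading_sum q B a (ln x))) \<longlongrightarrow> 0 - 0 + 0) at_top"
    unfolding \<beta>_def
    by (intro tendsto_add tendsto_diff err[unfolded \<beta>_def] carrier
        model_difference_asymptotics[OF sys z(2,3)])
  moreover have "(f1 - m1) * t - (fa - ma) * t + ((m1 - ma) * t - l) = (f1 - fa) * t - l"
    for f1 m1 fa ma t l :: real
    by (simp add: left_diff_distrib)
  ultimately show ?thesis by (simp only: \<beta>_def diff_zero add_0_left)
qed

section \<open>Characters on a cyclic group of order four\<close>

text \<open>What characters see of a cyclic group of order four with generator \<open>g\<close> and further elements \<open>g2 = g\<^sup>2\<close>, \<open>g3 = g\<^sup>3\<close>.
Nothing else about the group enters the sign analysis.\<close>

definition quartic_cycle :: "nat \<Rightarrow> int \<Rightarrow> int \<Rightarrow> int \<Rightarrow> bool" where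
  "quartic_cycle q g g2 g3 \<longleftrightarrow>
     (\<forall>\<psi>. dirichlet_character q \<psi> \<longrightarrow> \<psi> g ^ 4 = 1 \<and> \<psi> g2 = \<psi> g ^ 2 \<and> \<psi> g3 = \<psi> g ^ 3)"

lemma fourth_root_of_unity_cases:
  fixes z :: complex
  assumes "z ^ 4 = 1"
  shows "z \<in> {1, - 1, \<i>, - \<i>}"
proof -
  have "(z - 1) * ((z + 1) * ((z - \<i>) * (z + \<i>))) = z ^ 4 - 1"
    by (simp add: algebra_simps power4_eq_xxxx)
  then have "z - 1 = 0 \<or> z + 1 = 0 \<or> z - \<i> = 0 \<or> z + \<i> = 0"
    using assms by simp
  then show ?thesis by (auto simp: add_eq_0_iff2 add_eq_0_iff)
qed

lemma fourth_root_of_unity: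
  fixes z :: complex
  assumes "z ^ 4 = 1"
  shows "z ^ 3 = cnj z" "Im (z ^ 2) = 0" "Re (z ^ 2) \<le> 1"
    and "2 * \<bar>Im z\<bar> \<le> 1 - Re (z ^ 2)" "2 * (Re z - 1) \<le> Re (z ^ 2) - 1"
  using fourth_root_of_unity_cases[OF assms] by (auto simp: power2_eq_square power3_eq_cube)

text \<open>For a single character with value \<open>z\<close> at \<open>g\<close> these are the facts of \<open>fourth_root_of_unity\<close> about \<open>z\<close>; they are linear
in the contributions of the characters and hence pass to sums with nonnegative multiplicities. Here \<open>a \<rho>\<close> is the
number of occurrences of \<open>\<rho>\<close> at characters with value \<open>\<i>\<close> or \<open>- \<i>\<close>.\<close>

lemma g_diff_quartic_cycle:
  fixes B :: system
  assumes cyc: "quartic_cycle q g g2 g3"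
  defines "a \<equiv> \<lambda>\<rho>. - Re (g_diff q B \<rho> g2 1) / 2"
  shows "g_diff q B \<rho> g3 1 = cnj (g_diff q B \<rho> g 1)"
    and "g_diff q B \<rho> g2 1 = of_real (- 2 * a \<rho>)"
    and "0 \<le> a \<rho>"
    and "\<bar>Im (g_diff q B \<rho> g 1)\<bar> \<le> a \<rho>"
    and "Re (g_diff q B \<rho> g 1) \<le> - a \<rho>"
proof -
  let ?C = "nonprincipal_characters q"
  have char: "\<psi> 1 = 1" "\<psi> g ^ 4 = 1" "\<psi> g2 = \<psi> g ^ 2" "\<psi> g3 = \<psi> g ^ 3" if "\<psi> \<in> ?C" for \<psi>
    using that cyc dirichlet_character_1[of q \<psi>]
    by (auto simp: nonprincipal_characters_def quartic_cycle_def)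
  note root = fourth_root_of_unity[OF char(2)]
  show "g_diff q B \<rho> g3 1 = cnj (g_diff q B \<rho> g 1)"
    unfolding g_diff_def cnj_sum by (intro sum.cong refl) (simp add: char root)
  have "Im (g_diff q B \<rho> g2 1) = 0"
    unfolding g_diff_def Im_sum by (intro sum.neutral ballI) (simp add: char root)
  then show "g_diff q B \<rho> g2 1 = of_real (- 2 * a \<rho>)"
    by (simp add: a_def complex_eq_iff)
  have a: "a \<rho> = (\<Sum>\<psi>\<in>?C. real (multiplicity_in B \<rho> \<psi>) * ((1 - Re (\<psi> g ^ 2)) / 2))"
    unfolding a_def g_diff_def Re_sum sum_divide_distrib sum_negf[symmetric]
    by (intro sum.cong refl) (simp add: char algebra_simps diff_divide_distrib)
  show "0 \<le> a \<rho>" unfolding a using root(3) by (intro sum_nonneg mult_nonneg_nonneg) auto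
  have "\<bar>Im (g_diff q B \<rho> g 1)\<bar> \<le> (\<Sum>\<psi>\<in>?C. \<bar>real (multiplicity_in B \<rho> \<psi>) * Im (\<psi> g)\<bar>)"
    unfolding g_diff_def Im_sum by (rule order_trans[OF sum_abs]) (intro sum_mono, simp add: char)
  also have "\<dots> \<le> a \<rho>"
    unfolding a abs_mult using root(4) by (intro sum_mono mult_mono) (auto simp: mult.commute)
  finally show "\<bar>Im (g_diff q B \<rho> g 1)\<bar> \<le> a \<rho>" .
  show "Re (g_diff q B \<rho> g 1) \<le> - a \<rho>"
    unfolding a g_diff_def Re_sum sum_negf[symmetric]
  proof (intro sum_mono)
    fix \<psi> assume "\<psi> \<in> ?C"
    then have "Re (\<psi> g) - 1 \<le> - ((1 - Re (\<psi> g ^ 2)) / 2)" using root(5)[of \<psi>] by argo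
    from mult_left_mono[OF this, of "real (multiplicity_in B \<rho> \<psi>)"]
    show "Re (of_nat (multiplicity_in B \<rho> \<psi>) * (\<psi> g - \<psi> 1))
        \<le> - (real (multiplicity_in B \<rho> \<psi>) * ((1 - Re (\<psi> g ^ 2)) / 2))"
      using char(1)[OF \<open>\<psi> \<in> ?C\<close>] by simp
  qed
qed

section \<open>Signs of the leading sums\<close>

text \<open>The leading sum with \<open>1 / \<rho>\<close> replaced by \<open>1 / (\<i> Im \<rho>)\<close>.\<close>

definition sine_cosine_sum :: "nat \<Rightarrow> system \<Rightarrow> int \<Rightarrow> real \<Rightarrow> real" where
  "sine_cosine_sum q B b u = (\<Sum>\<rho>\<in>z_diff q B b 1.
     (Re (g_diff q B \<rho> b 1) * sin (Im \<rho> * u) - Im (g_diff q B \<rho> b 1) * cos (Im \<rho> * u)) / Im \<rho>)"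

lemma leading_sum_approx:
  assumes sys: "is_system q B" and "\<tau> > 0" and im: "\<And>\<rho>. \<rho> \<in> z_diff q B b 1 \<Longrightarrow> Im \<rho> \<ge> \<tau>"
  shows "\<bar>leading_sum q B b u - sine_cosine_sum q B b u\<bar>
    \<le> (\<Sum>\<rho>\<in>z_diff q B b 1. cmod (g_diff q B \<rho> b 1) / Im \<rho>) / \<tau>"
proof -
  have "leading_sum q B b u - sine_cosine_sum q B b u = (\<Sum>\<rho>\<in>z_diff q B b 1.
     Re (cnj (g_diff q B \<rho> b 1) * cis (Im \<rho> * u) * (1 / \<rho> - 1 / (\<i> * of_real (Im \<rho>)))))"
    unfolding leading_sum_def sine_cosine_sum_def Re_sum sum_subtractf[symmetric]
  proof (intro sum.cong refl)
    fix \<rho> assume "\<rho> \<in> z_diff q B b 1"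
    then have "Im \<rho> > 0" using im \<open>\<tau> > 0\<close> by fastforce
    then have "Re (cnj (g_diff q B \<rho> b 1) * cis (Im \<rho> * u) * (1 / (\<i> * of_real (Im \<rho>)))) =
      (Re (g_diff q B \<rho> b 1) * sin (Im \<rho> * u) - Im (g_diff q B \<rho> b 1) * cos (Im \<rho> * u)) / Im \<rho>"
      by (simp add: Re_divide power2_eq_square diff_divide_distrib add_divide_distrib)
    then show "Re (cnj (g_diff q B \<rho> b 1) * cis (Im \<rho> * u) / \<rho>) -
       (Re (g_diff q B \<rho> b 1) * sin (Im \<rho> * u) - Im (g_diff q B \<rho> b 1) * cos (Im \<rho> * u)) / Im \<rho> =
      Re (cnj (g_diff q B \<rho> b 1) * cis (Im \<rho> * u) * (1 / \<rho> - 1 / (\<i> * of_real (Im \<rho>))))"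
      by (simp only: right_diff_distrib minus_complex.sel) simp
  qed
  also have "\<bar>\<dots>\<bar> \<le> (\<Sum>\<rho>\<in>z_diff q B b 1. cmod (g_diff q B \<rho> b 1) / Im \<rho> / \<tau>)"
  proof (rule order_trans[OF sum_abs], intro sum_mono)
    fix \<rho> assume \<rho>: "\<rho> \<in> z_diff q B b 1"
    have im': "Im \<rho> \<ge> \<tau>" "Im \<rho> > 0" using im[OF \<rho>] \<open>\<tau> > 0\<close> by auto
    have re: "0 < Re \<rho>" "Re \<rho> \<le> 1"
      using is_system_Re[OF sys subsetD[OF z_diff_subset \<rho>]] by auto
    have "\<rho> \<noteq> 0" using re by auto
    have "1 / \<rho> - 1 / (\<i> * of_real (Im \<rho>)) = (\<i> * of_real (Im \<rho>) - \<rho>) / (\<rho> * (\<i> * of_real (Im \<rho>)))"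
      using im' \<open>\<rho> \<noteq> 0\<close> by (simp add: field_simps)
    also have "\<i> * of_real (Im \<rho>) - \<rho> = - of_real (Re \<rho>)" by (simp add: complex_eq_iff)
    finally have "cmod (1 / \<rho> - 1 / (\<i> * of_real (Im \<rho>))) = Re \<rho> / (cmod \<rho> * Im \<rho>)"
      using re im' by (simp add: norm_divide norm_mult)
    also have "\<dots> \<le> 1 / (\<tau> * Im \<rho>)"
      using re im' \<open>\<tau> > 0\<close> abs_Im_le_cmod[of \<rho>]
      by (intro frac_le mult_right_mono mult_pos_pos) auto
    finally have d: "cmod (1 / \<rho> - 1 / (\<i> * of_real (Im \<rho>))) \<le> 1 / (\<tau> * Im \<rho>)" .
    have "\<bar>Re (cnj (g_diff q B \<rho> b 1) * cis (Im \<rho> * u) * (1 / \<rho> - 1 / (\<i> * of_real (Im \<rho>))))\<bar>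
       \<le> cmod (g_diff q B \<rho> b 1) * cmod (1 / \<rho> - 1 / (\<i> * of_real (Im \<rho>)))"
      by (rule order_trans[OF abs_Re_le_cmod]) (simp add: norm_mult)
    also have "\<dots> \<le> cmod (g_diff q B \<rho> b 1) * (1 / (\<tau> * Im \<rho>))"
      by (intro mult_left_mono d) auto
    finally show "\<bar>Re (cnj (g_diff q B \<rho> b 1) * cis (Im \<rho> * u) * (1 / \<rho> - 1 / (\<i> * of_real (Im \<rho>))))\<bar>
       \<le> cmod (g_diff q B \<rho> b 1) / Im \<rho> / \<tau>" by (simp add: mult_ac)
  qed
  finally show ?thesis by (simp add: sum_divide_distrib)
qed

text \<open>Let \<open>a\<close>, \<open>b\<close>, \<open>c\<close> be as in the introduction. A point of \<open>z(g, 1)\<close> with \<open>a \<rho> > 0\<close> always belongs to \<open>z(g\<^sup>2, 1)\<close>, as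
\<open>\<beta>(g\<^sup>2, 1) \<le> \<beta>(g, 1)\<close>. So there are two cases. If the two sets meet, they have the same abscissa and one contains
the other, and \<open>sine_cosine_domination\<close> applies. If they are disjoint, then \<open>a\<close> and with it \<open>c\<close> vanish on \<open>z(g, 1)\<close>,
and \<open>two_sine_sums_positive\<close> applies to the two sine sums. The margin \<open>8 / threshold n\<close> exceeds the error
\<open>2 / threshold n\<close> of passing from \<open>sine_cosine_sum\<close> to \<open>leading_sum\<close>.\<close>

lemma leading_sums_same_sign:
  fixes s :: real
  assumes sys: "is_system q B" and cyc: "quartic_cycle q g g2 g3"
    and z: "z_diff q B g 1 \<noteq> {}" "finite (z_diff q B g 1 \<union> z_diff q B g2 1)"
      "card (z_diff q B g 1 \<union> z_diff q B g2 1) \<le> n"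
    and im: "\<And>\<rho>. \<rho> \<in> z_diff q B g 1 \<union> z_diff q B g2 1 \<Longrightarrow> Im \<rho> \<ge> real (threshold n)"
    and s: "s \<in> {1, -1}"
  obtains u where "s * leading_sum q B g u < 0" "s * leading_sum q B g3 u < 0"
    "z_diff q B g2 1 \<noteq> {} \<Longrightarrow> s * leading_sum q B g2 u < 0"
proof -
  let ?Z = "z_diff q B g 1" and ?Z2 = "z_diff q B g2 1"
  define G where "G \<rho> = g_diff q B \<rho> g 1" for \<rho>
  define a where "a \<rho> = - Re (g_diff q B \<rho> g2 1) / 2" for \<rho>
  define b where "b \<rho> = - Re (G \<rho>) - a \<rho>" for \<rho>
  define c where "c \<rho> = Im (G \<rho>)" for \<rho>
  define \<tau> where "\<tau> = real (threshold n)"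
  note gd = g_diff_quartic_cycle[OF cyc, of B, folded G_def a_def]
  have b0: "b \<rho> \<ge> 0" for \<rho> using gd(5)[of \<rho>] by (simp add: b_def)
  have c_le: "\<bar>c \<rho>\<bar> \<le> a \<rho>" for \<rho> using gd(4) by (simp add: c_def)
  have G_eq: "Re (G \<rho>) = - (a \<rho> + b \<rho>)" "Im (G \<rho>) = c \<rho>" for \<rho> by (simp_all add: b_def c_def)
  have G2_nz: "g_diff q B \<rho> g2 1 \<noteq> 0 \<longleftrightarrow> a \<rho> > 0" for \<rho>
    using gd(2,3)[of \<rho>] by (auto simp: less_le)
  have G_nz: "G \<rho> \<noteq> 0 \<longleftrightarrow> a \<rho> + b \<rho> > 0" for \<rho>
    using gd(3)[of \<rho>] b0[of \<rho>] c_le[of \<rho>] by (auto simp: complex_eq_iff G_eq)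
  have norm_G: "cmod (G \<rho>) \<le> 2 * (a \<rho> + b \<rho>)" for \<rho>
    using cmod_le[of "G \<rho>"] c_le[of \<rho>] b0[of \<rho>] gd(3)[of \<rho>] by (simp add: G_eq)
  have "card (?Z \<union> ?Z2) > 0" using z by (simp add: card_gt_0_iff)
  then have "n \<ge> 1" using z by linarith
  then have \<tau>: "\<tau> > 0" by (simp add: \<tau>_def threshold_def)
  have im': "Im \<rho> \<ge> \<tau>" "Im \<rho> > 0" if "\<rho> \<in> ?Z \<union> ?Z2" for \<rho>
    using im[OF that] \<tau> by (auto simp: \<tau>_def)
  have fin: "finite ?Z" "finite ?Z2" using z by auto
  have cards: "card ?Z \<le> n" using z(2,3) card_mono[of "?Z \<union> ?Z2" ?Z] by auto
  have Z3: "z_diff q B g3 1 = ?Z"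
  proof -
    have "beta_diff q B g3 1 = beta_diff q B g 1"
      by (simp add: beta_diff_def gd(1) G_def)
    then show ?thesis by (auto simp: z_diff_iff gd(1) G_def)
  qed
  have beta_eq: "\<rho> \<in> ?Z2" if "\<rho> \<in> ?Z" "a \<rho> > 0" for \<rho>
  proof -
    have "beta_diff q B g2 1 \<le> beta_diff q B g 1"
    proof -
      have "beta_diff q B g2 1 = Sup {Re \<rho> |\<rho>. g_diff q B \<rho> g2 1 \<noteq> 0}"
        by (simp add: beta_diff_def)
      also have "\<dots> \<le> beta_diff q B g 1"
      proof (rule cSup_least)
        show "{Re \<rho> |\<rho>. g_diff q B \<rho> g2 1 \<noteq> 0} \<noteq> {}" using that G2_nz by blast
      next
        fix r assume "r \<in> {Re \<rho> |\<rho>. g_diff q B \<rho> g2 1 \<noteq> 0}"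
        then obtain \<rho>' where "r = Re \<rho>'" "a \<rho>' > 0" using G2_nz by auto
        then show "r \<le> beta_diff q B g 1"
          using Re_le_beta_diff[OF sys, of \<rho>' g 1] G_nz[of \<rho>'] b0[of \<rho>'] by (auto simp: G_def)
      qed
      finally show ?thesis .
    qed
    moreover have "Re \<rho> \<le> beta_diff q B g2 1"
      using Re_le_beta_diff[OF sys, of \<rho> g2 1] that G2_nz by auto
    ultimately show ?thesis using that G2_nz[of \<rho>] by (auto simp: z_diff_iff)
  qed
  define A where "A = (\<Sum>\<rho>\<in>?Z2. a \<rho> / Im \<rho>)"
  define T where "T = (\<Sum>\<rho>\<in>?Z. (a \<rho> + b \<rho>) / Im \<rho>)"
  define X where "X u = (\<Sum>\<rho>\<in>?Z2. a \<rho> / Im \<rho> * sin (Im \<rho> * u))" for u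
  define Y where "Y u = (\<Sum>\<rho>\<in>?Z. (a \<rho> + b \<rho>) / Im \<rho> * sin (Im \<rho> * u))" for u
  define V where "V u = (\<Sum>\<rho>\<in>?Z. c \<rho> / Im \<rho> * cos (Im \<rho> * u))" for u
  have "\<exists>v. Y v \<ge> \<bar>V v\<bar> + 8 / \<tau> * T \<and> (?Z2 \<noteq> {} \<longrightarrow> X v \<ge> 8 / \<tau> * A)"
  proof (cases "?Z \<inter> ?Z2 = {}")
    case False
    then obtain \<rho>0 where \<rho>0: "\<rho>0 \<in> ?Z" "\<rho>0 \<in> ?Z2" by blast
    have Z2: "?Z2 \<subseteq> ?Z"
    proof
      fix \<rho> assume "\<rho> \<in> ?Z2"
      then show "\<rho> \<in> ?Z"
        using \<rho>0 G2_nz[of \<rho>] G_nz[of \<rho>] b0[of \<rho>] by (auto simp: z_diff_iff G_def)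
    qed
    have a_out: "a \<rho> = 0" if "\<rho> \<in> ?Z - ?Z2" for \<rho>
      using that beta_eq[of \<rho>] gd(3)[of \<rho>] by (auto simp: less_le)
    have X_eq: "X u = (\<Sum>\<rho>\<in>?Z. a \<rho> / Im \<rho> * sin (Im \<rho> * u))" for u
      unfolding X_def using Z2 fin a_out by (intro sum.mono_neutral_left) auto
    have A_eq: "A = (\<Sum>\<rho>\<in>?Z. a \<rho> / Im \<rho>)"
      unfolding A_def using Z2 fin a_out by (intro sum.mono_neutral_left) auto
    have "a \<rho>0 > 0" using \<rho>0 G2_nz by (auto simp: z_diff_iff)
    then have "A > 0" unfolding A_eq
      using \<rho>0 im' gd(3) fin by (intro sum_pos2[of _ \<rho>0]) (auto intro!: divide_nonneg_pos)
    then have "\<exists>v. (\<Sum>\<rho>\<in>?Z. a \<rho> / Im \<rho> * sin (Im \<rho> * v)) \<ge> 16 / real (threshold n) * (\<Sum>\<rho>\<in>?Z. a \<rho> / Im \<rho>) \<and>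
      (\<Sum>\<rho>\<in>?Z. a \<rho> / Im \<rho> * sin (Im \<rho> * v)) + (\<Sum>\<rho>\<in>?Z. b \<rho> / Im \<rho> * sin (Im \<rho> * v)) \<ge>
       \<bar>\<Sum>\<rho>\<in>?Z. c \<rho> / Im \<rho> * cos (Im \<rho> * v)\<bar> +
       16 / real (threshold n) * ((\<Sum>\<rho>\<in>?Z. a \<rho> / Im \<rho>) + (\<Sum>\<rho>\<in>?Z. b \<rho> / Im \<rho>))"
      using im' gd(3) b0 c_le unfolding A_eq
      by - (rule sine_cosine_domination[OF fin(1) cards, where f = Im and a = "\<lambda>\<rho>. a \<rho> / Im \<rho>"
          and b = "\<lambda>\<rho>. b \<rho> / Im \<rho>" and c = "\<lambda>\<rho>. c \<rho> / Im \<rho>"];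
          force intro: divide_nonneg_pos divide_right_mono simp: abs_divide)
    then obtain v where v: "X v \<ge> 16 / \<tau> * A" "Y v \<ge> \<bar>V v\<bar> + 16 / \<tau> * T"
      by (auto simp: X_eq A_eq Y_def V_def T_def \<tau>_def sum.distrib add_divide_distrib distrib_right)
    have "T \<ge> 0" unfolding T_def using im' gd(3) b0 by (intro sum_nonneg divide_nonneg_pos add_nonneg_nonneg) auto
    then have "8 / \<tau> * A \<le> 16 / \<tau> * A" "8 / \<tau> * T \<le> 16 / \<tau> * T"
      using \<tau> \<open>A > 0\<close> by (auto intro!: mult_right_mono divide_right_mono)
    then show ?thesis using v by (intro exI[of _ v]) auto
  next
    case True
    have a_out: "a \<rho> = 0" if "\<rho> \<in> ?Z" for \<rho>
      using that beta_eq[of \<rho>] gd(3)[of \<rho>] True by (auto simp: less_le)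
    then have "c \<rho> = 0" if "\<rho> \<in> ?Z" for \<rho> using that c_le[of \<rho>] by simp
    then have V0: "V u = 0" for u unfolding V_def by simp
    have b_pos: "b \<rho> > 0" if "\<rho> \<in> ?Z" for \<rho>
      using that a_out[OF that] G_nz[of \<rho>] by (auto simp: z_diff_iff G_def)
    have a_pos: "a \<rho> > 0" if "\<rho> \<in> ?Z2" for \<rho>
      using that G2_nz[of \<rho>] by (auto simp: z_diff_iff)
    define y where "y \<rho> = (if \<rho> \<in> ?Z then (a \<rho> + b \<rho>) / Im \<rho> else 0)" for \<rho>
    \<comment> \<open>If \<open>z(g\<^sup>2, 1)\<close> is empty there is no condition on \<open>X\<close>; repeating \<open>y\<close> meets the positivity hypothesis.\<close>
    define x where "x \<rho> = (if ?Z2 = {} then y \<rho> else if \<rho> \<in> ?Z2 then a \<rho> / Im \<rho> else 0)" for \<rho>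
    have y_sum: "(\<Sum>\<rho>\<in>?Z \<union> ?Z2. y \<rho> * h \<rho>) = (\<Sum>\<rho>\<in>?Z. (a \<rho> + b \<rho>) / Im \<rho> * h \<rho>)" for h
      using fin by (intro sum.mono_neutral_cong_right) (auto simp: y_def)
    have x_sum: "(\<Sum>\<rho>\<in>?Z \<union> ?Z2. x \<rho> * h \<rho>) = (\<Sum>\<rho>\<in>?Z2. a \<rho> / Im \<rho> * h \<rho>)" if "?Z2 \<noteq> {}" for h
      using fin that by (intro sum.mono_neutral_cong_right) (auto simp: x_def)
    have y0: "y \<rho> \<ge> 0" if "\<rho> \<in> ?Z \<union> ?Z2" for \<rho>
      using im'(2)[OF that] gd(3)[of \<rho>] b0[of \<rho>] by (simp add: y_def)
    have x0: "x \<rho> \<ge> 0" if "\<rho> \<in> ?Z \<union> ?Z2" for \<rho>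
      using im'(2)[OF that] gd(3)[of \<rho>] y0[OF that] by (simp add: x_def)
    have T_pos: "T > 0" unfolding T_def using z(1) fin b_pos gd(3) im'
      by (intro sum_pos divide_pos_pos add_nonneg_pos) auto
    have y_T: "sum y (?Z \<union> ?Z2) = T" using y_sum[of "\<lambda>_. 1"] by (simp add: T_def)
    have x_A: "sum x (?Z \<union> ?Z2) = A" if "?Z2 \<noteq> {}"
      using x_sum[OF that, of "\<lambda>_. 1"] by (simp add: A_def)
    have "sum x (?Z \<union> ?Z2) > 0"
    proof (cases "?Z2 = {}")
      case False
      then have "A > 0" unfolding A_def using fin a_pos im' by (intro sum_pos divide_pos_pos) auto
      then show ?thesis using x_A False by simp
    next
      case True
      then show ?thesis using y_T T_pos by (simp add: x_def)
    qed
    then have "\<exists>v. (\<Sum>\<rho>\<in>?Z \<union> ?Z2. x \<rho> * sin (Im \<rho> * v)) \<ge> 8 / real (threshold n) * sum x (?Z \<union> ?Z2) \<and>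
        (\<Sum>\<rho>\<in>?Z \<union> ?Z2. y \<rho> * sin (Im \<rho> * v)) \<ge> 8 / real (threshold n) * sum y (?Z \<union> ?Z2)"
      using T_pos unfolding y_T[symmetric]
      by - (rule two_sine_sums_positive[OF z(2,3), where f = Im and a = x and b = y]; use im'(2) x0 y0 in blast)
    then obtain v where v: "(\<Sum>\<rho>\<in>?Z \<union> ?Z2. x \<rho> * sin (Im \<rho> * v)) \<ge> 8 / \<tau> * sum x (?Z \<union> ?Z2)"
      "Y v \<ge> 8 / \<tau> * T"
      unfolding y_sum y_T by (auto simp: Y_def \<tau>_def)
    have "X v \<ge> 8 / \<tau> * A" if "?Z2 \<noteq> {}"
      using v(1) unfolding x_sum[OF that] x_A[OF that] by (simp add: X_def)
    then show ?thesis using v(2) V0 by (intro exI[of _ v]) auto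
  qed
  then obtain v where v: "Y v \<ge> \<bar>V v\<bar> + 8 / \<tau> * T" "?Z2 \<noteq> {} \<Longrightarrow> X v \<ge> 8 / \<tau> * A" by blast
  have T_pos: "T > 0" unfolding T_def
    using z(1) fin im' G_nz by (intro sum_pos divide_pos_pos) (auto simp: z_diff_iff G_def)
  have A_pos: "A > 0" if "?Z2 \<noteq> {}" unfolding A_def
    using that fin im' G2_nz by (intro sum_pos divide_pos_pos) (auto simp: z_diff_iff)
  have sY: "s * Y (s * v) = Y v" and sX: "s * X (s * v) = X v" and sV: "V (s * v) = V v"
    using s by (auto simp: X_def Y_def V_def sum_negf)
  have abs_s: "\<bar>s\<bar> = 1" using s by auto
  have small: "s * l < 0" if "\<bar>l - e\<bar> \<le> d" "s * e < - d" for l e d :: real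
    using that s by auto
  have eg: "sine_cosine_sum q B g u = - Y u - V u" for u
    unfolding sine_cosine_sum_def Y_def V_def sum_negf[symmetric] sum_subtractf[symmetric]
    by (intro sum.cong refl)
      (simp add: G_def[symmetric] G_eq diff_divide_distrib add_divide_distrib ring_distribs)
  have eg3: "sine_cosine_sum q B g3 u = - Y u + V u" for u
    unfolding sine_cosine_sum_def Z3 Y_def V_def sum_negf[symmetric] sum.distrib[symmetric]
    by (intro sum.cong refl)
      (simp add: gd(1) G_eq diff_divide_distrib add_divide_distrib ring_distribs)
  have eg2: "sine_cosine_sum q B g2 u = - 2 * X u" for u
    by (simp add: sine_cosine_sum_def X_def sum_distrib_left gd(2) mult.assoc)
  have sum_G: "(\<Sum>\<rho>\<in>?Z. cmod (G \<rho>) / Im \<rho>) / \<tau> \<le> 2 / \<tau> * T"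
  proof -
    have "(\<Sum>\<rho>\<in>?Z. cmod (G \<rho>) / Im \<rho>) \<le> (\<Sum>\<rho>\<in>?Z. 2 * ((a \<rho> + b \<rho>) / Im \<rho>))"
    proof (intro sum_mono)
      fix \<rho> assume "\<rho> \<in> ?Z"
      then show "cmod (G \<rho>) / Im \<rho> \<le> 2 * ((a \<rho> + b \<rho>) / Im \<rho>)"
        using divide_right_mono[OF norm_G[of \<rho>], of "Im \<rho>"] im'(2)[of \<rho>] by simp
    qed
    also have "\<dots> = 2 * T" by (simp add: T_def sum_distrib_left)
    finally show ?thesis using \<tau> by (simp add: divide_right_mono)
  qed
  have sum_G2: "(\<Sum>\<rho>\<in>?Z2. cmod (g_diff q B \<rho> g2 1) / Im \<rho>) / \<tau> = 2 / \<tau> * A"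
  proof -
    have "(\<Sum>\<rho>\<in>?Z2. cmod (g_diff q B \<rho> g2 1) / Im \<rho>) = 2 * A"
      using gd(3) by (simp add: gd(2) A_def sum_distrib_left norm_mult)
    then show ?thesis by simp
  qed
  have T8: "2 / \<tau> * T < 8 / \<tau> * T"
    using T_pos \<tau> by (intro mult_strict_right_mono divide_strict_right_mono) auto
  show thesis
  proof (rule that[of "s * v"])
    have "\<bar>leading_sum q B g (s * v) - sine_cosine_sum q B g (s * v)\<bar> \<le> 2 / \<tau> * T"
      using leading_sum_approx[OF sys \<tau>, of g "s * v"] im'(1) sum_G by (fastforce simp: G_def)
    moreover have "s * sine_cosine_sum q B g (s * v) < - (2 / \<tau> * T)"
      using sY sV v(1) T8 s by (auto simp: eg)
    ultimately show "s * leading_sum q B g (s * v) < 0" by (rule small)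
    have "\<bar>leading_sum q B g3 (s * v) - sine_cosine_sum q B g3 (s * v)\<bar> \<le> 2 / \<tau> * T"
      using leading_sum_approx[OF sys \<tau>, of g3 "s * v"] im'(1) sum_G by (fastforce simp: Z3 gd(1))
    moreover have "s * sine_cosine_sum q B g3 (s * v) < - (2 / \<tau> * T)"
      using sY sV v(1) T8 s by (auto simp: eg3)
    ultimately show "s * leading_sum q B g3 (s * v) < 0" by (rule small)
    assume "?Z2 \<noteq> {}"
    then have "2 / \<tau> * A < 2 * (8 / \<tau> * A)" using A_pos \<tau> by (simp add: field_simps)
    have "\<bar>leading_sum q B g2 (s * v) - sine_cosine_sum q B g2 (s * v)\<bar> \<le> 2 / \<tau> * A"
      using leading_sum_approx[OF sys \<tau>, of g2 "s * v"] im'(1) sum_G2 by fastforce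
    moreover have "s * sine_cosine_sum q B g2 (s * v) < - (2 / \<tau> * A)"
      using sX v(2)[OF \<open>?Z2 \<noteq> {}\<close>] \<open>2 / \<tau> * A < 2 * (8 / \<tau> * A)\<close> s by (auto simp: eg2)
    ultimately show "s * leading_sum q B g2 (s * v) < 0" by (rule small)
  qed
qed

section \<open>Recurrence of the signs\<close>

lemma leading_sum_recurrence:
  assumes "finite (z_diff q B b 1)" "d \<ge> 0"
    and "\<And>\<rho>. \<rho> \<in> z_diff q B b 1 \<Longrightarrow> cmod (cis (Im \<rho> * t) - 1) \<le> d"
  shows "\<bar>leading_sum q B b (u + t) - leading_sum q B b u\<bar>
    \<le> d * (\<Sum>\<rho>\<in>z_diff q B b 1. cmod (g_diff q B \<rho> b 1) / cmod \<rho>)"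
proof -
  have "leading_sum q B b (u + t) - leading_sum q B b u =
    Re (\<Sum>\<rho>\<in>z_diff q B b 1. cnj (g_diff q B \<rho> b 1) * cis (Im \<rho> * u) / \<rho> * (cis (Im \<rho> * t) - 1))"
    unfolding leading_sum_def minus_complex.sel[symmetric] sum_subtractf[symmetric]
    by (intro arg_cong[of _ _ Re] sum.cong refl)
      (simp add: distrib_left right_diff_distrib cis_mult[symmetric] diff_divide_distrib mult_ac)
  also have "\<bar>\<dots>\<bar> \<le> (\<Sum>\<rho>\<in>z_diff q B b 1. cmod (cnj (g_diff q B \<rho> b 1) * cis (Im \<rho> * u) / \<rho> * (cis (Im \<rho> * t) - 1)))"
    by (rule order_trans[OF abs_Re_le_cmod norm_sum])
  also have "\<dots> \<le> (\<Sum>\<rho>\<in>z_diff q B b 1. d * (cmod (g_diff q B \<rho> b 1) / cmod \<rho>))"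
  proof (intro sum_mono)
    fix \<rho> assume "\<rho> \<in> z_diff q B b 1"
    from mult_right_mono[OF assms(3)[OF this], of "cmod (g_diff q B \<rho> b 1) / cmod \<rho>"]
    show "cmod (cnj (g_diff q B \<rho> b 1) * cis (Im \<rho> * u) / \<rho> * (cis (Im \<rho> * t) - 1))
        \<le> d * (cmod (g_diff q B \<rho> b 1) / cmod \<rho>)"
      by (simp add: norm_mult norm_divide mult_ac)
  qed
  finally show ?thesis by (simp add: sum_distrib_left)
qed

text \<open>A time shift that nearly restores all phases, as given by \<open>simultaneous_recurrence\<close>, changes each of the finitely many sums by less than half of its value at \<open>v\<close>.\<close>

lemma leading_sums_recurrent:
  fixes s :: real
  assumes "finite S" and fin: "\<And>b. b \<in> S \<Longrightarrow> finite (z_diff q B b 1)"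
    and neg: "\<And>b. b \<in> S \<Longrightarrow> s * leading_sum q B b v < 0" and s: "s \<in> {1, -1}"
  obtains u where "u \<ge> U" "\<And>b. b \<in> S \<Longrightarrow> s * leading_sum q B b u \<le> s * leading_sum q B b v / 2"
proof -
  define K where "K b = (\<Sum>\<rho>\<in>z_diff q B b 1. cmod (g_diff q B \<rho> b 1) / cmod \<rho>)" for b
  have "\<forall>\<^sub>F d in at_right 0. d * K b < - (s * leading_sum q B b v) / 2" if "b \<in> S" for b
  proof -
    have "((\<lambda>d. d * K b) \<longlongrightarrow> 0 * K b) (at_right 0)"
      by (intro tendsto_mult_right tendsto_ident_at)
    then show ?thesis using neg[OF that] by (intro order_tendstoD(2)) auto
  qed
  then have "\<forall>\<^sub>F d in at_right 0. \<forall>b\<in>S. d * K b < - (s * leading_sum q B b v) / 2"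
    using \<open>finite S\<close> by (intro eventually_ball_finite) auto
  then have "\<forall>\<^sub>F d in at_right 0. d > 0 \<and> (\<forall>b\<in>S. d * K b < - (s * leading_sum q B b v) / 2)"
    using eventually_at_right_less[of "0::real"] by (rule eventually_elim2) auto
  then obtain d where d: "d > 0" "\<And>b. b \<in> S \<Longrightarrow> d * K b < - (s * leading_sum q B b v) / 2"
    using eventually_happens'[of "at_right (0::real)"] by force
  have "finite (\<Union>b\<in>S. z_diff q B b 1)" using \<open>finite S\<close> fin by auto
  then obtain t where t: "t \<ge> U - v"
    "\<And>\<rho>. \<rho> \<in> (\<Union>b\<in>S. z_diff q B b 1) \<Longrightarrow> cmod (cis (Im \<rho> * t) - 1) \<le> d"
    using simultaneous_recurrence[of "\<Union>b\<in>S. z_diff q B b 1" d "U - v" Im] d(1) by blast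
  show thesis
  proof (rule that[of "v + t"])
    fix b assume b: "b \<in> S"
    have "\<bar>leading_sum q B b (v + t) - leading_sum q B b v\<bar> \<le> d * K b"
      unfolding K_def using b d t by (intro leading_sum_recurrence fin) auto
    then have "s * leading_sum q B b (v + t) \<le> s * leading_sum q B b v + d * K b"
      using s by auto
    then show "s * leading_sum q B b (v + t) \<le> s * leading_sum q B b v / 2"
      using d(2)[OF b] by simp
  qed (use t in simp)
qed

text \<open>The leading sums return infinitely often to values bounded away from \<open>0\<close>, whereas the error in the asymptotics tends to
\<open>0\<close>; so the differences themselves inherit the signs of the leading sums at \<open>v\<close>. The factor \<open>s\<close> treats both signs at once.\<close>

lemma family_differences_frequently_negative:
  fixes s :: real
  assumes sys: "is_system q B" and sim: "similar_family q (R_minus q B) F B"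
    and carrier: "1 \<in> carrier (reduced_residues q)" "S \<subseteq> carrier (reduced_residues q)"
    and "finite S" "q > 0"
    and z: "\<And>b. b \<in> S \<Longrightarrow> z_diff q B b 1 \<noteq> {}" "\<And>b. b \<in> S \<Longrightarrow> finite (z_diff q B b 1)"
      "\<And>b \<rho>. b \<in> S \<Longrightarrow> \<rho> \<in> z_diff q B b 1 \<Longrightarrow> Im \<rho> > 0"
    and neg: "\<And>b. b \<in> S \<Longrightarrow> s * leading_sum q B b v < 0" and s: "s \<in> {1, -1}"
  obtains x where "x \<ge> x0" "\<And>b. b \<in> S \<Longrightarrow> s * (F 1 x - F b x) < 0"
proof -
  define k where "k = 2 / real (totient q)"
  have "k > 0" using \<open>q > 0\<close> by (simp add: k_def)
  define D where "D b x = (F 1 x - F b x) * (ln x / x powr beta_diff q B b 1)" for b x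
  have "\<forall>\<^sub>F x in at_top. \<bar>D b x - k * leading_sum q B b (ln x)\<bar> < - (s * k * leading_sum q B b v) / 2"
    if b: "b \<in> S" for b
  proof -
    have "((\<lambda>x. D b x - k * leading_sum q B b (ln x)) \<longlongrightarrow> 0) at_top"
      unfolding D_def k_def
      by (rule family_difference_asymptotics[OF sys sim carrier(1)]) (use b carrier z in auto)
    moreover have "- (s * k * leading_sum q B b v) / 2 > 0"
      using neg[OF b] \<open>k > 0\<close> mult_pos_neg[of k "s * leading_sum q B b v"] by (simp add: mult_ac)
    ultimately have "\<forall>\<^sub>F x in at_top. dist (D b x - k * leading_sum q B b (ln x)) 0
        < - (s * k * leading_sum q B b v) / 2"
      by (rule tendstoD)
    then show ?thesis by (simp add: dist_real_def)
  qed
  then have "\<forall>\<^sub>F x in at_top. \<forall>b\<in>S. \<bar>D b x - k * leading_sum q B b (ln x)\<bar> < - (s * k * leading_sum q B b v) / 2"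
    using \<open>finite S\<close> by (intro eventually_ball_finite) auto
  then obtain x1 where x1: "\<And>x b. x \<ge> x1 \<Longrightarrow> b \<in> S \<Longrightarrow>
      \<bar>D b x - k * leading_sum q B b (ln x)\<bar> < - (s * k * leading_sum q B b v) / 2"
    by (auto simp: eventually_at_top_linorder)
  define U where "U = ln (max 2 (max x0 x1))"
  obtain u where u: "u \<ge> U" "\<And>b. b \<in> S \<Longrightarrow> s * leading_sum q B b u \<le> s * leading_sum q B b v / 2"
    using leading_sums_recurrent[OF \<open>finite S\<close> z(2) neg s] by blast
  define x where "x = exp u"
  have "exp U \<le> x" using u by (simp add: x_def)
  then have x: "x \<ge> 2" "x \<ge> x0" "x \<ge> x1" by (auto simp: U_def)
  show thesis
  proof (rule that[OF x(2)])
    fix b assume b: "b \<in> S"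
    have "s * D b x \<le> k * (s * leading_sum q B b u) + \<bar>D b x - k * leading_sum q B b u\<bar>"
      using s by auto
    also have "\<dots> < k * (s * leading_sum q B b u) - s * k * leading_sum q B b v / 2"
      using x1[OF x(3) b] by (simp add: x_def)
    also have "\<dots> \<le> 0"
      using mult_left_mono[OF u(2)[OF b], of k] \<open>k > 0\<close> by (simp add: mult_ac)
    finally have "(s * (F 1 x - F b x)) * (ln x / x powr beta_diff q B b 1) < 0"
      by (simp add: D_def mult_ac)
    moreover have "ln x / x powr beta_diff q B b 1 > 0" using x by simp
    ultimately show "s * (F 1 x - F b x) < 0" by (simp only: mult_less_0_iff) auto
  qed
qed

section \<open>Subgroups of the reduced residues\<close>

lemma dirichlet_character_mod:
  assumes "dirichlet_character q \<psi>"
  shows "\<psi> (m mod int q) = \<psi> m"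
proof -
  have per: "\<psi> (m + int q) = \<psi> m" for m using assms by (simp add: dirichlet_character_def)
  have "\<psi> (m + int q * k) = \<psi> m" for m k
  proof (induction k rule: int_induct[of _ 0])
    case (step1 i)
    then show ?case using per[of "m + int q * i"] by (simp add: algebra_simps)
  next
    case (step2 i)
    then show ?case using per[of "m + int q * (i - 1)"] by (simp add: algebra_simps)
  qed simp
  from this[of "m mod int q" "m div int q"] show ?thesis by simp
qed

lemma carrier_reduced_residues:
  assumes "q > 1"
  shows "carrier (reduced_residues q) = {x. 0 < x \<and> x < int q \<and> coprime x (int q)}"
    and "group (reduced_residues q)"
    and "\<one>\<^bsub>reduced_residues q\<^esub> = 1"
    and "x \<otimes>\<^bsub>reduced_residues q\<^esub> y = x * y mod int q"
proof -
  interpret residues "int q" "residue_ring (int q)"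
    using assms by unfold_locales auto
  show "carrier (reduced_residues q) = {x. 0 < x \<and> x < int q \<and> coprime x (int q)}"
    by (simp add: units_of_carrier res_units_eq)
  show "group (reduced_residues q)" by (rule units_group)
  show "\<one>\<^bsub>reduced_residues q\<^esub> = 1"
    by (simp add: units_of_one res_one_eq)
  show "x \<otimes>\<^bsub>reduced_residues q\<^esub> y = x * y mod int q"
    by (simp add: units_of_mult res_mult_eq)
qed

text \<open>As \<open>g [^] 4\<close> is the neutral element, \<open>G\<close> consists of the first four powers of a generator \<open>g\<close>; they are distinct because \<open>G\<close>
has four elements. Characters are multiplicative also with respect to multiplication modulo \<open>q\<close>, by periodicity.\<close>

lemma cyclic_subgroup_of_order_4:
  assumes q: "q > 1" and sub: "subgroup G (reduced_residues q)"
    and cyc: "cyclic_group (reduced_residues q\<lparr>carrier := G\<rparr>)" and card: "card G = 4"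
  obtains g g2 g3 where "G - {1} = {g, g2, g3}" "quartic_cycle q g g2 g3"
proof -
  define H where "H = reduced_residues q\<lparr>carrier := G\<rparr>"
  interpret R: group "reduced_residues q" by (rule carrier_reduced_residues(2)[OF q])
  interpret H: group H unfolding H_def by (rule R.subgroup_imp_group[OF sub])
  have H: "carrier H = G" "\<one>\<^bsub>H\<^esub> = 1" "\<And>x y. x \<otimes>\<^bsub>H\<^esub> y = x * y mod int q"
    using carrier_reduced_residues(3,4)[OF q] by (simp_all add: H_def)
  obtain g where g: "g \<in> carrier H" "carrier H = range (\<lambda>n::int. g [^]\<^bsub>H\<^esub> n)"
    using cyc H.cyclic_group unfolding H_def[symmetric] by blast
  define e where "e k = g [^]\<^bsub>H\<^esub> (k::nat)" for k
  have e4: "e 4 = 1"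
    using H.pow_order_eq_1[OF g(1)] card by (simp add: e_def order_def H)
  have "G \<subseteq> e ` {..<4}"
  proof
    fix y assume "y \<in> G"
    then obtain n :: int where n: "y = g [^]\<^bsub>H\<^esub> n" using g(2) H(1) by auto
    have "n = 4 * (n div 4) + n mod 4" by simp
    then have "y = (g [^]\<^bsub>H\<^esub> (4::int)) [^]\<^bsub>H\<^esub> (n div 4) \<otimes>\<^bsub>H\<^esub> g [^]\<^bsub>H\<^esub> (n mod 4)"
      unfolding n using g(1) by (metis H.int_pow_mult H.int_pow_pow)
    also have "g [^]\<^bsub>H\<^esub> (4::int) = e 4"
      unfolding e_def by (simp add: int_pow_int[symmetric])
    also have "(e 4) [^]\<^bsub>H\<^esub> (n div 4) = \<one>\<^bsub>H\<^esub>" using e4 H(2) by (simp add: H.int_pow_one[unfolded H(2)])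
    also have "\<one>\<^bsub>H\<^esub> \<otimes>\<^bsub>H\<^esub> g [^]\<^bsub>H\<^esub> (n mod 4) = g [^]\<^bsub>H\<^esub> (n mod 4)"
      using g(1) by simp
    also have "\<dots> = e (nat (n mod 4))"
      unfolding e_def by (simp add: int_pow_int[symmetric])
    finally show "y \<in> e ` {..<4}" by auto
  qed
  also have "{..<4::nat} = {0, 1, 2, 3}" by auto
  finally have sub4: "G \<subseteq> {1, e 1, e 2, e 3}" by (simp add: e_def H(2))
  have mem: "{1, e 1, e 2, e 3} \<subseteq> G"
    using g(1) H.one_closed unfolding e_def H(1)[symmetric] H(2)[symmetric] by auto
  have G: "G = {1, e 1, e 2, e 3}" using sub4 mem by blast
  have "1 \<notin> {e 1, e 2, e 3}"
  proof
    assume "1 \<in> {e 1, e 2, e 3}"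
    then have "G = {e 1, e 2, e 3}" using G by auto
    then have "card G \<le> 3" using card_length[of "[e 1, e 2, e 3]"] by simp
    then show False using card by simp
  qed
  then have "G - {1} = {e 1, e 2, e 3}" using G by auto
  moreover have "quartic_cycle q (e 1) (e 2) (e 3)"
    unfolding quartic_cycle_def
  proof (intro allI impI)
    fix \<psi> assume \<psi>: "dirichlet_character q \<psi>"
    have "\<psi> (e k) = \<psi> g ^ k" for k
    proof (induction k)
      case 0
      then show ?case using dirichlet_character_1[OF \<psi>] by (simp add: e_def H(2))
    next
      case (Suc k)
      have "\<psi> (e k * g) = \<psi> (e k) * \<psi> g" using \<psi> by (simp add: dirichlet_character_def)
      then show ?case
        using Suc dirichlet_character_mod[OF \<psi>, of "e k * g"] by (simp add: e_def H(3))
    qed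
    from this[of 1] this[of 2] this[of 3] this[of 4]
    show "\<psi> (e 1) ^ 4 = 1 \<and> \<psi> (e 2) = \<psi> (e 1) ^ 2 \<and> \<psi> (e 3) = \<psi> (e 1) ^ 3"
      using e4 dirichlet_character_1[OF \<psi>] by simp
  qed
  ultimately show thesis by (rule that)
qed

section \<open>Barriers\<close>

lemma threshold_pos: "n \<ge> 1 \<Longrightarrow> threshold n > 0"
  by (simp add: threshold_def)

text \<open>Elements \<open>b\<close> with empty \<open>z(b, 1)\<close> have no leading sum and are left out. This can only concern \<open>g2\<close>, and happens in the
application to \<open>q = 5\<close> and \<open>q = 10\<close>.\<close>

lemma quartic_family_frequently_negative:
  fixes s :: real
  assumes sys: "is_system q B" and sim: "similar_family q (R_minus q B) F B"
    and cyc: "quartic_cycle q g g2 g3" and q: "q > 1"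
    and carrier: "{g, g2, g3} \<subseteq> carrier (reduced_residues q)"
    and z: "z_diff q B g 1 \<noteq> {}" "finite (z_diff q B g 1 \<union> z_diff q B g2 1)"
      "card (z_diff q B g 1 \<union> z_diff q B g2 1) \<le> n"
    and im: "\<And>\<rho>. \<rho> \<in> z_diff q B g 1 \<union> z_diff q B g2 1 \<Longrightarrow> Im \<rho> \<ge> real (threshold n)"
    and s: "s \<in> {1, -1}"
  shows "\<exists>x\<ge>x0. \<forall>b\<in>{g, g2, g3}. z_diff q B b 1 \<noteq> {} \<longrightarrow> s * (F 1 x - F b x) < 0"
proof -
  define S where "S = {b \<in> {g, g2, g3}. z_diff q B b 1 \<noteq> {}}"
  obtain u where u: "s * leading_sum q B g u < 0" "s * leading_sum q B g3 u < 0"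
    "z_diff q B g2 1 \<noteq> {} \<Longrightarrow> s * leading_sum q B g2 u < 0"
    using leading_sums_same_sign[OF sys cyc z im s] by blast
  have "card (z_diff q B g 1 \<union> z_diff q B g2 1) > 0" using z by (simp add: card_gt_0_iff)
  then have "threshold n > 0" using z(3) by (intro threshold_pos) linarith
  then have pos: "Im \<rho> > 0" if "\<rho> \<in> z_diff q B g 1 \<union> z_diff q B g2 1" for \<rho>
    using im[OF that] by linarith
  have z3: "z_diff q B g3 1 = z_diff q B g 1"
    by (auto simp: z_diff_iff beta_diff_def g_diff_quartic_cycle(1)[OF cyc])
  have "1 \<in> carrier (reduced_residues q)"
    using q by (simp add: carrier_reduced_residues)
  then obtain x where x: "x \<ge> x0" "\<And>b. b \<in> S \<Longrightarrow> s * (F 1 x - F b x) < 0"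
  proof (rule family_differences_frequently_negative[OF sys sim _ _ _ _ _ _ _ _ s])
    show "s * leading_sum q B b u < 0" if "b \<in> S" for b using that u by (auto simp: S_def)
    show "Im \<rho> > 0" if "b \<in> S" "\<rho> \<in> z_diff q B b 1" for b \<rho>
      using that pos z3 by (auto simp: S_def)
    show "finite (z_diff q B b 1)" if "b \<in> S" for b using that z z3 by (auto simp: S_def)
  qed (use carrier q in \<open>auto simp: S_def\<close>)
  then show ?thesis by (intro exI[of _ x]) (auto simp: S_def)
qed

lemma quartic_subgroup_barrier:
  assumes "q \<ge> 5" and sub: "subgroup G (reduced_residues q)"
    and cyc: "cyclic_group (reduced_residues q\<lparr>carrier := G\<rparr>)" and card: "card G = 4"
    and sys: "is_system q B" and z: "\<And>a. a \<in> G - {1} \<Longrightarrow> z_diff q B a 1 \<noteq> {}"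
    and im: "\<And>\<rho>. \<rho> \<in> (\<Union>a\<in>G - {1}. z_diff q B a 1) \<Longrightarrow> Im \<rho> \<ge> real (threshold n)"
    and fin: "finite (\<Union>a\<in>G - {1}. z_diff q B a 1)"
    and n: "card (\<Union>a\<in>G - {1}. z_diff q B a 1) \<le> n"
  shows "barrier q (\<lambda>F. eventually (\<lambda>x. \<exists>a\<in>G - {1}. F 1 x \<ge> F a x) at_top) B"
    and "barrier q (\<lambda>F. eventually (\<lambda>x. \<exists>a\<in>G - {1}. F 1 x \<le> F a x) at_top) B"
proof -
  have q: "q > 1" using assms by simp
  obtain g g2 g3 where G: "G - {1} = {g, g2, g3}" and quart: "quartic_cycle q g g2 g3"
    using cyclic_subgroup_of_order_4[OF q sub cyc card] by blast
  have "G \<subseteq> carrier (reduced_residues q)" using sub by (rule subgroup.subset)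
  then have carrier: "{g, g2, g3} \<subseteq> carrier (reduced_residues q)" using G by blast
  have z3: "z_diff q B g3 1 = z_diff q B g 1"
    by (auto simp: z_diff_iff beta_diff_def g_diff_quartic_cycle(1)[OF quart])
  have Z: "(\<Union>a\<in>G - {1}. z_diff q B a 1) = z_diff q B g 1 \<union> z_diff q B g2 1"
    unfolding G using z3 by auto
  have freq: "\<exists>x\<ge>x0. \<forall>a\<in>G - {1}. s * (F 1 x - F a x) < 0"
    if "similar_family q (R_minus q B) F B" "s \<in> {1, -1}" for F x0 and s :: real
    using quartic_family_frequently_negative[OF sys that(1) quart q carrier z[unfolded G]
        fin[unfolded Z] n[unfolded Z] im[unfolded Z] that(2), of x0] z
    unfolding G by simp
  have "\<not> eventually (\<lambda>x. \<exists>a\<in>G - {1}. F 1 x \<ge> F a x) at_top"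
    "\<not> eventually (\<lambda>x. \<exists>a\<in>G - {1}. F 1 x \<le> F a x) at_top"
    if sim: "similar_family q (R_minus q B) F B" for F
  proof -
    have "\<exists>x\<ge>x0. \<forall>a\<in>G - {1}. F 1 x < F a x" "\<exists>x\<ge>x0. \<forall>a\<in>G - {1}. F 1 x > F a x" for x0
      using freq[OF sim, of 1 x0] freq[OF sim, of "-1" x0] by simp_all
    then show "\<not> eventually (\<lambda>x. \<exists>a\<in>G - {1}. F 1 x \<ge> F a x) at_top"
      "\<not> eventually (\<lambda>x. \<exists>a\<in>G - {1}. F 1 x \<le> F a x) at_top"
      unfolding eventually_at_top_linorder by (meson not_le)+
  qed
  then show "barrier q (\<lambda>F. eventually (\<lambda>x. \<exists>a\<in>G - {1}. F 1 x \<ge> F a x) at_top) B"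
    "barrier q (\<lambda>F. eventually (\<lambda>x. \<exists>a\<in>G - {1}. F 1 x \<le> F a x) at_top) B"
    using sys by (auto simp: barrier_def)
qed

text \<open>The generators are \<open>2\<close> modulo \<open>5\<close> and \<open>3\<close> modulo \<open>10\<close>.\<close>

lemma quartic_residues_5_10:
  assumes "q = 5 \<and> (g, g2, g3) = (2, 4, 3) \<or> q = 10 \<and> (g, g2, g3) = (3, 9, 7)"
  shows "quartic_cycle q g g2 g3" and "carrier (reduced_residues q) = {1, g, g2, g3}"
    and "1 \<notin> {g, g2, g3}"
proof -
  have "q > 1" using assms by auto
  have 5: "0 < x \<and> x < 5 \<and> coprime x 5 \<longleftrightarrow> x \<in> {1, 2, 4, 3}" for x :: int
  proof -
    have "x \<in> {1, 2, 3, 4}" if "0 < x" "x < 5" using that by auto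
    moreover have "coprime (2::int) 5" "coprime (3::int) 5" "coprime (4::int) 5"
      by (simp_all add: coprime_iff_gcd_eq_1 gcd_code_int)
    ultimately show ?thesis by auto
  qed
  have 10: "0 < x \<and> x < 10 \<and> coprime x 10 \<longleftrightarrow> x \<in> {1, 3, 9, 7}" for x :: int
  proof -
    have "x \<in> {1, 2, 3, 4, 5, 6, 7, 8, 9}" if "0 < x" "x < 10" using that by auto
    moreover have "coprime (3::int) 10" "coprime (7::int) 10" "coprime (9::int) 10"
      "\<not> coprime (2::int) 10" "\<not> coprime (4::int) 10" "\<not> coprime (5::int) 10"
      "\<not> coprime (6::int) 10" "\<not> coprime (8::int) 10"
      by (simp_all add: coprime_iff_gcd_eq_1 gcd_code_int)
    ultimately show ?thesis by auto
  qed
  show "carrier (reduced_residues q) = {1, g, g2, g3}"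
    using assms
  proof
    assume "q = 5 \<and> (g, g2, g3) = (2, 4, 3)"
    then show ?thesis
      unfolding carrier_reduced_residues(1)[OF \<open>q > 1\<close>] by (simp add: 5 set_eq_iff)
  next
    assume "q = 10 \<and> (g, g2, g3) = (3, 9, 7)"
    then show ?thesis
      unfolding carrier_reduced_residues(1)[OF \<open>q > 1\<close>] by (simp add: 10 set_eq_iff)
  qed
  show "1 \<notin> {g, g2, g3}" using assms by auto
  show "quartic_cycle q g g2 g3"
    unfolding quartic_cycle_def
  proof (intro allI impI)
    fix \<psi> assume \<psi>: "dirichlet_character q \<psi>"
    have mult: "\<psi> (m * n) = \<psi> m * \<psi> n" for m n using \<psi> by (simp add: dirichlet_character_def)
    have pow: "\<psi> (m ^ k) = \<psi> m ^ k" for m k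
      by (induction k) (simp_all add: mult dirichlet_character_1[OF \<psi>])
    have eq: "\<psi> m = \<psi> n" if "m mod int q = n mod int q" for m n
      using dirichlet_character_mod[OF \<psi>, of m] dirichlet_character_mod[OF \<psi>, of n] that by simp
    have "\<psi> (g ^ 4) = \<psi> 1" "\<psi> g2 = \<psi> (g ^ 2)" "\<psi> g3 = \<psi> (g ^ 3)"
      using assms by (auto intro!: eq)
    then show "\<psi> g ^ 4 = 1 \<and> \<psi> g2 = \<psi> g ^ 2 \<and> \<psi> g3 = \<psi> g ^ 3"
      by (simp add: pow dirichlet_character_1[OF \<psi>])
  qed
qed

lemma character_determined_by_generator:
  assumes "q > 1" and cyc: "quartic_cycle q g g2 g3"
    and carrier: "carrier (reduced_residues q) = {1, g, g2, g3}"
    and \<psi>: "dirichlet_character q \<psi>" and \<xi>: "dirichlet_character q \<xi>" and eq: "\<psi> g = \<xi> g"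
  shows "\<psi> = \<xi>"
proof
  fix m
  show "\<psi> m = \<xi> m"
  proof (cases "coprime m (int q)")
    case False
    then show ?thesis using \<psi> \<xi> by (metis dirichlet_character_def)
  next
    case True
    have gen: "\<theta> 1 = 1 \<and> \<theta> g2 = \<theta> g ^ 2 \<and> \<theta> g3 = \<theta> g ^ 3" if "dirichlet_character q \<theta>" for \<theta>
      using cyc that dirichlet_character_1[OF that] unfolding quartic_cycle_def by blast
    have "m mod int q \<noteq> 0"
    proof
      assume "m mod int q = 0"
      then have "int q dvd m" by auto
      then have "is_unit (int q)" using True by (meson coprime_common_divisor dvd_refl)
      then show False using \<open>q > 1\<close> by simp
    qed
    moreover have "coprime (m mod int q) (int q)" using True \<open>q > 1\<close> by simp
    moreover have "0 \<le> m mod int q" "m mod int q < int q" using \<open>q > 1\<close> by simp_all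
    ultimately have "m mod int q \<in> {1, g, g2, g3}"
      unfolding carrier[symmetric] carrier_reduced_residues(1)[OF \<open>q > 1\<close>] by simp
    then have "\<psi> (m mod int q) = \<xi> (m mod int q)"
      using eq gen[OF \<psi>] gen[OF \<xi>] by auto
    then show ?thesis by (simp add: dirichlet_character_mod[OF \<psi>] dirichlet_character_mod[OF \<xi>])
  qed
qed

lemma principal_character_is_character:
  "q > 0 \<Longrightarrow> dirichlet_character q (principal_character q)"
proof -
  have "coprime (m + int q) (int q) \<longleftrightarrow> coprime m (int q)" for m
    by (simp only: coprime_iff_gcd_eq_1 gcd_add1)
  then show ?thesis
    by (simp add: dirichlet_character_def principal_character_def)
qed

text \<open>In a finite system the supremum defining \<open>\<beta>(a, b)\<close> is a maximum.\<close>

lemma z_diff_nonempty: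
  assumes "finite (system_points q B)" "g_diff q B \<rho> a b \<noteq> 0"
  shows "z_diff q B a b \<noteq> {}"
proof -
  define N where "N = {\<rho>. g_diff q B \<rho> a b \<noteq> 0}"
  have "N \<subseteq> system_points q B" unfolding N_def
    using g_diff_nonzero_imp_point[of q B _ a b] by (intro subsetI) simp
  then have N: "finite (Re ` N)" "Re ` N \<noteq> {}"
    using assms finite_subset by (auto simp: N_def)
  have "beta_diff q B a b = Sup (Re ` N)"
    unfolding beta_diff_def N_def by (rule arg_cong[of _ _ Sup]) auto
  then have "beta_diff q B a b = Max (Re ` N)" using N by (simp add: cSup_eq_Max)
  then obtain \<rho>' where "\<rho>' \<in> N" "Re \<rho>' = beta_diff q B a b" using Max_in[OF N] by auto
  then show ?thesis using z_diff_iff[of \<rho>' q B a b] by (auto simp: N_def)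
qed

lemma card_system_points_le:
  assumes "finite (nonprincipal_characters q)"
    and "\<And>\<psi>. \<psi> \<in> nonprincipal_characters q \<Longrightarrow> finite_seq (B \<psi>)"
  shows "finite (system_points q B)" "card (system_points q B) \<le> system_size q B"
proof -
  have *: "finite (seq_points (B \<psi>)) \<and> card (seq_points (B \<psi>)) \<le> seq_length (B \<psi>)"
    if "\<psi> \<in> nonprincipal_characters q" for \<psi>
    using assms(2)[OF that] by (cases "B \<psi>") (auto simp: card_length)
  then show "finite (system_points q B)" using assms by (auto simp: system_points_def)
  have "card (system_points q B) \<le> (\<Sum>\<psi>\<in>nonprincipal_characters q. card (seq_points (B \<psi>)))"
    unfolding system_points_def using assms(1) by (rule card_UN_le)
  also have "\<dots> \<le> system_size q B" unfolding system_size_def using * by (intro sum_mono) auto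
  finally show "card (system_points q B) \<le> system_size q B" .
qed

text \<open>The value of a nonprincipal character at the generator is a fourth root of unity different from \<open>1\<close>. So every character
at which \<open>\<rho>\<close> occurs makes a contribution with negative real part, and there is no cancellation.\<close>

lemma g_diff_generator_nonzero:
  assumes "q > 1" and cyc: "quartic_cycle q g g2 g3"
    and carrier: "carrier (reduced_residues q) = {1, g, g2, g3}"
    and fin: "finite (nonprincipal_characters q)"
    and sys: "is_system q B" and \<rho>: "\<rho> \<in> system_points q B"
  shows "g_diff q B \<rho> g 1 \<noteq> 0"
proof -
  let ?C = "nonprincipal_characters q"
  have char: "dirichlet_character q \<psi>" "\<psi> g ^ 4 = 1" "\<psi> g \<noteq> 1" if "\<psi> \<in> ?C" for \<psi>
  proof -
    show \<psi>: "dirichlet_character q \<psi>" using that by (simp add: nonprincipal_characters_def)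
    then show "\<psi> g ^ 4 = 1" using cyc by (simp add: quartic_cycle_def)
    have "principal_character q g = 1"
    proof -
      have "g \<in> carrier (reduced_residues q)" by (simp add: carrier)
      then show ?thesis
        by (simp add: carrier_reduced_residues(1)[OF \<open>q > 1\<close>] principal_character_def)
    qed
    then show "\<psi> g \<noteq> 1"
      using character_determined_by_generator[OF \<open>q > 1\<close> cyc carrier \<psi>
          principal_character_is_character] \<open>q > 1\<close> that
      by (auto simp: nonprincipal_characters_def)
  qed
  have neg: "Re (\<psi> g) - 1 < 0" if "\<psi> \<in> ?C" for \<psi>
    using fourth_root_of_unity_cases[OF char(2)[OF that]] char(3)[OF that] by auto
  obtain \<psi> where \<psi>: "\<psi> \<in> ?C" "\<rho> \<in> seq_points (B \<psi>)" using \<rho> by (auto simp: system_points_def)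
  then have "finite (occurrences (B \<psi>) \<rho>)" using sys by (simp add: is_system_def)
  moreover have "occurrences (B \<psi>) \<rho> \<noteq> {}"
    using \<psi>(2) by (cases "B \<psi>") (auto simp: in_set_conv_nth)
  ultimately have "multiplicity_in B \<rho> \<psi> > 0" by (simp add: multiplicity_in_def card_gt_0_iff)
  have "Re (g_diff q B \<rho> g 1) = (\<Sum>\<psi>\<in>?C. real (multiplicity_in B \<rho> \<psi>) * (Re (\<psi> g) - 1))"
    unfolding g_diff_def Re_sum
    by (intro sum.cong refl) (simp add: dirichlet_character_1[OF char(1)])
  also have "\<dots> < (\<Sum>\<psi>\<in>?C. 0)"
    using neg \<psi> \<open>multiplicity_in B \<rho> \<psi> > 0\<close> fin
    by (intro sum_strict_mono_ex1) (auto simp: mult_le_0_iff mult_less_0_iff less_imp_le intro!: bexI[of _ \<psi>])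
  finally show ?thesis by auto
qed

text \<open>The family \<open>F\<close> which refutes the barrier is the model with the function at \<open>1\<close> moved slightly in the direction of \<open>- s\<close>.
For residues with nonempty \<open>z(b, 1)\<close> the sign analysis applies to every similar family and thus to \<open>F\<close>; for the others the
model functions at \<open>1\<close> and \<open>b\<close> agree and the shift decides.\<close>

lemma no_bounded_barrier_modulo_5_10:
  fixes s :: real
  assumes q: "q \<in> {5, 10}" and s: "s \<in> {1, -1}"
  shows "\<not> possesses_bounded_barrier q (\<lambda>F. \<not> bdd_above
      {x. x \<ge> 0 \<and> (\<forall>a\<in>carrier (reduced_residues q) - {1}. s * (F 1 x - F a x) < 0)})"
    (is "\<not> possesses_bounded_barrier q ?I")
proof
  assume "possesses_bounded_barrier q ?I"
  then obtain K where K: "\<forall>\<tau>>0. \<exists>B. barrier q ?I B \<and>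
        (\<forall>\<psi>\<in>nonprincipal_characters q. finite_seq (B \<psi>)) \<and>
        system_size q B \<le> K \<and> (\<forall>\<rho>\<in>system_points q B. Im \<rho> \<ge> \<tau>)"
    unfolding possesses_bounded_barrier_def by (elim exE)
  define n where "n = max K 1"
  have "real (threshold n) > 0" using threshold_pos[of n] by (simp add: n_def)
  with K obtain B where barrier: "barrier q ?I B"
    and finseqs: "\<forall>\<psi>\<in>nonprincipal_characters q. finite_seq (B \<psi>)"
    and size: "system_size q B \<le> K"
    and ims: "\<forall>\<rho>\<in>system_points q B. Im \<rho> \<ge> real (threshold n)"
    by (elim allE[of _ "real (threshold n)"] impE exE conjE) simp_all
  note finseq = bspec[OF finseqs] and im = bspec[OF ims]
  have sys: "is_system q B" using barrier by (simp add: barrier_def)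
  have "q > 1" using q by auto
  obtain g g2 g3 :: int where "q = 5 \<and> (g, g2, g3) = (2, 4, 3) \<or> q = 10 \<and> (g, g2, g3) = (3, 9, 7)"
    using q by auto
  note cyc = quartic_residues_5_10(1)[OF this] and carrier = quartic_residues_5_10(2)[OF this]
    and g1 = quartic_residues_5_10(3)[OF this]
  have fin: "finite (nonprincipal_characters q)"
  proof (rule inj_on_finite)
    show "inj_on (\<lambda>\<psi>. \<psi> g) (nonprincipal_characters q)"
      using character_determined_by_generator[OF \<open>q > 1\<close> cyc carrier]
      by (auto simp: inj_on_def nonprincipal_characters_def)
    show "(\<lambda>\<psi>. \<psi> g) ` nonprincipal_characters q \<subseteq> {1, - 1, \<i>, - \<i>}"
      using cyc fourth_root_of_unity_cases
      by (auto simp: nonprincipal_characters_def quartic_cycle_def)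
  qed simp
  note points = card_system_points_le[OF fin, of B, OF finseq]
  obtain \<rho>0 where "\<rho>0 \<in> system_points q B" using sys by (auto simp: is_system_def)
  note zg = z_diff_nonempty[OF points(1)
      g_diff_generator_nonzero[OF \<open>q > 1\<close> cyc carrier fin sys this]]
  have Z: "z_diff q B g 1 \<union> z_diff q B g2 1 \<subseteq> system_points q B"
    using z_diff_subset by blast
  have Zfin: "finite (z_diff q B g 1 \<union> z_diff q B g2 1)"
    using Z points(1) by (rule finite_subset)
  have Zcard: "card (z_diff q B g 1 \<union> z_diff q B g2 1) \<le> n"
    using card_mono[OF points(1) Z] points(2) size by (simp add: n_def)
  define r where "r = R_minus q B"
  \<comment> \<open>smaller than the tolerance \<open>x powr r / ln x\<close> of similarity by a factor \<open>ln x\<close>\<close>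
  define F :: family where "F b x = model_count q B b x
      - (if b = 1 then s * (x powr r / (ln x)\<^sup>2) else 0)" for b x
  have sim: "similar_family q r F B"
    unfolding similar_family_def
  proof
    fix a
    have "(\<lambda>x::real. x powr r / (ln x)\<^sup>2) \<in> o[at_top](\<lambda>x. x powr r / ln x)"
      by real_asymp
    then show "(\<lambda>x. \<bar>F a x - model_count q B a x\<bar>) \<in> o[at_top](\<lambda>x. x powr r / ln x)"
      using s by (cases "a = 1") (auto simp: F_def abs_mult)
  qed
  have shifted: "s * (F 1 x - F b x) < 0"
    if "z_diff q B b 1 = {}" "b \<noteq> 1" "x \<ge> 2" for b x
  proof -
    have "g_diff q B \<rho> b 1 = 0" for \<rho>
      using z_diff_nonempty[OF points(1), of \<rho> b 1] that(1) by blast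
    then have "model_count q B 1 x - model_count q B b x = 0"
      using model_difference(1)[OF sys \<open>x \<ge> 2\<close>, of b] by simp
    then have "s * (F 1 x - F b x) = - (s * s * (x powr r / (ln x)\<^sup>2))"
      using \<open>b \<noteq> 1\<close> by (simp add: F_def)
    moreover have "x powr r / (ln x)\<^sup>2 > 0" using \<open>x \<ge> 2\<close> by simp
    ultimately show ?thesis using s by auto
  qed
  have "?I F"
  proof
    assume "bdd_above {x. x \<ge> 0 \<and> (\<forall>a\<in>carrier (reduced_residues q) - {1}. s * (F 1 x - F a x) < 0)}"
    then obtain M where M: "\<And>x. x \<ge> 0 \<Longrightarrow>
        (\<forall>a\<in>carrier (reduced_residues q) - {1}. s * (F 1 x - F a x) < 0) \<Longrightarrow> x \<le> M"
      unfolding bdd_above_def by blast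
    have "{g, g2, g3} \<subseteq> carrier (reduced_residues q)" by (auto simp: carrier)
    from quartic_family_frequently_negative[OF sys sim[unfolded r_def] cyc \<open>q > 1\<close> this zg Zfin
          Zcard im[OF subsetD[OF Z]] s, of "max 2 (M + 1)"]
    obtain x where x: "x \<ge> max 2 (M + 1)"
      "\<And>b. b \<in> {g, g2, g3} \<Longrightarrow> z_diff q B b 1 \<noteq> {} \<Longrightarrow> s * (F 1 x - F b x) < 0"
      by blast
    have "s * (F 1 x - F b x) < 0" if "b \<in> {g, g2, g3}" for b
      using x(2)[OF that] shifted[of b x] x(1) that g1 by (cases "z_diff q B b 1 = {}") auto
    then have "x \<le> M" using x(1) by (intro M) (auto simp: carrier)
    then show False using x(1) by simp
  qed
  moreover have "\<forall>F. similar_family q (R_minus q B) F B \<longrightarrow> \<not> ?I F"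
    using barrier unfolding barrier_def by (rule conjunct2)
  then have "\<not> ?I F" using sim unfolding r_def by (elim allE[of _ F] impE)
  ultimately show False by (rule notE[rotated])
qed

theorem theorem3p9:
  shows
    "(\<exists>\<tau> :: nat \<Rightarrow> real. computable_real_seq \<tau> \<and>
       (\<forall>n\<ge>1. \<forall>(q :: nat) (G :: int set) (B :: system).
          q \<ge> 5 \<longrightarrow>
          subgroup G (reduced_residues q) \<longrightarrow>
          cyclic_group (reduced_residues q\<lparr>carrier := G\<rparr>) \<longrightarrow>
          card G = 4 \<longrightarrow>
          is_system q B \<longrightarrow>
          (\<forall>a\<in>G - {1}. z_diff q B a 1 \<noteq> {}) \<longrightarrow>
          (\<forall>\<rho>\<in>(\<Union>a\<in>G - {1}. z_diff q B a 1). Im \<rho> \<ge> \<tau> n) \<longrightarrow>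
          finite (\<Union>a\<in>G - {1}. z_diff q B a 1) \<longrightarrow>
          card (\<Union>a\<in>G - {1}. z_diff q B a 1) \<le> n \<longrightarrow>
          barrier q (\<lambda>F. eventually (\<lambda>x. \<exists>a\<in>G - {1}. F 1 x \<ge> F a x) at_top) B \<and>
          barrier q (\<lambda>F. eventually (\<lambda>x. \<exists>a\<in>G - {1}. F 1 x \<le> F a x) at_top) B))
     \<and>
     (\<forall>q :: nat. q \<in> {5, 10} \<longrightarrow>
        \<not> possesses_bounded_barrier q (\<lambda>F. \<not> bdd_above
             {x. x \<ge> 0 \<and> (\<forall>a\<in>carrier (reduced_residues q) - {1}. F 1 x < F a x)}) \<and>
        \<not> possesses_bounded_barrier q (\<lambda>F. \<not> bdd_above
             {x. x \<ge> 0 \<and> (\<forall>a\<in>carrier (reduced_residues q) - {1}. F 1 x > F a x)}))"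
proof (intro conjI allI impI)
  show "\<exists>\<tau> :: nat \<Rightarrow> real. computable_real_seq \<tau> \<and>
       (\<forall>n\<ge>1. \<forall>(q :: nat) (G :: int set) (B :: system).
          q \<ge> 5 \<longrightarrow>
          subgroup G (reduced_residues q) \<longrightarrow>
          cyclic_group (reduced_residues q\<lparr>carrier := G\<rparr>) \<longrightarrow>
          card G = 4 \<longrightarrow>
          is_system q B \<longrightarrow>
          (\<forall>a\<in>G - {1}. z_diff q B a 1 \<noteq> {}) \<longrightarrow>
          (\<forall>\<rho>\<in>(\<Union>a\<in>G - {1}. z_diff q B a 1). Im \<rho> \<ge> \<tau> n) \<longrightarrow>
          finite (\<Union>a\<in>G - {1}. z_diff q B a 1) \<longrightarrow>
          card (\<Union>a\<in>G - {1}. z_diff q B a 1) \<le> n \<longrightarrow>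
          barrier q (\<lambda>F. eventually (\<lambda>x. \<exists>a\<in>G - {1}. F 1 x \<ge> F a x) at_top) B \<and>
          barrier q (\<lambda>F. eventually (\<lambda>x. \<exists>a\<in>G - {1}. F 1 x \<le> F a x) at_top) B)"
  proof (intro exI[of _ "\<lambda>n. real (threshold n)"] conjI computable_threshold allI impI)
    fix n q :: nat and G :: "int set" and B :: system
    assume hyps: "q \<ge> 5" "subgroup G (reduced_residues q)"
      "cyclic_group (reduced_residues q\<lparr>carrier := G\<rparr>)" "card G = 4" "is_system q B"
      and z: "\<forall>a\<in>G - {1}. z_diff q B a 1 \<noteq> {}"
      and im: "\<forall>\<rho>\<in>(\<Union>a\<in>G - {1}. z_diff q B a 1). Im \<rho> \<ge> real (threshold n)"
      and fin: "finite (\<Union>a\<in>G - {1}. z_diff q B a 1)"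
        "card (\<Union>a\<in>G - {1}. z_diff q B a 1) \<le> n"
    note barriers = quartic_subgroup_barrier[OF hyps bspec[OF z] bspec[OF im] fin]
    show "barrier q (\<lambda>F. eventually (\<lambda>x. \<exists>a\<in>G - {1}. F 1 x \<ge> F a x) at_top) B"
      by (rule barriers(1))
    show "barrier q (\<lambda>F. eventually (\<lambda>x. \<exists>a\<in>G - {1}. F 1 x \<le> F a x) at_top) B"
      by (rule barriers(2))
  qed
next
  fix q :: nat assume "q \<in> {5, 10}"
  from no_bounded_barrier_modulo_5_10[OF this, of 1] no_bounded_barrier_modulo_5_10[OF this, of "-1"]
  show "\<not> possesses_bounded_barrier q (\<lambda>F. \<not> bdd_above
             {x. x \<ge> 0 \<and> (\<forall>a\<in>carrier (reduced_residues q) - {1}. F 1 x < F a x)})"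
    "\<not> possesses_bounded_barrier q (\<lambda>F. \<not> bdd_above
             {x. x \<ge> 0 \<and> (\<forall>a\<in>carrier (reduced_residues q) - {1}. F 1 x > F a x)})"
    by simp_all
qed

end
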